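(* For a point of $\mathbb{P}(\lambda,\mu,\nu)$ represented by $(X,Y,Z)$, put $L(z)=(Y-Z)z+(Y+Z)$. Conjugate so that $Y-Z$ is diagonal, with eigenvalues $\alpha_1,\alpha_2,\alpha_3$, so that $L(z)=\operatorname{diag}(\alpha_1,\alpha_2,\alpha_3)\,z+(s_{j,k})_{1\le j,k\le 3}$. Let $\widetilde L(z,\eta)$ be the matrix of cofactors of $L(z)-\eta I$, so that $(L(z)-\eta I)\widetilde L(z,\eta)=\rho(z,\eta)I$ with $\rho(z,\eta)=\det(L(z)-\eta I)$. The two off-diagonal entries of the first column of $\widetilde L(z,\eta)$ are the functions, linear in $z,\eta$, $$\widetilde L_{2,1}(z,\eta)=-s_{2,1}(\alpha_3z-\eta+s_{3,3})+s_{3,1}s_{2,3},\qquad \widetilde L_{3,1}(z,\eta)=-s_{3,1}(\alpha_2z-\eta+s_{2,2})+s_{2,1}s_{3,2}.$$ Setting both of them equal to zero and solving, one obtains a unique solution $(z_0,\eta_0)$, and $\widetilde L_{1,1}(z_0,\eta_0)$ also vanishes. Setting $$\zeta_0=\frac{\eta_0}{z_0(z_0^2-1)},$$ $z_0,\zeta_0$ are Darboux coordinates on $\mathbb{P}(\lambda,\mu,\nu)$.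
   Context: $\lambda,\mu,\nu$ are diagonal traceless $3\times3$ matrices with real eigenvalues, so that $i\lambda,i\mu,i\nu\in\mathfrak{su}(3)$, and $\mathcal{O}_{i\lambda},\mathcal{O}_{i\mu},\mathcal{O}_{i\nu}$ are their orbits under the adjoint action of $\mathrm{SU}(3)$ on $\mathfrak{su}(3)$, viewed as coadjoint orbits. The triple reduced product $\mathbb{P}(\lambda,\mu,\nu)$ is the symplectic quotient $M^{-1}(0)/\mathrm{SU}(3)$ of $\mathcal{O}_{i\lambda}\times\mathcal{O}_{i\mu}\times\mathcal{O}_{i\nu}$ by the diagonal adjoint action, where $M(X,Y,Z)=X+Y+Z$ is the moment map. It is identified symplectically with the space of Higgs fields $\Phi(z)=\frac{X}{z}+\frac{Y}{z-1}+\frac{Z}{z+1}$ on the trivial bundle over $\mathbb{P}^1$ with $X\in\mathcal{O}_{i\lambda}$, $Y\in\mathcal{O}_{i\mu}$, $Z\in\mathcal{O}_{i\nu}$ and $X+Y+Z=0$, modulo conjugation by $\mathrm{SU}(3)$; then $L(z)=z(z^2-1)\Phi(z)=(Y-Z)z+(Y+Z)$.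
   Formalization: Uniqueness is stated where α2≠α3, s21≠0, s31≠0; the Darboux coordinates are claimed on the open set of points with distinct α's (numbering fixed), s21, s31≠0 and z0≠0,±1, where z0, ζ0 are well defined. *)

theory Defs
  imports "HOL-Analysis.Analysis"
begin

section \<open>Matrices\<close>

type_synonym cmat3 = "complex^3^3"
type_synonym triple = "cmat3 \<times> cmat3 \<times> cmat3"

definition diag_mat :: "complex^3 \<Rightarrow> cmat3" where
  "diag_mat a = (\<chi> i j. if i = j then a $ i else 0)"

definition hermitian_adjoint :: "cmat3 \<Rightarrow> cmat3" where
  "hermitian_adjoint A = (\<chi> i j. cnj (A $ j $ i))"

text \<open>The entry \<open>(i, j)\<close> is the cofactor of \<open>A\<close> at the position \<open>(j, i)\<close>: the determinant of
  \<open>A\<close> with row \<open>j\<close> replaced by the \<open>i\<close>-th unit row. Hence the product of \<open>A\<close> and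
  \<open>cofactor_matrix A\<close>, in this order, is \<open>mat (det A)\<close>.\<close>
definition cofactor_matrix :: "cmat3 \<Rightarrow> cmat3" where
  "cofactor_matrix A =
     (\<chi> i j. det (\<chi> k l. if k = j then (if l = i then 1 else 0) else A $ k $ l))"

definition commutator :: "cmat3 \<Rightarrow> cmat3 \<Rightarrow> cmat3" where
  "commutator A B = A ** B - B ** A"

definition SU3 :: "cmat3 set" where
  "SU3 = {g. g ** hermitian_adjoint g = mat 1 \<and> det g = 1}"

definition su3 :: "cmat3 set" where
  "su3 = {A. hermitian_adjoint A = - A \<and> trace A = 0}"

text \<open>For \<open>g \<in> SU3\<close> the Hermitian adjoint is the inverse.\<close>
definition Ad :: "cmat3 \<Rightarrow> cmat3 \<Rightarrow> cmat3" where
  "Ad g A = g ** A ** hermitian_adjoint g"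

section \<open>Orbits and the Kirillov-Kostant-Souriau form\<close>

text \<open>A real diagonal matrix is given by its diagonal \<open>lam\<close>; this is the orbit of \<open>\<i>\<close> times it.\<close>
definition orbit :: "real^3 \<Rightarrow> cmat3 set" where
  "orbit lam = {Ad g (diag_mat (\<chi> j. \<i> * complex_of_real (lam $ j))) | g. g \<in> SU3}"

text \<open>\<open>su3\<close> is identified with its dual by the trace pairing \<open>Re (trace (A ** B))\<close>
  (\<open>trace (A ** B)\<close> is real on \<open>su3\<close>), and the sign of the form is that of
  \<open>\<omega>([A,X],[B,X]) = \<langle>X,[A,B]\<rangle>\<close>. With these conventions the inclusion of an orbit in \<open>su3\<close> is
  a moment map, in the sense that contracting \<open>\<omega>\<close> with \<open>[A,X]\<close> in its first argument gives
  \<open>d\<langle>X,A\<rangle>\<close>. The value does not depend on the choice of \<open>A\<close> and \<open>B\<close>.\<close>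
definition kks_form :: "cmat3 \<Rightarrow> cmat3 \<Rightarrow> cmat3 \<Rightarrow> real" where
  "kks_form X u v = (THE r. \<exists>A\<in>su3. \<exists>B\<in>su3. u = commutator A X \<and> v = commutator B X \<and>
                        r = Re (trace (X ** commutator A B)))"

definition product_form :: "triple \<Rightarrow> triple \<Rightarrow> triple \<Rightarrow> real" where
  "product_form = (\<lambda>(X, Y, Z) (u, v, w) (u', v', w').
     kks_form X u u' + kks_form Y v v' + kks_form Z w w')"

definition moment_map :: "triple \<Rightarrow> cmat3" where
  "moment_map = (\<lambda>(X, Y, Z). X + Y + Z)"

section \<open>The triple reduced product\<close>

definition zero_level :: "real^3 \<Rightarrow> real^3 \<Rightarrow> real^3 \<Rightarrow> triple set" where
  "zero_level lam mu nu = {p \<in> orbit lam \<times> orbit mu \<times> orbit nu. moment_map p = 0}"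

definition diagonal_action :: "cmat3 \<Rightarrow> triple \<Rightarrow> triple" where
  "diagonal_action g = (\<lambda>(X, Y, Z). (Ad g X, Ad g Y, Ad g Z))"

definition conj_class :: "triple \<Rightarrow> triple set" where
  "conj_class p = {diagonal_action g p | g. g \<in> SU3}"

definition triple_reduced_product :: "real^3 \<Rightarrow> real^3 \<Rightarrow> real^3 \<Rightarrow> triple set set" where
  "triple_reduced_product lam mu nu = conj_class ` zero_level lam mu nu"

text \<open>Kernel of the differential of \<open>moment_map\<close> on the tangent space of the product of the
  orbits. This is the tangent space of the zero level at every point \<open>p\<close> with discrete
  stabilizer, and its quotient by \<open>vertical_space p\<close> is the tangent space of the reduced product
  at \<open>conj_class p\<close>.\<close>
definition level_tangent :: "triple \<Rightarrow> triple set" where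
  "level_tangent = (\<lambda>(X, Y, Z). {(commutator A X, commutator B Y, commutator C Z) | A B C.
     A \<in> su3 \<and> B \<in> su3 \<and> C \<in> su3 \<and> commutator A X + commutator B Y + commutator C Z = 0})"

definition vertical_space :: "triple \<Rightarrow> triple set" where
  "vertical_space = (\<lambda>(X, Y, Z). {(commutator A X, commutator A Y, commutator A Z) | A. A \<in> su3})"

section \<open>Darboux coordinates on the reduced product\<close>

primrec Ck_on :: "nat \<Rightarrow> 'a::real_normed_vector set \<Rightarrow> ('a \<Rightarrow> 'b::real_normed_vector) \<Rightarrow> bool" where
  "Ck_on 0 W f = continuous_on W f"
| "Ck_on (Suc k) W f = ((\<forall>x\<in>W. f differentiable (at x)) \<and>
                       (\<forall>v. Ck_on k W (\<lambda>x. frechet_derivative f (at x) v)))"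

text \<open>Real smoothness; only meant for open \<open>W\<close>.\<close>
definition smooth_on :: "'a::real_normed_vector set \<Rightarrow> ('a \<Rightarrow> 'b::real_normed_vector) \<Rightarrow> bool" where
  "smooth_on W f = (\<forall>k. Ck_on k W f)"

text \<open>The functions are complex valued on a real manifold (restrictions of holomorphic functions
  on its complexification), so \<open>\<omega>\<^bsub>red\<^esub> = df \<and> dh\<close> is an identity of complex valued two-forms.
  Everything is expressed through the pullback along the quotient map \<open>conj_class\<close>: the reduced
  form is the form whose pullback is the restriction of \<open>product_form\<close> to the zero level, and a
  function on the quotient is smooth when its pullback is locally the restriction of a smooth
  function of the ambient matrix space. The last clause says that \<open>(df, dh)\<close> is injective on the
  tangent space of the quotient.\<close>
definition darboux_coordinates_on ::
  "real^3 \<Rightarrow> real^3 \<Rightarrow> real^3 \<Rightarrow> triple set set \<Rightarrow> (triple set \<Rightarrow> complex) \<Rightarrow> (triple set \<Rightarrow> complex) \<Rightarrow> bool"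
  where
  "darboux_coordinates_on lam mu nu U f h \<longleftrightarrow>
     U \<subseteq> triple_reduced_product lam mu nu \<and>
     openin (top_of_set (zero_level lam mu nu)) {p \<in> zero_level lam mu nu. conj_class p \<in> U} \<and>
     inj_on (\<lambda>c. (f c, h c)) U \<and>
     (\<forall>p\<in>zero_level lam mu nu. conj_class p \<in> U \<longrightarrow>
       (\<exists>W F H. open W \<and> p \<in> W \<and> smooth_on W F \<and> smooth_on W H \<and>
          (\<forall>q\<in>W \<inter> zero_level lam mu nu. F q = f (conj_class q) \<and> H q = h (conj_class q)) \<and>
          (\<forall>u\<in>level_tangent p. \<forall>v\<in>level_tangent p.
             complex_of_real (product_form p u v) =
               frechet_derivative F (at p) u * frechet_derivative H (at p) v
             - frechet_derivative F (at p) v * frechet_derivative H (at p) u) \<and>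
          (\<forall>u\<in>level_tangent p.
             frechet_derivative F (at p) u = 0 \<and> frechet_derivative H (at p) u = 0
               \<longrightarrow> u \<in> vertical_space p)))"

section \<open>The functions \<open>z\<^sub>0\<close>, \<open>\<eta>\<^sub>0\<close> and \<open>\<zeta>\<^sub>0\<close>\<close>

definition L_mat :: "triple \<Rightarrow> complex \<Rightarrow> cmat3" where
  "L_mat = (\<lambda>(X, Y, Z) z. mat z ** (Y - Z) + (Y + Z))"

definition L_tilde :: "triple \<Rightarrow> complex \<Rightarrow> complex \<Rightarrow> cmat3" where
  "L_tilde p z \<eta> = cofactor_matrix (L_mat p z - mat \<eta>)"

definition diagonal_representative :: "triple \<Rightarrow> complex^3 \<Rightarrow> bool" where
  "diagonal_representative = (\<lambda>(X, Y, Z) \<alpha>. Y - Z = diag_mat \<alpha>)"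

text \<open>The matrix \<open>(s\<^sub>j\<^sub>k)\<close>.\<close>
definition s_mat :: "triple \<Rightarrow> cmat3" where
  "s_mat = (\<lambda>(X, Y, Z). Y + Z)"

definition common_zero :: "triple \<Rightarrow> complex \<times> complex \<Rightarrow> bool" where
  "common_zero p = (\<lambda>(z, \<eta>). L_tilde p z \<eta> $ 2 $ 1 = 0 \<and> L_tilde p z \<eta> $ 3 $ 1 = 0)"

text \<open>The numbering of the (purely imaginary) eigenvalues of \<open>Y - Z\<close> must be chosen
  consistently over the quotient; it is fixed by a permutation \<open>\<sigma>\<close> of the indices. The strict
  inequalities make the eigenvalues distinct, without which the solution depends on the
  diagonalization and not only on the point of the quotient.\<close>
definition ordered_eigenvalues :: "(3 \<Rightarrow> 3) \<Rightarrow> complex^3 \<Rightarrow> bool" where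
  "ordered_eigenvalues \<sigma> \<alpha> \<longleftrightarrow>
     Im (\<alpha> $ \<sigma> 1) < Im (\<alpha> $ \<sigma> 2) \<and> Im (\<alpha> $ \<sigma> 2) < Im (\<alpha> $ \<sigma> 3)"

definition solution_point :: "(3 \<Rightarrow> 3) \<Rightarrow> triple set \<Rightarrow> complex \<times> complex" where
  "solution_point \<sigma> c = (THE q. \<exists>p\<in>c. \<exists>\<alpha>. diagonal_representative p \<alpha> \<and>
                            ordered_eigenvalues \<sigma> \<alpha> \<and> common_zero p q)"

definition z0 :: "(3 \<Rightarrow> 3) \<Rightarrow> triple set \<Rightarrow> complex" where
  "z0 \<sigma> c = fst (solution_point \<sigma> c)"

definition eta0 :: "(3 \<Rightarrow> 3) \<Rightarrow> triple set \<Rightarrow> complex" where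
  "eta0 \<sigma> c = snd (solution_point \<sigma> c)"

definition zeta0 :: "(3 \<Rightarrow> 3) \<Rightarrow> triple set \<Rightarrow> complex" where
  "zeta0 \<sigma> c = eta0 \<sigma> c / (z0 \<sigma> c * ((z0 \<sigma> c)\<^sup>2 - 1))"

text \<open>The points of the reduced product at which the construction makes sense: distinct
  eigenvalues, both linear equations genuinely involve \<open>(z, \<eta>)\<close>, and \<open>\<zeta>\<^sub>0\<close> is finite.\<close>
definition coordinate_domain ::
  "real^3 \<Rightarrow> real^3 \<Rightarrow> real^3 \<Rightarrow> (3 \<Rightarrow> 3) \<Rightarrow> triple set set" where
  "coordinate_domain lam mu nu \<sigma> = {c \<in> triple_reduced_product lam mu nu.
     (\<exists>p\<in>c. \<exists>\<alpha>. diagonal_representative p \<alpha> \<and> ordered_eigenvalues \<sigma> \<alpha> \<and>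
        s_mat p $ 2 $ 1 \<noteq> 0 \<and> s_mat p $ 3 $ 1 \<noteq> 0) \<and>
     z0 \<sigma> c \<noteq> 0 \<and> (z0 \<sigma> c)\<^sup>2 \<noteq> 1}"

end

theory Submission
  imports Defs "HOL-Complex_Analysis.Conformal_Mappings"
begin

text \<open>Write \<open>D = Y - Z\<close> and \<open>S = Y + Z = - X\<close>. The pair \<open>(z\<^sub>0, \<eta>\<^sub>0)\<close> is characterized by a row
  \<open>\<psi>\<close> with \<open>\<psi> e = 0\<close> and \<open>\<psi> (z\<^sub>0 D + S) = \<eta>\<^sub>0 \<psi>\<close>, where \<open>e\<close> is the first eigenvector of \<open>D\<close>; this
  makes it a rational, conjugation invariant function of \<open>D\<close>, \<open>S\<close> and a simple eigenvalue of \<open>D\<close>.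

  The coefficients of \<open>det (z D + S - \<eta>)\<close> are fixed by \<open>\<lambda>, \<mu>, \<nu>\<close> up to one multiple of
  \<open>z (z\<^sup>2 - 1)\<close>. So \<open>(z\<^sub>0, \<eta>\<^sub>0)\<close> determines the spectral curve, then the eigenvalues of \<open>D\<close>, the
  diagonal of \<open>S\<close>, the products \<open>S\<^sub>j\<^sub>k S\<^sub>k\<^sub>j\<close>, and finally \<open>S\<close> up to conjugation by a diagonal matrix.
  The linearized argument shows that a tangent vector with \<open>\<delta>z\<^sub>0 = \<delta>\<eta>\<^sub>0 = 0\<close> is vertical, also
  after complexification. Hence the complexified tangent space has dimension at most two, and
  \<open>\<omega> = dz\<^sub>0 \<and> d\<zeta>\<^sub>0\<close> only has to be checked on one vector with \<open>d\<zeta>\<^sub>0 \<noteq> 0\<close>. The Hamiltonian vector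
  field \<open>V\<close> of \<open>z\<^sub>0\<close> is such a vector: \<open>dz\<^sub>0(V) = 0\<close> and \<open>d\<eta>\<^sub>0(V) = - z\<^sub>0 (z\<^sub>0\<^sup>2 - 1)\<close>.\<close>

text \<open>No charts of the quotient are used. At a point with \<open>D\<close> diagonal everything
  is matrix algebra, and equivariance carries the result to the other representatives. The dimension
  bound is used in this form: a suitable combination of two tangent vectors and \<open>V\<close> has
  vanishing variations of \<open>z\<close> and \<open>\<eta>\<close>, is therefore vertical, and is
  annihilated by the form. The coefficients are complex, so the generators there are arbitrary
  complex matrices; \<open>vertical_spaceI\<close> returns to \<open>su3\<close> at the end. The
  obstacle is smoothness: \<open>z0\<close> and \<open>eta0\<close> are definite descriptions on the
  quotient, while smooth functions on an open set of triples are required. No smooth diagonalization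
  is chosen. On the zero level \<open>D\<close> is traceless with constant
  \<open>trace (D ** D)\<close>, so its eigenvalues are local holomorphic functions of
  \<open>trace (D ** D ** D)\<close>, and the adjugate gives an eigenvector. Off the zero level the
  same formulas are merely smooth extensions. Their differentials are not expanded; they are
  characterized by \<open>jet\<close>.\<close>

section \<open>Smooth functions\<close>

lemma Ck_on_cong:
  assumes "open W" "Ck_on k W f" "\<And>x. x \<in> W \<Longrightarrow> f x = g x"
  shows "Ck_on k W g"
  using assms(2,3)
proof (induction k arbitrary: f g)
  case 0
  from 0 show ?case
    unfolding Ck_on.simps by (simp cong: continuous_on_cong)
next
  case (Suc k)
  have "g differentiable (at x)" if "x \<in> W" for x
  proof -
    from Suc.prems(1) that obtain D where "(f has_derivative D) (at x)"
      by (auto simp: differentiable_def)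
    then have "(g has_derivative D) (at x)"
      using has_derivative_transform_within_open[of f D x UNIV W g] Suc.prems(2) that assms(1) by simp
    then show ?thesis by (auto simp: differentiable_def)
  qed
  moreover have "Ck_on k W (\<lambda>x. frechet_derivative g (at x) v)" for v
  proof (rule Suc.IH)
    show "Ck_on k W (\<lambda>x. frechet_derivative f (at x) v)" using Suc.prems by simp
    show "frechet_derivative f (at x) v = frechet_derivative g (at x) v" if "x \<in> W" for x
      using frechet_derivative_transform_within_open[of f x W g] Suc.prems that assms(1) by auto
  qed
  ultimately show ?case by simp
qed

lemma Ck_on_SucD: "Ck_on (Suc k) W f \<Longrightarrow> Ck_on k W f"
proof (induction k arbitrary: f)
  case 0
  then show ?case
    by (auto intro!: continuous_at_imp_continuous_on differentiable_imp_continuous_within)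
next
  case (Suc k)
  then show ?case by simp
qed

text \<open>\<open>Ck_on\<close> is phrased with \<open>frechet_derivative\<close>. This rule
  accepts any explicit derivative \<open>f'\<close> instead, so that the closure properties below
  follow by induction from the usual differentiation rules.\<close>

lemma Ck_on_has_derivativeI:
  assumes "open W" "\<And>x. x \<in> W \<Longrightarrow> (f has_derivative f' x) (at x)" "\<And>v. Ck_on k W (\<lambda>x. f' x v)"
  shows "Ck_on (Suc k) W f"
proof -
  have "Ck_on k W (\<lambda>x. frechet_derivative f (at x) v)" for v
    by (rule Ck_on_cong[OF assms(1) assms(3)[of v]]) (metis assms(2) frechet_derivative_at)
  with assms(2) show ?thesis by (auto simp: differentiable_def)
qed

lemma Ck_on_has_derivativeD:
  assumes "Ck_on (Suc k) W f" "x \<in> W"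
  shows "(f has_derivative frechet_derivative f (at x)) (at x)"
  using assms frechet_derivative_works by auto

lemma Ck_on_const: "open W \<Longrightarrow> Ck_on k W (\<lambda>x. c)"
proof (induction k arbitrary: c)
  case (Suc k)
  then show ?case by (intro Ck_on_has_derivativeI[where f' = "\<lambda>_ _. 0"]) auto
qed simp

lemma Ck_on_linear:
  assumes "open W" "bounded_linear f"
  shows "Ck_on k W f"
proof (cases k)
  case 0
  then show ?thesis using assms linear_continuous_on by auto
next
  case (Suc n)
  then show ?thesis
    using Ck_on_has_derivativeI[OF assms(1) bounded_linear_imp_has_derivative[OF assms(2)]
        Ck_on_const[OF assms(1)]] by simp
qed

lemma Ck_on_add:
  assumes "open W" "Ck_on k W f" "Ck_on k W g"
  shows "Ck_on k W (\<lambda>x. f x + g x)"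
  using assms(2,3)
proof (induction k arbitrary: f g)
  case 0
  then show ?case by (auto intro: continuous_intros)
next
  case (Suc k)
  show ?case
    by (rule Ck_on_has_derivativeI[OF assms(1) has_derivative_add])
      (use Suc in \<open>auto intro: Ck_on_has_derivativeD\<close>)
qed

lemma Ck_on_mult:
  fixes f g :: "'a::real_normed_vector \<Rightarrow> complex"
  assumes "open W" "Ck_on k W f" "Ck_on k W g"
  shows "Ck_on k W (\<lambda>x. f x * g x)"
  using assms(2,3)
proof (induction k arbitrary: f g)
  case 0
  then show ?case by (auto intro: continuous_intros)
next
  case (Suc k)
  have fg: "Ck_on k W f" "Ck_on k W g" using Suc.prems Ck_on_SucD by blast+
  show ?case
    by (rule Ck_on_has_derivativeI[OF assms(1) has_derivative_mult])
      (use Suc fg in \<open>auto intro!: Ck_on_add assms(1) intro: Ck_on_has_derivativeD\<close>)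
qed

text \<open>The chain rule produces \<open>deriv h\<close>, which is again holomorphic, so the
  induction generalizes over \<open>h\<close> with \<open>f\<close> fixed. The outer functions that
  occur are the reciprocal and the local root of a cubic.\<close>

lemma Ck_on_holomorphic_comp:
  fixes f :: "'a::real_normed_vector \<Rightarrow> complex"
  assumes "open W" "open V" "f ` W \<subseteq> V" "h holomorphic_on V" "Ck_on k W f"
  shows "Ck_on k W (\<lambda>x. h (f x))"
  using assms(4,5)
proof (induction k arbitrary: h)
  case 0
  then show ?case
    using assms(3) by (auto intro!: continuous_on_compose2[of V h W f] holomorphic_on_imp_continuous_on)
next
  case (Suc k)
  have f: "Ck_on k W f" using Suc.prems Ck_on_SucD by blast
  show ?case
  proof (rule Ck_on_has_derivativeI[OF assms(1)])
    fix x assume x: "x \<in> W"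
    have "(h has_derivative (*) (deriv h (f x))) (at (f x))"
      using holomorphic_derivI[OF Suc.prems(1) assms(2), of "f x"] assms(3) x
      by (blast intro: has_field_derivative_imp_has_derivative)
    from has_derivative_compose[OF Ck_on_has_derivativeD[OF Suc.prems(2) x] this]
    show "((\<lambda>x. h (f x)) has_derivative (\<lambda>v. deriv h (f x) * frechet_derivative f (at x) v)) (at x)" .
  next
    fix v
    show "Ck_on k W (\<lambda>x. deriv h (f x) * frechet_derivative f (at x) v)"
      using Ck_on_mult[OF assms(1) Suc.IH[OF holomorphic_deriv[OF Suc.prems(1) assms(2)] f]]
        Suc.prems(2) by simp
  qed
qed

text \<open>The chain rule only replaces the direction \<open>v\<close> by \<open>L v\<close>, so
  the induction generalizes over \<open>f\<close>. It is applied to the linear action of a group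
  element on triples.\<close>

lemma Ck_on_comp_linear:
  fixes f :: "'b::real_normed_vector \<Rightarrow> 'c::real_normed_vector"
  assumes "open W" "bounded_linear L" "Ck_on k W f"
  shows "Ck_on k (L -` W) (\<lambda>x. f (L x))"
  using assms(3)
proof (induction k arbitrary: f)
  case 0
  then show ?case
    using continuous_on_compose2[of W f "L -` W" L] linear_continuous_on[OF assms(2)] by auto
next
  case (Suc k)
  have "open (L -` W)"
    using assms by (simp add: continuous_open_vimage linear_continuous_at)
  then show ?case
  proof (rule Ck_on_has_derivativeI)
    fix x assume x: "x \<in> L -` W"
    show "((\<lambda>x. f (L x)) has_derivative (\<lambda>v. frechet_derivative f (at (L x)) (L v))) (at x)"
      using has_derivative_compose[OF bounded_linear_imp_has_derivative[OF assms(2)]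
          Ck_on_has_derivativeD[OF Suc.prems, of "L x"]] x by auto
  next
    fix v
    show "Ck_on k (L -` W) (\<lambda>x. frechet_derivative f (at (L x)) (L v))"
      using Suc.IH[of "\<lambda>y. frechet_derivative f (at y) (L v)"] Suc.prems by simp
  qed
qed

lemma smooth_on_const: "open W \<Longrightarrow> smooth_on W (\<lambda>x. c)"
  by (simp add: smooth_on_def Ck_on_const)

lemma smooth_on_linear: "open W \<Longrightarrow> bounded_linear f \<Longrightarrow> smooth_on W f"
  by (simp add: smooth_on_def Ck_on_linear)

lemma smooth_on_add:
  "open W \<Longrightarrow> smooth_on W f \<Longrightarrow> smooth_on W g \<Longrightarrow> smooth_on W (\<lambda>x. f x + g x)"
  by (simp add: smooth_on_def Ck_on_add)

lemma smooth_on_mult: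
  fixes f g :: "'a::real_normed_vector \<Rightarrow> complex"
  shows "open W \<Longrightarrow> smooth_on W f \<Longrightarrow> smooth_on W g \<Longrightarrow> smooth_on W (\<lambda>x. f x * g x)"
  by (simp add: smooth_on_def Ck_on_mult)

lemma smooth_on_diff:
  fixes f g :: "'a::real_normed_vector \<Rightarrow> complex"
  assumes "open W" "smooth_on W f" "smooth_on W g"
  shows "smooth_on W (\<lambda>x. f x - g x)"
  using smooth_on_add[OF assms(1,2) smooth_on_mult[OF assms(1) smooth_on_const[OF assms(1)] assms(3)], of "-1"]
  by simp

lemma smooth_on_holomorphic_comp:
  fixes f :: "'a::real_normed_vector \<Rightarrow> complex"
  assumes "open W" "open V" "f ` W \<subseteq> V" "h holomorphic_on V" "smooth_on W f"
  shows "smooth_on W (\<lambda>x. h (f x))"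
  using assms by (auto simp: smooth_on_def intro: Ck_on_holomorphic_comp)

lemma smooth_on_divide:
  fixes f g :: "'a::real_normed_vector \<Rightarrow> complex"
  assumes "open W" "smooth_on W f" "smooth_on W g" "\<And>x. x \<in> W \<Longrightarrow> g x \<noteq> 0"
  shows "smooth_on W (\<lambda>x. f x / g x)"
proof -
  have "smooth_on W (\<lambda>x. inverse (g x))"
    by (rule smooth_on_holomorphic_comp[of _ "- {0}"]) (use assms in \<open>auto intro!: holomorphic_intros\<close>)
  then show ?thesis using assms by (auto simp: divide_inverse intro!: smooth_on_mult)
qed

lemma smooth_on_comp_linear:
  "open W \<Longrightarrow> bounded_linear L \<Longrightarrow> smooth_on W f \<Longrightarrow> smooth_on (L -` W) (\<lambda>x. f (L x))"
  by (simp add: smooth_on_def Ck_on_comp_linear)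

lemma smooth_on_subset:
  assumes "smooth_on W f" "V \<subseteq> W"
  shows "smooth_on V f"
proof -
  have "Ck_on k W f \<Longrightarrow> Ck_on k V f" for k
    using assms(2) by (induction k arbitrary: f) (auto intro: continuous_on_subset)
  with assms show ?thesis by (auto simp: smooth_on_def)
qed

lemma smooth_on_has_derivative:
  "smooth_on W f \<Longrightarrow> x \<in> W \<Longrightarrow> (f has_derivative frechet_derivative f (at x)) (at x)"
  unfolding smooth_on_def using Ck_on_has_derivativeD by blast

lemma smooth_on_imp_continuous_on: "smooth_on W f \<Longrightarrow> continuous_on W f"
  unfolding smooth_on_def by (metis Ck_on.simps(1))

section \<open>Matrix algebra\<close>

definition scale_mat :: "complex \<Rightarrow> cmat3 \<Rightarrow> cmat3" where
  "scale_mat c A = (\<chi> i j. c * A $ i $ j)"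

text \<open>Bilinear, with no conjugation: rows such as \<open>\<psi>\<close> pair with columns
  complex linearly.\<close>

definition bdot :: "complex^3 \<Rightarrow> complex^3 \<Rightarrow> complex" where
  "bdot u v = (\<Sum>i\<in>UNIV. u $ i * v $ i)"

lemma scale_mat_nth [simp]: "scale_mat c A $ i $ j = c * A $ i $ j"
  by (simp add: scale_mat_def)

lemmas mat_entries = matrix_matrix_mult_def matrix_vector_mult_def vector_matrix_mult_def
  commutator_def trace_def bdot_def vec_eq_iff forall_3 sum_3 diag_mat_def

lemma commutator_add_left: "commutator (A + B) M = commutator A M + commutator B M"
  and commutator_add_right: "commutator M (A + B) = commutator M A + commutator M B"
  and commutator_diff_left: "commutator (A - B) M = commutator A M - commutator B M"
  and commutator_diff_right: "commutator M (A - B) = commutator M A - commutator M B"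
  and commutator_scale_left: "commutator (scale_mat c A) M = scale_mat c (commutator A M)"
  by (simp_all add: mat_entries algebra_simps)

lemma trace_mult_add: "trace (A ** (B + C)) = trace (A ** B) + trace (A ** C)"
  and trace_add_mult: "trace ((B + C) ** A) = trace (B ** A) + trace (C ** A)"
  and trace_mult_diff: "trace (A ** (B - C)) = trace (A ** B) - trace (A ** C)"
  and trace_diff_mult: "trace ((B - C) ** A) = trace (B ** A) - trace (C ** A)"
  and trace_scale_mult: "trace (scale_mat c A ** B) = c * trace (A ** B)"
  and trace_mult_scale: "trace (A ** scale_mat c B) = c * trace (A ** B)"
  for A :: cmat3
  by (simp_all add: mat_entries algebra_simps)

lemma trace_commutator: "trace (commutator A B) = 0"
  by (simp add: commutator_def trace_sub trace_mul_sym[of A B])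

text \<open>By cyclicity of the trace, the pairing of \<open>A\<close> with the tangent vector
  generated by \<open>B\<close> is antisymmetric in the two generators; this is the antisymmetry of
  the orbit form.\<close>

lemma trace_mult_commutator: "trace (A ** commutator B M) = - trace (B ** commutator A M)"
  by (simp add: mat_entries algebra_simps)

lemma trace_commutator_shift: "trace (M ** commutator A B) = trace (A ** commutator B M)"
  by (simp add: mat_entries algebra_simps)

text \<open>This and the next lemma say that \<open>trace (M ** M)\<close> and
  \<open>trace (M ** M ** M)\<close> are constant to first order along the orbit of
  \<open>M\<close>, a tangent vector being \<open>commutator B M\<close>.\<close>

lemma trace_self_commutator: "trace (M ** commutator B M) = 0"
  by (simp add: mat_entries algebra_simps)

lemma trace_square_commutator: "trace (M ** M ** commutator B M) = 0"
proof -
  have "M ** M ** commutator B M = (M ** M ** B) ** M - M ** (M ** M ** B)"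
    by (simp add: commutator_def matrix_mul_assoc vec_eq_iff matrix_matrix_mult_def sum_3 algebra_simps)
  then show ?thesis by (simp add: trace_sub trace_mul_sym[of M])
qed

section \<open>First-order variations\<close>

text \<open>The linearization of the equations \<open>D e = a e\<close>, \<open>\<psi> e = 0\<close>, \<open>\<psi> (z D + S - \<eta>) = 0\<close>.\<close>
definition jet :: "cmat3 \<Rightarrow> cmat3 \<Rightarrow> complex \<Rightarrow> complex^3 \<Rightarrow> complex^3 \<Rightarrow> complex \<Rightarrow> complex \<Rightarrow>
    cmat3 \<Rightarrow> cmat3 \<Rightarrow> complex \<Rightarrow> complex \<Rightarrow> bool" where
  "jet D S a e \<psi> z \<eta> D' S' z' \<eta>' \<longleftrightarrow> (\<exists>e' a' \<psi>'.
     D' *v e + D *v e' = a' *s e + a *s e' \<and>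
     bdot \<psi>' e + bdot \<psi> e' = 0 \<and>
     \<psi>' v* (scale_mat z D + S - mat \<eta>) + \<psi> v* (scale_mat z' D + scale_mat z D' + S' - mat \<eta>') = 0)"

text \<open>Conjugation moves the solution along: \<open>e' = G e\<close>, \<open>a' = 0\<close> and
  \<open>\<psi>' = - \<psi> G\<close> solve the linearized equations.\<close>

lemma jet_vertical:
  assumes De: "D *v e = a *s e" and \<psi>: "\<psi> v* (scale_mat z D + S - mat \<eta>) = 0"
  shows "jet D S a e \<psi> z \<eta> (commutator G D) (commutator G S) 0 0"
proof -
  let ?L = "scale_mat z D + S - mat \<eta>"
  have "commutator G D *v e + D *v (G *v e) = G *v (D *v e)"
    by (simp add: commutator_def matrix_vector_mult_diff_rdistrib matrix_vector_mul_assoc)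
  also have "\<dots> = a *s (G *v e)"
    unfolding De by (simp add: mat_entries algebra_simps)
  finally have 1: "commutator G D *v e + D *v (G *v e) = 0 *s e + a *s (G *v e)" by simp
  have 2: "bdot (- (\<psi> v* G)) e + bdot \<psi> (G *v e) = 0"
    by (simp add: mat_entries algebra_simps)
  have "scale_mat 0 D + scale_mat z (commutator G D) + commutator G S - mat 0 = commutator G ?L"
    by (simp add: mat_entries mat_def algebra_simps)
  then have "(- (\<psi> v* G)) v* ?L + \<psi> v* (scale_mat 0 D + scale_mat z (commutator G D) + commutator G S - mat 0)
     = - (\<psi> v* (G ** ?L)) + \<psi> v* commutator G ?L"
    by (simp only: vector_matrix_mul_assoc[symmetric])
      (simp add: mat_entries algebra_simps)
  also have "\<dots> = - ((\<psi> v* ?L) v* G)"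
    unfolding commutator_def vector_matrix_mul_assoc
    by (simp only: vector_matrix_mult_diff_rdistrib) simp
  also have "\<dots> = 0" unfolding \<psi> by (simp add: mat_entries)
  finally show ?thesis
    unfolding jet_def using 1 2 by blast
qed

text \<open>The unknowns \<open>e'\<close>, \<open>a'\<close>, \<open>\<psi>'\<close> enter linearly
  and are existentially quantified, so \<open>jet\<close> is a linear relation over the complex
  numbers.\<close>

lemma jet_comb:
  assumes "jet D S a e \<psi> z \<eta> D1 S1 z1 \<eta>1" "jet D S a e \<psi> z \<eta> D2 S2 z2 \<eta>2"
  shows "jet D S a e \<psi> z \<eta> (scale_mat c1 D1 + scale_mat c2 D2) (scale_mat c1 S1 + scale_mat c2 S2)
     (c1 * z1 + c2 * z2) (c1 * \<eta>1 + c2 * \<eta>2)"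
proof -
  let ?L = "scale_mat z D + S - mat \<eta>"
  let ?N = "\<lambda>D' S' z' \<eta>'. scale_mat z' D + scale_mat z D' + S' - mat \<eta>'"
  obtain e1 a1 p1 where 1: "D1 *v e + D *v e1 = a1 *s e + a *s e1" "bdot p1 e + bdot \<psi> e1 = 0"
    "p1 v* ?L + \<psi> v* ?N D1 S1 z1 \<eta>1 = 0"
    using assms(1) unfolding jet_def by blast
  obtain e2 a2 p2 where 2: "D2 *v e + D *v e2 = a2 *s e + a *s e2" "bdot p2 e + bdot \<psi> e2 = 0"
    "p2 v* ?L + \<psi> v* ?N D2 S2 z2 \<eta>2 = 0"
    using assms(2) unfolding jet_def by blast
  let ?D = "scale_mat c1 D1 + scale_mat c2 D2" and ?S = "scale_mat c1 S1 + scale_mat c2 S2"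
  let ?e = "c1 *s e1 + c2 *s e2" and ?p = "c1 *s p1 + c2 *s p2"
  have "?D *v e + D *v ?e = c1 *s (D1 *v e + D *v e1) + c2 *s (D2 *v e + D *v e2)"
    by (simp add: mat_entries algebra_simps)
  also have "\<dots> = (c1 * a1 + c2 * a2) *s e + a *s ?e"
    unfolding 1 2 by (simp add: vec_eq_iff algebra_simps)
  finally have i: "?D *v e + D *v ?e = (c1 * a1 + c2 * a2) *s e + a *s ?e" .
  have "bdot ?p e + bdot \<psi> ?e = c1 * (bdot p1 e + bdot \<psi> e1) + c2 * (bdot p2 e + bdot \<psi> e2)"
    by (simp add: mat_entries algebra_simps)
  then have ii: "bdot ?p e + bdot \<psi> ?e = 0" using 1 2 by simp
  have p: "?p v* M = c1 *s (p1 v* M) + c2 *s (p2 v* M)" for M :: cmat3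
    by (simp add: mat_entries algebra_simps)
  have q: "\<psi> v* ?N ?D ?S (c1 * z1 + c2 * z2) (c1 * \<eta>1 + c2 * \<eta>2)
     = c1 *s (\<psi> v* ?N D1 S1 z1 \<eta>1) + c2 *s (\<psi> v* ?N D2 S2 z2 \<eta>2)"
    by (simp add: mat_entries mat_def algebra_simps)
  have "?p v* ?L + \<psi> v* ?N ?D ?S (c1 * z1 + c2 * z2) (c1 * \<eta>1 + c2 * \<eta>2)
    = c1 *s (p1 v* ?L + \<psi> v* ?N D1 S1 z1 \<eta>1) + c2 *s (p2 v* ?L + \<psi> v* ?N D2 S2 z2 \<eta>2)"
    unfolding p q by (simp add: vec_eq_iff algebra_simps)
  then have iii: "?p v* ?L + \<psi> v* ?N ?D ?S (c1 * z1 + c2 * z2) (c1 * \<eta>1 + c2 * \<eta>2) = 0"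
    unfolding 1 2 by simp
  show ?thesis unfolding jet_def using i ii iii by blast
qed

text \<open>With \<open>D = Y - Z\<close> and \<open>S = Y + Z = - X\<close>, this says that \<open>D', S'\<close> come from the tangent vector
  \<open>([A, X], [B, Y], [C, Z])\<close> and that the latter is annihilated by the differential of the moment
  map.\<close>
definition tangent :: "cmat3 \<Rightarrow> cmat3 \<Rightarrow> cmat3 \<Rightarrow> cmat3 \<Rightarrow> cmat3 \<Rightarrow> cmat3 \<Rightarrow> cmat3 \<Rightarrow> bool" where
  "tangent D S A B C D' S' \<longleftrightarrow>
     commutator A S = S' \<and> commutator B (S + D) = S' + D' \<and> commutator C (S - D) = S' - D'"

text \<open>The form \<open>product_form\<close>, extended complex bilinearly.\<close>
definition omega :: "cmat3 \<Rightarrow> cmat3 \<Rightarrow> cmat3 \<Rightarrow> cmat3 \<Rightarrow> cmat3 \<Rightarrow> complex" where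
  "omega A B C D2 S2 = (trace (B ** (S2 + D2)) + trace (C ** (S2 - D2))) / 2 - trace (A ** S2)"

lemma tangent_comb:
  assumes "tangent D S A1 B1 C1 D1 S1" "tangent D S A2 B2 C2 D2 S2"
  shows "tangent D S (scale_mat c1 A1 + scale_mat c2 A2) (scale_mat c1 B1 + scale_mat c2 B2)
     (scale_mat c1 C1 + scale_mat c2 C2) (scale_mat c1 D1 + scale_mat c2 D2)
     (scale_mat c1 S1 + scale_mat c2 S2)"
  using assms unfolding tangent_def
  by (simp add: commutator_add_left commutator_scale_left) (simp add: vec_eq_iff algebra_simps)

lemma omega_comb_left:
  "omega (scale_mat c1 A1 + scale_mat c2 A2) (scale_mat c1 B1 + scale_mat c2 B2)
     (scale_mat c1 C1 + scale_mat c2 C2) D' S' = c1 * omega A1 B1 C1 D' S' + c2 * omega A2 B2 C2 D' S'"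
  unfolding omega_def by (simp add: trace_add_mult trace_scale_mult algebra_simps add_divide_distrib)

text \<open>Tangency writes each of the three traces with a commutator, where
  \<open>trace_mult_commutator\<close> exchanges the generators.\<close>

lemma omega_antisym:
  assumes "tangent D S A1 B1 C1 D1 S1" "tangent D S A2 B2 C2 D2 S2"
  shows "omega A1 B1 C1 D2 S2 = - omega A2 B2 C2 D1 S1"
proof -
  have 1: "S1 = commutator A1 S" "S1 + D1 = commutator B1 (S + D)" "S1 - D1 = commutator C1 (S - D)"
    and 2: "S2 = commutator A2 S" "S2 + D2 = commutator B2 (S + D)" "S2 - D2 = commutator C2 (S - D)"
    using assms unfolding tangent_def by simp_all
  have "trace (A1 ** S2) = - trace (A2 ** S1)"
    unfolding 1(1) 2(1) by (rule trace_mult_commutator)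
  moreover have "trace (B1 ** (S2 + D2)) = - trace (B2 ** (S1 + D1))"
    unfolding 1(2) 2(2) by (rule trace_mult_commutator)
  moreover have "trace (C1 ** (S2 - D2)) = - trace (C2 ** (S1 - D1))"
    unfolding 1(3) 2(3) by (rule trace_mult_commutator)
  ultimately show ?thesis unfolding omega_def by (simp only:) (simp add: field_simps)
qed

text \<open>Moment map property: contraction with a vertical vector differentiates the sum of the
  three matrices, and in terms of \<open>D'\<close> and \<open>S'\<close> that sum vanishes
  identically.\<close>

lemma omega_vertical: "omega G G G D' S' = 0"
  unfolding omega_def by (simp add: trace_mult_add trace_mult_diff)

lemma tangent_vertical: "tangent D S G G G (commutator G D) (commutator G S)"
  unfolding tangent_def by (simp add: commutator_add_right commutator_diff_right)


section \<open>The frame in which \<open>D\<close> is diagonal: gradient and Hamiltonian vector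
  field of \<open>z\<close>\<close>

definition mat_of_rows :: "complex \<Rightarrow> complex \<Rightarrow> complex \<Rightarrow> complex \<Rightarrow> complex \<Rightarrow> complex \<Rightarrow> complex \<Rightarrow>
    complex \<Rightarrow> complex \<Rightarrow> cmat3" where
  "mat_of_rows a b c d e f g h i = vector [vector [a, b, c], vector [d, e, f], vector [g, h, i]]"

lemma mat_of_rows_nth [simp]:
  "mat_of_rows a b c d e f g h i $ 1 $ 1 = a" "mat_of_rows a b c d e f g h i $ 1 $ 2 = b"
  "mat_of_rows a b c d e f g h i $ 1 $ 3 = c" "mat_of_rows a b c d e f g h i $ 2 $ 1 = d"
  "mat_of_rows a b c d e f g h i $ 2 $ 2 = e" "mat_of_rows a b c d e f g h i $ 2 $ 3 = f"
  "mat_of_rows a b c d e f g h i $ 3 $ 1 = g" "mat_of_rows a b c d e f g h i $ 3 $ 2 = h"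
  "mat_of_rows a b c d e f g h i $ 3 $ 3 = i"
  by (simp_all add: mat_of_rows_def)

text \<open>The frame is purely algebraic over the complex numbers, so that it also serves
  complexified tangent vectors. \<open>zero2\<close> and \<open>zero3\<close> are the two equations
  that define \<open>(z, \<eta>)\<close>.\<close>

locale diagonal_frame =
  fixes \<alpha> :: "complex^3" and S :: cmat3 and z \<eta> :: complex
  assumes distinct: "\<alpha> $ 1 \<noteq> \<alpha> $ 2" "\<alpha> $ 1 \<noteq> \<alpha> $ 3" "\<alpha> $ 2 \<noteq> \<alpha> $ 3"
    and s_nz: "S $ 2 $ 1 \<noteq> 0" "S $ 3 $ 1 \<noteq> 0"
    and zero2: "S $ 2 $ 1 * (\<alpha> $ 3 * z - \<eta> + S $ 3 $ 3) = S $ 3 $ 1 * S $ 2 $ 3"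
    and zero3: "S $ 3 $ 1 * (\<alpha> $ 2 * z - \<eta> + S $ 2 $ 2) = S $ 2 $ 1 * S $ 3 $ 2"
begin

abbreviation "D \<equiv> diag_mat \<alpha>"

text \<open>The cross product of \<open>axis 1 1\<close> with the first column of \<open>S\<close>:
  the row, unique up to scale, that annihilates both.\<close>

definition \<psi> :: "complex^3" where "\<psi> = vector [0, - S $ 3 $ 1, S $ 2 $ 1]"

abbreviation "L \<equiv> scale_mat z D + S - mat \<eta>"

abbreviation "is_jet \<equiv> jet D S (\<alpha> $ 1) (axis 1 1) \<psi> z \<eta>"

lemma psi_nth [simp]: "\<psi> $ 1 = 0" "\<psi> $ 2 = - S $ 3 $ 1" "\<psi> $ 3 = S $ 2 $ 1"
  by (simp_all add: \<psi>_def)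

lemma D_axis: "D *v axis 1 1 = (\<alpha> $ 1) *s axis 1 1"
  by (simp add: mat_entries axis_def)

text \<open>The first column vanishes by the choice of \<open>\<psi>\<close>; the second and third
  are \<open>zero3\<close> and \<open>zero2\<close>.\<close>

lemma psi_L: "\<psi> v* L = 0"
  using zero2 zero3 by (simp add: mat_entries mat_def algebra_simps)

lemma is_jetE:
  assumes "is_jet D' S' z' \<eta>'"
  obtains e2 e3 p1 p2 p3 where
    "D' $ 2 $ 1 = (\<alpha> $ 1 - \<alpha> $ 2) * e2" "D' $ 3 $ 1 = (\<alpha> $ 1 - \<alpha> $ 3) * e3"
    "p1 = S $ 3 $ 1 * e2 - S $ 2 $ 1 * e3"
    "p1 * (\<alpha> $ 1 * z + S $ 1 $ 1 - \<eta>) + p2 * S $ 2 $ 1 + p3 * S $ 3 $ 1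
      = S $ 3 $ 1 * (z * D' $ 2 $ 1 + S' $ 2 $ 1) - S $ 2 $ 1 * (z * D' $ 3 $ 1 + S' $ 3 $ 1)"
    "p1 * S $ 1 $ 2 + p2 * (\<alpha> $ 2 * z - \<eta> + S $ 2 $ 2) + p3 * S $ 3 $ 2
      = S $ 3 $ 1 * (z' * \<alpha> $ 2 + z * D' $ 2 $ 2 + S' $ 2 $ 2 - \<eta>') - S $ 2 $ 1 * (z * D' $ 3 $ 2 + S' $ 3 $ 2)"
    "p1 * S $ 1 $ 3 + p2 * S $ 2 $ 3 + p3 * (\<alpha> $ 3 * z - \<eta> + S $ 3 $ 3)
      = S $ 3 $ 1 * (z * D' $ 2 $ 3 + S' $ 2 $ 3) - S $ 2 $ 1 * (z' * \<alpha> $ 3 + z * D' $ 3 $ 3 + S' $ 3 $ 3 - \<eta>')"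
proof -
  obtain e' a' p where *: "D' *v axis 1 1 + D *v e' = a' *s axis 1 1 + \<alpha> $ 1 *s e'"
     "bdot p (axis 1 1) + bdot \<psi> e' = 0"
     "p v* L + \<psi> v* (scale_mat z' D + scale_mat z D' + S' - mat \<eta>') = 0"
    using assms unfolding jet_def by blast
  show ?thesis
    by (rule that[of "e' $ 2" "e' $ 3" "p $ 1" "p $ 2" "p $ 3"];
      (use * in \<open>simp add: mat_entries mat_def axis_def algebra_simps eq_neg_iff_add_eq_0\<close>)?)
qed

text \<open>Up to sign the reciprocal of the determinant of \<open>zero2\<close>,
  \<open>zero3\<close> as linear equations in \<open>(z, \<eta>)\<close>.\<close>

definition k where "k = 1 / (S $ 2 $ 1 * S $ 3 $ 1 * (\<alpha> $ 3 - \<alpha> $ 2))"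
text \<open>The trace of the lower right 2 by 2 block of \<open>L\<close>. By \<open>zero2\<close>
  and \<open>zero3\<close> this block is singular and has \<open>(S $ 2 $ 1, S $ 3 $ 1)\<close> as a
  right eigenvector with eigenvalue \<open>\<tau>\<close>.\<close>

definition \<tau> where "\<tau> = (\<alpha> $ 2 * z - \<eta> + S $ 2 $ 2) + (\<alpha> $ 3 * z - \<eta> + S $ 3 $ 3)"

text \<open>The gradient of \<open>z\<close> with respect to \<open>S\<close> and \<open>D\<close> for the trace pairing.\<close>
definition gradS where
  "gradS = mat_of_rows 0 (- k * \<tau> * S $ 3 $ 1) (k * \<tau> * S $ 2 $ 1)
     0 (k * S $ 2 $ 1 * S $ 3 $ 1) (- k * (S $ 2 $ 1)\<^sup>2)
     0 (k * (S $ 3 $ 1)\<^sup>2) (- k * S $ 2 $ 1 * S $ 3 $ 1)"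

text \<open>The lower right block is \<open>z\<close> times that of \<open>gradS\<close>, because
  \<open>D\<close> enters there only through \<open>z D + S\<close>. The first row comes from the
  motion of the eigenvector \<open>e\<close>, hence the denominators.\<close>

definition gradD where
  "gradD = mat_of_rows 0
     (k * (\<tau> * (S $ 2 $ 1 * S $ 3 $ 2 - S $ 3 $ 1 * (S $ 2 $ 2 - S $ 1 $ 1)) - S $ 2 $ 1 * S $ 3 $ 1 * S $ 1 $ 2
        - (S $ 3 $ 1)\<^sup>2 * S $ 1 $ 3) / (\<alpha> $ 1 - \<alpha> $ 2))
     (k * (\<tau> * (S $ 2 $ 1 * (S $ 3 $ 3 - S $ 1 $ 1) - S $ 3 $ 1 * S $ 2 $ 3) + S $ 2 $ 1 * S $ 3 $ 1 * S $ 1 $ 3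
        + (S $ 2 $ 1)\<^sup>2 * S $ 1 $ 2) / (\<alpha> $ 1 - \<alpha> $ 3))
     0 (z * k * S $ 2 $ 1 * S $ 3 $ 1) (- z * k * (S $ 2 $ 1)\<^sup>2)
     0 (z * k * (S $ 3 $ 1)\<^sup>2) (- z * k * S $ 2 $ 1 * S $ 3 $ 1)"

lemma k: "k * S $ 2 $ 1 * S $ 3 $ 1 * (\<alpha> $ 3 - \<alpha> $ 2) = 1"
  using distinct s_nz by (simp add: k_def)

lemma jet_gradient:
  assumes "is_jet D' S' z' \<eta>'"
  shows "z' = trace (gradS ** S') + trace (gradD ** D')"
proof -
  obtain e2 e3 p1 p2 p3 where e: "D' $ 2 $ 1 = (\<alpha> $ 1 - \<alpha> $ 2) * e2" "D' $ 3 $ 1 = (\<alpha> $ 1 - \<alpha> $ 3) * e3"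
    and p1: "p1 = S $ 3 $ 1 * e2 - S $ 2 $ 1 * e3"
    and r1: "p1 * (\<alpha> $ 1 * z + S $ 1 $ 1 - \<eta>) + p2 * S $ 2 $ 1 + p3 * S $ 3 $ 1
      = S $ 3 $ 1 * (z * D' $ 2 $ 1 + S' $ 2 $ 1) - S $ 2 $ 1 * (z * D' $ 3 $ 1 + S' $ 3 $ 1)"
    and r2: "p1 * S $ 1 $ 2 + p2 * (\<alpha> $ 2 * z - \<eta> + S $ 2 $ 2) + p3 * S $ 3 $ 2
      = S $ 3 $ 1 * (z' * \<alpha> $ 2 + z * D' $ 2 $ 2 + S' $ 2 $ 2 - \<eta>') - S $ 2 $ 1 * (z * D' $ 3 $ 2 + S' $ 3 $ 2)"
    and r3: "p1 * S $ 1 $ 3 + p2 * S $ 2 $ 3 + p3 * (\<alpha> $ 3 * z - \<eta> + S $ 3 $ 3)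
      = S $ 3 $ 1 * (z * D' $ 2 $ 3 + S' $ 2 $ 3) - S $ 2 $ 1 * (z' * \<alpha> $ 3 + z * D' $ 3 $ 3 + S' $ 3 $ 3 - \<eta>')"
    using is_jetE[OF assms] by metis
  have g2: "gradD $ 1 $ 2 * D' $ 2 $ 1 = k * (\<tau> * (S $ 2 $ 1 * S $ 3 $ 2 - S $ 3 $ 1 * (S $ 2 $ 2 - S $ 1 $ 1))
      - S $ 2 $ 1 * S $ 3 $ 1 * S $ 1 $ 2 - (S $ 3 $ 1)\<^sup>2 * S $ 1 $ 3) * e2"
    and g3: "gradD $ 1 $ 3 * D' $ 3 $ 1 = k * (\<tau> * (S $ 2 $ 1 * (S $ 3 $ 3 - S $ 1 $ 1) - S $ 3 $ 1 * S $ 2 $ 3)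
      + S $ 2 $ 1 * S $ 3 $ 1 * S $ 1 $ 3 + (S $ 2 $ 1)\<^sup>2 * S $ 1 $ 2) * e3"
    using distinct by (simp_all add: e gradD_def)
  \<comment> \<open>This is the combination
    \<open>S $ 2 $ 1 * r2 + S $ 3 $ 1 * r3 - \<tau> * r1\<close>: the eigenvector property behind
    \<open>\<tau>\<close> removes \<open>p2\<close> and \<open>p3\<close>, and the two
    \<open>\<eta>'\<close> terms cancel.\<close>
  have "S $ 2 $ 1 * S $ 3 $ 1 * (\<alpha> $ 3 - \<alpha> $ 2) * z'
      = \<tau> * (S $ 2 $ 1 * S' $ 3 $ 1 - S $ 3 $ 1 * S' $ 2 $ 1)
      + S $ 2 $ 1 * S $ 3 $ 1 * (z * D' $ 2 $ 2 + S' $ 2 $ 2 - (z * D' $ 3 $ 3 + S' $ 3 $ 3))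
      - (S $ 2 $ 1)\<^sup>2 * (z * D' $ 3 $ 2 + S' $ 3 $ 2) + (S $ 3 $ 1)\<^sup>2 * (z * D' $ 2 $ 3 + S' $ 2 $ 3)
      + (\<tau> * (S $ 2 $ 1 * S $ 3 $ 2 - S $ 3 $ 1 * (S $ 2 $ 2 - S $ 1 $ 1))
      - S $ 2 $ 1 * S $ 3 $ 1 * S $ 1 $ 2 - (S $ 3 $ 1)\<^sup>2 * S $ 1 $ 3) * e2
      + (\<tau> * (S $ 2 $ 1 * (S $ 3 $ 3 - S $ 1 $ 1) - S $ 3 $ 1 * S $ 2 $ 3)
      + S $ 2 $ 1 * S $ 3 $ 1 * S $ 1 $ 3 + (S $ 2 $ 1)\<^sup>2 * S $ 1 $ 2) * e3"
    using r1 r2 r3 zero2 zero3 unfolding e p1 \<tau>_def by algebra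
  note * = arg_cong[OF this, of "\<lambda>x. k * x"]
  have "z' = k * S $ 2 $ 1 * S $ 3 $ 1 * (\<alpha> $ 3 - \<alpha> $ 2) * z'" using k by simp
  also have "\<dots> = trace (gradS ** S') + trace (gradD ** D')"
  proof -
    have "trace (gradD ** D') = gradD $ 1 $ 2 * D' $ 2 $ 1 + gradD $ 1 $ 3 * D' $ 3 $ 1
        + z * k * (S $ 2 $ 1 * S $ 3 $ 1 * (D' $ 2 $ 2 - D' $ 3 $ 3)
        - (S $ 2 $ 1)\<^sup>2 * D' $ 3 $ 2 + (S $ 3 $ 1)\<^sup>2 * D' $ 2 $ 3)"
      by (simp add: mat_entries gradD_def) (simp add: algebra_simps)
    moreover have "trace (gradS ** S') = k * (\<tau> * (S $ 2 $ 1 * S' $ 3 $ 1 - S $ 3 $ 1 * S' $ 2 $ 1)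
        + S $ 2 $ 1 * S $ 3 $ 1 * (S' $ 2 $ 2 - S' $ 3 $ 3)
        - (S $ 2 $ 1)\<^sup>2 * S' $ 3 $ 2 + (S $ 3 $ 1)\<^sup>2 * S' $ 2 $ 3)"
      by (simp add: mat_entries gradS_def algebra_simps)
    ultimately show ?thesis
      unfolding g2 g3 using * by (simp only:) (simp only: algebra_simps)
  qed
  finally show ?thesis .
qed

text \<open>Infinitesimal conjugation invariance of \<open>z\<close>: pairing the left side with
  \<open>G\<close> gives, up to sign, the derivative of \<open>z\<close> along
  \<open>(commutator G S, commutator G D)\<close>.\<close>

lemma grad_invariant: "commutator gradS S + commutator gradD D = 0"
proof -
  \<comment> \<open>Naming the reciprocals turns the denominators into polynomial relations that
    \<open>algebra\<close> can use.\<close>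
  define d2 where "d2 = 1 / (\<alpha> $ 1 - \<alpha> $ 2)"
  define d3 where "d3 = 1 / (\<alpha> $ 1 - \<alpha> $ 3)"
  have d: "d2 * (\<alpha> $ 1 - \<alpha> $ 2) = 1" "d3 * (\<alpha> $ 1 - \<alpha> $ 3) = 1"
    using distinct by (simp_all add: d2_def d3_def)
  let ?C = "commutator gradS S + commutator gradD D"
  have gradD: "gradD = mat_of_rows 0
     (k * (\<tau> * (S $ 2 $ 1 * S $ 3 $ 2 - S $ 3 $ 1 * (S $ 2 $ 2 - S $ 1 $ 1)) - S $ 2 $ 1 * S $ 3 $ 1 * S $ 1 $ 2
        - (S $ 3 $ 1)\<^sup>2 * S $ 1 $ 3) * d2)
     (k * (\<tau> * (S $ 2 $ 1 * (S $ 3 $ 3 - S $ 1 $ 1) - S $ 3 $ 1 * S $ 2 $ 3) + S $ 2 $ 1 * S $ 3 $ 1 * S $ 1 $ 3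
        + (S $ 2 $ 1)\<^sup>2 * S $ 1 $ 2) * d3)
     0 (z * k * S $ 2 $ 1 * S $ 3 $ 1) (- z * k * (S $ 2 $ 1)\<^sup>2)
     0 (z * k * (S $ 3 $ 1)\<^sup>2) (- z * k * S $ 2 $ 1 * S $ 3 $ 1)"
    unfolding gradD_def d2_def d3_def by simp
  have "?C $ 1 $ 1 = 0" "?C $ 2 $ 1 = 0" "?C $ 3 $ 1 = 0"
    by (simp_all add: mat_entries gradS_def gradD power2_eq_square)
  moreover have "?C $ 1 $ 2 = 0" "?C $ 1 $ 3 = 0"
    using d by (simp_all add: mat_entries gradS_def gradD) algebra+
  moreover have "?C $ 2 $ 2 = 0" "?C $ 3 $ 3 = 0" "?C $ 2 $ 3 = 0" "?C $ 3 $ 2 = 0"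
    using zero2 zero3 by (simp_all add: mat_entries gradS_def gradD \<tau>_def) algebra+
  ultimately show ?thesis by (simp add: vec_eq_iff forall_3)
qed

text \<open>The Hamiltonian vector field of \<open>z\<close> has \<open>\<delta>S = 0\<close>, because \<open>z\<close> is a function of \<open>Y\<close> and \<open>Z\<close>.\<close>
lemma hamiltonian_tangent:
  "tangent D S 0 (gradS + gradD) (gradS - gradD) (commutator gradS D + commutator gradD S) 0"
  using grad_invariant unfolding tangent_def
  by (simp add: commutator_add_left commutator_add_right commutator_diff_left commutator_diff_right
      algebra_simps eq_neg_iff_add_eq_0) (simp add: commutator_def)

text \<open>Since \<open>D = Y - Z\<close> and \<open>S = Y + Z\<close>, the generators
  \<open>gradS + gradD\<close> and \<open>gradS - gradD\<close> are the gradients of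
  \<open>z\<close> in \<open>Y\<close> and \<open>Z\<close>.\<close>

lemma hamiltonian_omega:
  assumes "is_jet D' S' z' \<eta>'"
  shows "omega 0 (gradS + gradD) (gradS - gradD) D' S' = z'"
  unfolding jet_gradient[OF assms] omega_def
  by (simp add: trace_mult_add trace_mult_diff trace_add_mult trace_diff_mult field_simps)
    (simp add: trace_def)

text \<open>The flow fixes \<open>e\<close> and \<open>S\<close>, hence also \<open>\<psi>\<close>;
  it remains that \<open>\<psi>\<close> is a left eigenvector of the variation of \<open>D\<close>
  with eigenvalue \<open>1 - z\<^sup>2\<close>. Multiplied by \<open>z\<close> this is the variation
  of \<open>\<eta>\<close>.\<close>

lemma hamiltonian_jet:
  "is_jet (commutator gradS D + commutator gradD S) 0 0 (z - z ^ 3)"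
proof -
  define D1 where "D1 = commutator gradS D + commutator gradD S"
  have 0: "D1 $ 2 $ 1 = 0" "D1 $ 3 $ 1 = 0"
    by (simp_all add: D1_def mat_entries gradS_def gradD_def power2_eq_square)
  have k3: "k * S $ 2 $ 1 * S $ 3 $ 1 * (\<alpha> $ 3 - \<alpha> $ 2) = 1" by (rule k)
  have "- S $ 3 $ 1 * D1 $ 2 $ 2 + S $ 2 $ 1 * D1 $ 3 $ 2 = - S $ 3 $ 1 * (1 - z\<^sup>2)"
    using k3 zero2 zero3 by (simp add: D1_def mat_entries gradS_def gradD_def) algebra
  moreover have "- S $ 3 $ 1 * D1 $ 2 $ 3 + S $ 2 $ 1 * D1 $ 3 $ 3 = S $ 2 $ 1 * (1 - z\<^sup>2)"
    using k3 zero2 zero3 by (simp add: D1_def mat_entries gradS_def gradD_def) algebra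
  ultimately have "\<psi> v* (scale_mat 0 D + scale_mat z D1 + 0 - mat (z - z ^ 3)) = 0"
    using 0 by (simp add: mat_entries mat_def) algebra
  then show ?thesis unfolding D1_def[symmetric] jet_def
    using 0 by (intro exI[of _ 0] exI[of _ "D1 $ 1 $ 1"]) (simp add: mat_entries axis_def)
qed

end

section \<open>Infinitesimal rigidity and the comparison of the two forms\<close>

lemma vandermonde3:
  fixes a1 a2 a3 d1 d2 d3 :: complex
  assumes "a1 \<noteq> a2" "a1 \<noteq> a3" "a2 \<noteq> a3"
    and "d1 + d2 + d3 = 0" "a1 * d1 + a2 * d2 + a3 * d3 = 0"
      "a1\<^sup>2 * d1 + a2\<^sup>2 * d2 + a3\<^sup>2 * d3 = 0"
  shows "d1 = 0 \<and> d2 = 0 \<and> d3 = 0"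
proof -
  have "(a1 - a2) * (a1 - a3) * d1 = 0" "(a2 - a1) * (a2 - a3) * d2 = 0"
    "(a3 - a1) * (a3 - a2) * d3 = 0"
    using assms(4-6) by algebra+
  then show ?thesis using assms(1-3) by simp
qed

lemma commutator_diag_nth: "commutator M (diag_mat a) $ i $ j = M $ i $ j * (a $ j - a $ i)"
  by (simp add: commutator_def matrix_matrix_mult_def diag_mat_def if_distrib[of "\<lambda>x. _ * x"]
      if_distrib[of "\<lambda>x. x * _"] sum.delta sum.delta' algebra_simps cong: if_cong)

text \<open>Along the orbits of \<open>X = - S\<close>, \<open>Y = (S + D) / 2\<close> and
  \<open>Z = (S - D) / 2\<close> the traces of powers are constant to first order; adding and
  subtracting the relations for \<open>S + D\<close> and \<open>S - D\<close> separates the parities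
  in \<open>D\<close>. The last relation ties two coefficients of the spectral curve together, which
  leaves one free.\<close>

lemma tangent_traces:
  assumes "tangent D S A B C D' S'"
  shows "trace S' = 0" "trace D' = 0" "trace (S ** S') = 0" "trace (D ** D') = 0"
    "trace (D ** S') + trace (S ** D') = 0" "trace (S ** S ** S') = 0"
    "trace (D ** D ** S') + trace ((S ** D + D ** S) ** D') = 0"
    "trace (D ** D ** D') + trace (S ** S ** D') + trace ((S ** D + D ** S) ** S') = 0"
proof -
  have S: "S' = commutator A S" and p: "S' + D' = commutator B (S + D)"
    and m: "S' - D' = commutator C (S - D)"
    using assms unfolding tangent_def by auto
  have p0: "trace (S' + D') = 0"
    unfolding p by (rule trace_commutator)
  have s0: "trace S' = 0"
    unfolding S by (rule trace_commutator)
  show "trace S' = 0" by (rule s0)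
  show "trace D' = 0" using p0 s0 by (simp add: trace_add)
  have p1: "trace ((S + D) ** (S' + D')) = 0"
    unfolding p by (rule trace_self_commutator)
  have m1: "trace ((S - D) ** (S' - D')) = 0"
    unfolding m by (rule trace_self_commutator)
  have s1: "trace (S ** S') = 0"
    unfolding S by (rule trace_self_commutator)
  show "trace (S ** S') = 0" by (rule s1)
  have "trace ((S + D) ** (S' + D')) = trace (S ** S') + (trace (D ** S') + trace (S ** D')) + trace (D ** D')"
    and "trace ((S - D) ** (S' - D')) = trace (S ** S') - (trace (D ** S') + trace (S ** D')) + trace (D ** D')"
    by (simp_all add: mat_entries algebra_simps)
  then show "trace (D ** D') = 0" "trace (D ** S') + trace (S ** D') = 0"
    using p1 m1 s1 by algebra+
  have p2: "trace ((S + D) ** (S + D) ** (S' + D')) = 0"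
    unfolding p by (rule trace_square_commutator)
  have m2: "trace ((S - D) ** (S - D) ** (S' - D')) = 0"
    unfolding m by (rule trace_square_commutator)
  have s2: "trace (S ** S ** S') = 0"
    unfolding S by (rule trace_square_commutator)
  show "trace (S ** S ** S') = 0" by (rule s2)
  let ?u = "trace (D ** D ** S') + trace ((S ** D + D ** S) ** D')"
  let ?v = "trace (D ** D ** D') + trace (S ** S ** D') + trace ((S ** D + D ** S) ** S')"
  have "(S + D) ** (S + D) = S ** S + D ** D + (S ** D + D ** S)"
    "(S - D) ** (S - D) = S ** S + D ** D - (S ** D + D ** S)"
    by (simp_all add: mat_entries algebra_simps)
  then have "trace ((S + D) ** (S + D) ** (S' + D')) = trace (S ** S ** S') + ?u + ?v"
    "trace ((S - D) ** (S - D) ** (S' - D')) = trace (S ** S ** S') + ?u - ?v"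
    by (simp_all add: trace_add_mult trace_mult_add trace_mult_diff trace_diff_mult)
  then show "?u = 0" "?v = 0" using p2 m2 s2 by algebra+
qed

text \<open>Both sides are the derivative of \<open>det\<close> at \<open>M\<close> in the direction \<open>N\<close>, up to a multiple of
  \<open>trace N\<close>; on the right it is expanded along the first row.\<close>
lemma det_variation:
  fixes M N :: cmat3
  shows "trace (M ** M ** N) - (M $ 1 $ 1 + M $ 2 $ 2 + M $ 3 $ 3) * trace (M ** N)
    = N $ 1 $ 1 * (M $ 2 $ 2 * M $ 3 $ 3 - M $ 2 $ 3 * M $ 3 $ 2)
    + M $ 1 $ 1 * (N $ 2 $ 2 * M $ 3 $ 3 + M $ 2 $ 2 * N $ 3 $ 3 - N $ 2 $ 3 * M $ 3 $ 2 - M $ 2 $ 3 * N $ 3 $ 2)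
    - N $ 1 $ 2 * (M $ 2 $ 1 * M $ 3 $ 3 - M $ 3 $ 1 * M $ 2 $ 3)
    - M $ 1 $ 2 * (N $ 2 $ 1 * M $ 3 $ 3 + M $ 2 $ 1 * N $ 3 $ 3 - N $ 3 $ 1 * M $ 2 $ 3 - M $ 3 $ 1 * N $ 2 $ 3)
    - N $ 1 $ 3 * (M $ 3 $ 1 * M $ 2 $ 2 - M $ 2 $ 1 * M $ 3 $ 2)
    - M $ 1 $ 3 * (N $ 3 $ 1 * M $ 2 $ 2 + M $ 3 $ 1 * N $ 2 $ 2 - N $ 2 $ 1 * M $ 3 $ 2 - M $ 2 $ 1 * N $ 3 $ 2)
    + (N $ 1 $ 1 + N $ 2 $ 2 + N $ 3 $ 3) * (M $ 1 $ 2 * M $ 2 $ 1 + M $ 1 $ 3 * M $ 3 $ 1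
      + M $ 2 $ 3 * M $ 3 $ 2 - M $ 1 $ 1 * M $ 2 $ 2 - M $ 1 $ 1 * M $ 3 $ 3 - M $ 2 $ 2 * M $ 3 $ 3)"
  by (simp add: mat_entries algebra_simps)

context diagonal_frame
begin

text \<open>If \<open>\<delta>z = \<delta>\<eta> = 0\<close>, the spectral curve is fixed to first order, because only one of its
  coefficients is free; hence so are the eigenvalues and the diagonal of \<open>S\<close>. The two linear
  equations then fix \<open>S\<^sub>2\<^sub>3 S\<^sub>3\<^sub>2\<close> and with it the other products \<open>S\<^sub>j\<^sub>k S\<^sub>k\<^sub>j\<close>.\<close>
lemma diagonal_rigidity:
  assumes z: "z \<noteq> 0" "z\<^sup>2 \<noteq> 1"
    and tan: "tangent D S A B C (diag_mat d) P" and jet: "is_jet (diag_mat d) P 0 0"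
  shows "d = 0 \<and> (\<exists>x. P = commutator (diag_mat x) S)"
proof -
  note scal = mat_entries algebra_simps power2_eq_square
  obtain e2 e3 p1 p2 p3 where e: "0 = (\<alpha> $ 1 - \<alpha> $ 2) * e2" "0 = (\<alpha> $ 1 - \<alpha> $ 3) * e3"
    and p1: "p1 = S $ 3 $ 1 * e2 - S $ 2 $ 1 * e3"
    and r: "p1 * (\<alpha> $ 1 * z + S $ 1 $ 1 - \<eta>) + p2 * S $ 2 $ 1 + p3 * S $ 3 $ 1
      = S $ 3 $ 1 * P $ 2 $ 1 - S $ 2 $ 1 * P $ 3 $ 1"
      "p1 * S $ 1 $ 2 + p2 * (\<alpha> $ 2 * z - \<eta> + S $ 2 $ 2) + p3 * S $ 3 $ 2
      = S $ 3 $ 1 * (z * d $ 2 + P $ 2 $ 2) - S $ 2 $ 1 * P $ 3 $ 2"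
      "p1 * S $ 1 $ 3 + p2 * S $ 2 $ 3 + p3 * (\<alpha> $ 3 * z - \<eta> + S $ 3 $ 3)
      = S $ 3 $ 1 * P $ 2 $ 3 - S $ 2 $ 1 * (z * d $ 3 + P $ 3 $ 3)"
    by (rule is_jetE[OF jet]) (simp add: diag_mat_def)
  have p1: "p1 = 0" using e distinct p1 by simp
  define m2 where "m2 = \<alpha> $ 2 * z - \<eta> + S $ 2 $ 2"
  define m3 where "m3 = \<alpha> $ 3 * z - \<eta> + S $ 3 $ 3"
  define m1 where "m1 = \<alpha> $ 1 * z - \<eta> + S $ 1 $ 1"
  define n1 where "n1 = z * d $ 1 + P $ 1 $ 1"
  define n2 where "n2 = z * d $ 2 + P $ 2 $ 2"
  define n3 where "n3 = z * d $ 3 + P $ 3 $ 3"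
  have E2: "S $ 2 $ 1 * m3 = S $ 3 $ 1 * S $ 2 $ 3" and E3: "S $ 3 $ 1 * m2 = S $ 2 $ 1 * S $ 3 $ 2"
    using zero2 zero3 by (simp_all add: m2_def m3_def)
  \<comment> \<open>Both columns of the lower right block are multiples of
    \<open>(S $ 2 $ 1, S $ 3 $ 1)\<close>, so the first equation of \<open>r\<close> eliminates
    \<open>p2\<close> and \<open>p3\<close> from the others. What remains are the derivatives of
    \<open>zero2\<close> and \<open>zero3\<close>.\<close>
  have "S $ 2 $ 1 * (P $ 2 $ 1 * m3 + S $ 2 $ 1 * n3 - P $ 3 $ 1 * S $ 2 $ 3 - S $ 3 $ 1 * P $ 2 $ 3) = 0"
    "S $ 2 $ 1 * (P $ 3 $ 1 * m2 + S $ 3 $ 1 * n2 - P $ 2 $ 1 * S $ 3 $ 2 - S $ 2 $ 1 * P $ 3 $ 2) = 0"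
    using r E2 E3 unfolding p1 m2_def[symmetric] m3_def[symmetric] n2_def[symmetric] n3_def[symmetric]
    by algebra+
  then have F2: "P $ 2 $ 1 * m3 + S $ 2 $ 1 * n3 = P $ 3 $ 1 * S $ 2 $ 3 + S $ 3 $ 1 * P $ 2 $ 3"
    and F3: "P $ 3 $ 1 * m2 + S $ 3 $ 1 * n2 = P $ 2 $ 1 * S $ 3 $ 2 + S $ 2 $ 1 * P $ 3 $ 2"
    using s_nz unfolding mult_eq_0_iff by algebra+
  note tr = tangent_traces[OF tan]
  have t: "P $ 1 $ 1 + P $ 2 $ 2 + P $ 3 $ 3 = 0" "d $ 1 + d $ 2 + d $ 3 = 0"
    "\<alpha> $ 1 * d $ 1 + \<alpha> $ 2 * d $ 2 + \<alpha> $ 3 * d $ 3 = 0"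
    using tr(1,2,4) by (simp_all add: mat_entries)
  have "S $ 2 $ 1 * S $ 3 $ 1 * (n2 * m3 + m2 * n3 - P $ 2 $ 3 * S $ 3 $ 2 - S $ 2 $ 3 * P $ 3 $ 2) = 0"
    using E2 E3 F2 F3 by algebra
  then have C': "n2 * m3 + m2 * n3 = P $ 2 $ 3 * S $ 3 $ 2 + S $ 2 $ 3 * P $ 3 $ 2"
    using s_nz unfolding mult_eq_0_iff by algebra
  have "S $ 2 $ 1 * S $ 3 $ 1 * (m2 * m3 - S $ 2 $ 3 * S $ 3 $ 2) = 0"
    using E2 E3 by algebra
  then have C: "m2 * m3 = S $ 2 $ 3 * S $ 3 $ 2" using s_nz by simp
  let ?M = "L" and ?N = "scale_mat z (diag_mat d) + P"
  have tN: "n1 + n2 + n3 = 0"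
    unfolding n1_def n2_def n3_def using t by algebra
  have "trace (?M ** ?N) = z\<^sup>2 * trace (D ** diag_mat d) + z * (trace (D ** P) + trace (S ** diag_mat d))
      + trace (S ** P) - \<eta> * (z * trace (diag_mat d) + trace P)"
    by (simp add: mat_def scal)
  then have tMN: "trace (?M ** ?N) = 0" using tr by simp
  have "trace (?M ** ?M ** ?N) = z ^ 3 * trace (D ** D ** diag_mat d)
      + z\<^sup>2 * (trace (D ** D ** P) + trace ((S ** D + D ** S) ** diag_mat d))
      + z * (trace (S ** S ** diag_mat d) + trace ((S ** D + D ** S) ** P)) + trace (S ** S ** P)
      - 2 * \<eta> * trace (?M ** ?N) - \<eta>\<^sup>2 * (z * trace (diag_mat d) + trace P)"
    by (simp add: mat_def mat_entries) algebra
  \<comment> \<open>The last relation of \<open>tangent_traces\<close> makes the coefficients of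
    \<open>z ^ 3\<close> and \<open>z\<close> opposite; this is the origin of the factor
    \<open>z (z\<^sup>2 - 1)\<close>.\<close>
  then have tMMN: "trace (?M ** ?M ** ?N) = (z ^ 3 - z) * trace (D ** D ** diag_mat d)"
    using tr tMN by (simp add: algebra_simps eq_neg_iff_add_eq_0) algebra
  have Mn: "?M $ 1 $ 1 = m1" "?M $ 2 $ 2 = m2" "?M $ 3 $ 3 = m3" "?N $ 1 $ 1 = n1" "?N $ 2 $ 2 = n2"
    "?N $ 3 $ 3 = n3"
    by (simp_all add: diag_mat_def mat_def m1_def m2_def m3_def n1_def n2_def n3_def mult.commute)
  have Mo: "?M $ 1 $ 2 = S $ 1 $ 2" "?M $ 1 $ 3 = S $ 1 $ 3" "?M $ 2 $ 1 = S $ 2 $ 1"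
    "?M $ 2 $ 3 = S $ 2 $ 3" "?M $ 3 $ 1 = S $ 3 $ 1" "?M $ 3 $ 2 = S $ 3 $ 2"
    "?N $ 1 $ 2 = P $ 1 $ 2" "?N $ 1 $ 3 = P $ 1 $ 3" "?N $ 2 $ 1 = P $ 2 $ 1"
    "?N $ 2 $ 3 = P $ 2 $ 3" "?N $ 3 $ 1 = P $ 3 $ 1" "?N $ 3 $ 2 = P $ 3 $ 2"
    by (simp_all add: diag_mat_def mat_def)
  \<comment> \<open>The cofactors of the first row and their variations: every term on the right of
    \<open>det_variation\<close> contains one of them or \<open>trace ?N\<close>.\<close>
  have "m2 * m3 - S $ 2 $ 3 * S $ 3 $ 2 = 0"
    "n2 * m3 + m2 * n3 - P $ 2 $ 3 * S $ 3 $ 2 - S $ 2 $ 3 * P $ 3 $ 2 = 0"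
    "S $ 2 $ 1 * m3 - S $ 3 $ 1 * S $ 2 $ 3 = 0" "S $ 3 $ 1 * m2 - S $ 2 $ 1 * S $ 3 $ 2 = 0"
    "P $ 2 $ 1 * m3 + S $ 2 $ 1 * n3 - P $ 3 $ 1 * S $ 2 $ 3 - S $ 3 $ 1 * P $ 2 $ 3 = 0"
    "P $ 3 $ 1 * m2 + S $ 3 $ 1 * n2 - P $ 2 $ 1 * S $ 3 $ 2 - S $ 2 $ 1 * P $ 3 $ 2 = 0"
    using C C' E2 E3 F2 F3 by algebra+
  note det_variation[of ?M ?N, unfolded Mn Mo this tN tMN]
  then have "(z ^ 3 - z) * trace (D ** D ** diag_mat d) = 0"
    unfolding tMMN by simp
  moreover have "z ^ 3 - z = z * (z\<^sup>2 - 1)" by algebra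
  ultimately have "trace (D ** D ** diag_mat d) = 0" using z by simp
  then have "(\<alpha> $ 1)\<^sup>2 * d $ 1 + (\<alpha> $ 2)\<^sup>2 * d $ 2 + (\<alpha> $ 3)\<^sup>2 * d $ 3 = 0"
    by (simp add: mat_entries power2_eq_square)
  with vandermonde3[OF distinct t(2,3)] have d: "d $ 1 = 0" "d $ 2 = 0" "d $ 3 = 0" by auto
  then have d0: "d = 0" by (simp add: vec_eq_iff forall_3)
  have "P $ 1 $ 1 = 0 \<and> P $ 2 $ 2 = 0 \<and> P $ 3 $ 3 = 0"
    by (rule vandermonde3[OF distinct]) (use tr(1,5,7) d in \<open>simp_all add: mat_entries power2_eq_square\<close>)
  then have Pd: "P $ 1 $ 1 = 0" "P $ 2 $ 2 = 0" "P $ 3 $ 3 = 0" by auto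
  have n0: "n2 = 0" "n3 = 0" using d Pd by (simp_all add: n2_def n3_def)
  \<comment> \<open>The first column of \<open>P\<close> dictates the only candidate for the
    diagonal generator, normalized to have first entry zero.\<close>
  define x2 where "x2 = P $ 2 $ 1 / S $ 2 $ 1"
  define x3 where "x3 = P $ 3 $ 1 / S $ 3 $ 1"
  have x: "P $ 2 $ 1 = x2 * S $ 2 $ 1" "P $ 3 $ 1 = x3 * S $ 3 $ 1"
    using s_nz by (simp_all add: x2_def x3_def)
  have "S $ 2 $ 1 * (P $ 3 $ 2 - (x3 - x2) * S $ 3 $ 2) = 0" "S $ 3 $ 1 * (P $ 2 $ 3 - (x2 - x3) * S $ 2 $ 3) = 0"
    using E2 E3 F2 F3 n0 unfolding x by algebra+
  then have x23: "P $ 3 $ 2 = (x3 - x2) * S $ 3 $ 2" "P $ 2 $ 3 = (x2 - x3) * S $ 2 $ 3"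
    using s_nz by simp_all
  \<comment> \<open>Variations of \<open>S $ 1 $ 2 * S $ 2 $ 1\<close> and
    \<open>S $ 1 $ 3 * S $ 3 $ 1\<close>; \<open>tr(3)\<close> and \<open>tr(8)\<close> give two
    independent equations for them.\<close>
  define q12 where "q12 = P $ 1 $ 2 * S $ 2 $ 1 + S $ 1 $ 2 * P $ 2 $ 1"
  define q13 where "q13 = P $ 1 $ 3 * S $ 3 $ 1 + S $ 1 $ 3 * P $ 3 $ 1"
  have "q12 + q13 = 0"
    using tr(3) Pd x23 by (simp add: mat_entries q12_def q13_def) algebra
  moreover have "(\<alpha> $ 1 + \<alpha> $ 2) * q12 + (\<alpha> $ 1 + \<alpha> $ 3) * q13 = 0"
    using tr(8) Pd x23 d by (simp add: mat_entries q12_def q13_def) algebra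
  ultimately have "(\<alpha> $ 2 - \<alpha> $ 3) * q12 = 0" and q: "q13 = - q12" by algebra+
  then have "q12 = 0" "q13 = 0" using distinct by auto
  then have "S $ 2 $ 1 * (P $ 1 $ 2 + x2 * S $ 1 $ 2) = 0" "S $ 3 $ 1 * (P $ 1 $ 3 + x3 * S $ 1 $ 3) = 0"
    unfolding q12_def q13_def x by algebra+
  then have x1: "P $ 1 $ 2 = - x2 * S $ 1 $ 2" "P $ 1 $ 3 = - x3 * S $ 1 $ 3"
    using s_nz by (simp_all add: eq_neg_iff_add_eq_0)
  have "P = commutator (diag_mat (vector [0, x2, x3])) S"
    by (simp add: mat_entries x x1 x23 Pd algebra_simps)
  with d0 show ?thesis by blast
qed

text \<open>Distinct eigenvalues allow the off-diagonal part of \<open>D'\<close> to be written as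
  \<open>commutator G D\<close>. Subtracting this vertical direction leaves the diagonal
  case.\<close>

lemma rigidity:
  assumes z: "z \<noteq> 0" "z\<^sup>2 \<noteq> 1"
    and tan: "tangent D S A B C D' S'" and jet: "is_jet D' S' 0 0"
  shows "\<exists>G. D' = commutator G D \<and> S' = commutator G S"
proof -
  define G :: cmat3 where "G = (\<chi> i j. if i = j then 0 else D' $ i $ j / (\<alpha> $ j - \<alpha> $ i))"
  define d where "d = (\<chi> i. D' $ i $ i)"
  have D': "D' - commutator G D = diag_mat d"
    using distinct by (simp add: vec_eq_iff forall_3 commutator_diag_nth)
      (simp add: G_def d_def diag_mat_def)
  have "tangent D S (A - G) (B - G) (C - G) (diag_mat d) (S' - commutator G S)"
    using tan unfolding tangent_def D'[symmetric]
    by (simp add: commutator_diff_left commutator_add_right commutator_diff_right)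
  moreover have "is_jet (diag_mat d) (S' - commutator G S) 0 0"
  proof -
    have "scale_mat 1 D' + scale_mat (- 1) (commutator G D) = diag_mat d"
      "scale_mat 1 S' + scale_mat (- 1) (commutator G S) = S' - commutator G S"
      by (simp_all add: D'[symmetric] vec_eq_iff)
    then show ?thesis
      using jet_comb[OF jet jet_vertical[OF D_axis psi_L, of G], of 1 "- 1"] by simp
  qed
  ultimately obtain x where "d = 0" "S' - commutator G S = commutator (diag_mat x) S"
    using diagonal_rigidity[OF z] by blast
  then have "D' = commutator (G + diag_mat x) D" "S' = commutator (G + diag_mat x) S"
    using D' by (simp_all add: commutator_add_left algebra_simps)
      (simp_all add: mat_entries)
  then show ?thesis by blast
qed

text \<open>By the two equations on \<open>c1\<close>, \<open>c2\<close>, \<open>c\<close>, the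
  combination of two tangent vectors with the Hamiltonian field of \<open>z\<close> is vertical, so
  \<open>omega\<close> annihilates it; against the third vector the Hamiltonian term contributes
  \<open>c * z3\<close>. This takes the place of a dimension count.\<close>

lemma omega_combination_zero:
  assumes z: "z \<noteq> 0" "z\<^sup>2 \<noteq> 1"
    and 1: "tangent D S A1 B1 C1 D1 S1" "is_jet D1 S1 z1 \<eta>1"
    and 2: "tangent D S A2 B2 C2 D2 S2" "is_jet D2 S2 z2 \<eta>2"
    and 3: "tangent D S A3 B3 C3 D3 S3" "is_jet D3 S3 z3 \<eta>3"
    and c: "c1 * z1 + c2 * z2 = 0" "c1 * \<eta>1 + c2 * \<eta>2 + c * (z - z ^ 3) = 0"
  shows "c1 * omega A1 B1 C1 D3 S3 + c2 * omega A2 B2 C2 D3 S3 + c * z3 = 0"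
proof -
  note t = tangent_comb[OF tangent_comb[OF 1(1) 2(1), of c1 c2] hamiltonian_tangent, of 1 c]
  note j = jet_comb[OF jet_comb[OF 1(2) 2(2), of c1 c2] hamiltonian_jet, of 1 c]
  have "\<exists>G. scale_mat 1 (scale_mat c1 D1 + scale_mat c2 D2)
      + scale_mat c (commutator gradS D + commutator gradD S) = commutator G D
    \<and> scale_mat 1 (scale_mat c1 S1 + scale_mat c2 S2) + scale_mat c 0 = commutator G S"
    by (rule rigidity[OF z t]) (use j c in simp)
  then obtain G where G: "scale_mat 1 (scale_mat c1 D1 + scale_mat c2 D2)
      + scale_mat c (commutator gradS D + commutator gradD S) = commutator G D"
    "scale_mat 1 (scale_mat c1 S1 + scale_mat c2 S2) + scale_mat c 0 = commutator G S"
    by blast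
  have "omega A3 B3 C3 (commutator G D) (commutator G S) = 0"
    using omega_antisym[OF 3(1) tangent_vertical] omega_vertical by simp
  then have "omega (scale_mat 1 (scale_mat c1 A1 + scale_mat c2 A2) + scale_mat c 0)
     (scale_mat 1 (scale_mat c1 B1 + scale_mat c2 B2) + scale_mat c (gradS + gradD))
     (scale_mat 1 (scale_mat c1 C1 + scale_mat c2 C2) + scale_mat c (gradS - gradD)) D3 S3 = 0"
    using omega_antisym[OF t 3(1)] unfolding G by simp
  then show ?thesis
    unfolding omega_comb_left hamiltonian_omega[OF 3(2)] by simp
qed

text \<open>The right side divided by \<open>z ^ 3 - z\<close> is the wedge of the differentials of
  \<open>z\<close> and \<open>\<eta> / (z ^ 3 - z)\<close>, since the derivative of the denominator
  is a multiple of that of \<open>z\<close>.\<close>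

theorem omega_eq:
  assumes z: "z \<noteq> 0" "z\<^sup>2 \<noteq> 1"
    and 1: "tangent D S A1 B1 C1 D1 S1" "is_jet D1 S1 z1 \<eta>1"
    and 2: "tangent D S A2 B2 C2 D2 S2" "is_jet D2 S2 z2 \<eta>2"
  shows "(z ^ 3 - z) * omega A1 B1 C1 D2 S2 = z1 * \<eta>2 - z2 * \<eta>1"
proof -
  have "z ^ 3 - z = z * (z\<^sup>2 - 1)" by algebra
  then have m: "z ^ 3 - z \<noteq> 0" "z \<noteq> z ^ 3" "z - z ^ 3 \<noteq> 0" using z by auto
  have self: "omega A1 B1 C1 D1 S1 = 0" "omega A2 B2 C2 D2 S2 = 0"
    using omega_antisym[OF 1(1) 1(1)] omega_antisym[OF 2(1) 2(1)] by simp_all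
  have anti: "omega A2 B2 C2 D1 S1 = - omega A1 B1 C1 D2 S2"
    by (rule omega_antisym[OF 2(1) 1(1)])
  \<comment> \<open>The coefficients \<open>z2\<close> and \<open>- z1\<close> cancel the variation
    of \<open>z\<close>, and \<open>c\<close> cancels that of \<open>\<eta>\<close>. Pairing with
    the two vectors themselves gives \<open>i\<close>.\<close>
  define c where "c = (z2 * \<eta>1 - z1 * \<eta>2) / (z ^ 3 - z)"
  have c: "c * (z ^ 3 - z) = z2 * \<eta>1 - z1 * \<eta>2" using m by (simp add: c_def)
  have rel: "z2 * z1 + (- z1) * z2 = 0" by simp
  have rel': "z2 * \<eta>1 + (- z1) * \<eta>2 + c * (z - z ^ 3) = 0" using c by algebra
  have i: "z1 * (omega A1 B1 C1 D2 S2 + c) = 0" "z2 * (omega A1 B1 C1 D2 S2 + c) = 0"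
    using omega_combination_zero[OF z 1 2 1 rel rel'] omega_combination_zero[OF z 1 2 2 rel rel'] self anti
    by (simp_all add: algebra_simps)
  show ?thesis
  proof (cases "z1 = 0 \<and> z2 = 0")
    case False
    then have "omega A1 B1 C1 D2 S2 = - c" using i by (auto simp: eq_neg_iff_add_eq_0)
    then show ?thesis using c by algebra
  next
    case True
    \<comment> \<open>Here the first vector is vertical up to a multiple of the Hamiltonian field,
      whose pairing with the second vector is \<open>z2 = 0\<close>.\<close>
    have "\<eta>1 + 0 * \<eta>2 + (\<eta>1 / (z ^ 3 - z)) * (z - z ^ 3) = 0" using m by (simp add: field_simps)
    then have "omega A1 B1 C1 D2 S2 = 0"
      using omega_combination_zero[OF z 1 2 2, of 1 0 "\<eta>1 / (z ^ 3 - z)"] True by simp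
    then show ?thesis using True by simp
  qed
qed

end

section \<open>The adjoint action\<close>

lemma hermitian_adjoint_nth [simp]: "hermitian_adjoint A $ i $ j = cnj (A $ j $ i)"
  by (simp add: hermitian_adjoint_def)

lemma hermitian_adjoint_mult:
  "hermitian_adjoint (A ** B) = hermitian_adjoint B ** hermitian_adjoint A"
  and hermitian_adjoint_add: "hermitian_adjoint (A + B) = hermitian_adjoint A + hermitian_adjoint B"
  and hermitian_adjoint_diff: "hermitian_adjoint (A - B) = hermitian_adjoint A - hermitian_adjoint B"
  and hermitian_adjoint_idem [simp]: "hermitian_adjoint (hermitian_adjoint A) = A"
  and trace_hermitian_adjoint: "trace (hermitian_adjoint A) = cnj (trace A)"
  and det_hermitian_adjoint: "det (hermitian_adjoint A) = cnj (det A)"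
  and hermitian_adjoint_mat_1: "hermitian_adjoint (mat 1) = mat 1"
  by (simp_all add: mat_entries mat_def det_3 algebra_simps)

lemma SU3_inverse:
  assumes "g \<in> SU3"
  shows "g ** hermitian_adjoint g = mat 1" "hermitian_adjoint g ** g = mat 1"
  using assms matrix_left_right_inverse[of g "hermitian_adjoint g"] by (auto simp: SU3_def)

lemma SU3_hermitian_adjoint: "g \<in> SU3 \<Longrightarrow> hermitian_adjoint g \<in> SU3"
  using SU3_inverse[of g] by (simp add: SU3_def det_hermitian_adjoint)

lemma SU3_mult:
  assumes "g \<in> SU3" "h \<in> SU3"
  shows "g ** h \<in> SU3"
proof -
  have "(g ** h) ** hermitian_adjoint (g ** h) = g ** (h ** hermitian_adjoint h) ** hermitian_adjoint g"
    by (simp add: hermitian_adjoint_mult matrix_mul_assoc)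
  then show ?thesis using assms by (simp add: SU3_def det_mul)
qed

lemma SU3_one: "mat 1 \<in> SU3"
  by (simp add: SU3_def hermitian_adjoint_mat_1)

lemma Ad_Ad: "Ad g (Ad h A) = Ad (g ** h) A"
  by (simp add: Ad_def hermitian_adjoint_mult matrix_mul_assoc)

lemma Ad_one [simp]: "Ad (mat 1) A = A"
  by (simp add: Ad_def hermitian_adjoint_mat_1)

lemma Ad_add: "Ad g (A + B) = Ad g A + Ad g B"
  and Ad_diff: "Ad g (A - B) = Ad g A - Ad g B"
  and Ad_minus: "Ad g (- A) = - Ad g A"
  and Ad_zero [simp]: "Ad g 0 = 0"
  by (simp_all add: Ad_def mat_entries algebra_simps)

lemma Ad_mult:
  assumes "g \<in> SU3"
  shows "Ad g (A ** B) = Ad g A ** Ad g B"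
proof -
  have "Ad g A ** Ad g B = g ** A ** (hermitian_adjoint g ** g) ** B ** hermitian_adjoint g"
    by (simp add: Ad_def matrix_mul_assoc)
  then show ?thesis using SU3_inverse[OF assms] by (simp add: Ad_def matrix_mul_assoc)
qed

lemma Ad_commutator: "g \<in> SU3 \<Longrightarrow> Ad g (commutator A B) = commutator (Ad g A) (Ad g B)"
  by (simp add: commutator_def Ad_diff Ad_mult)

lemma trace_Ad: "g \<in> SU3 \<Longrightarrow> trace (Ad g A) = trace A"
  using trace_mul_sym[of "g ** A" "hermitian_adjoint g"]
  by (simp add: Ad_def matrix_mul_assoc SU3_inverse)

lemma hermitian_adjoint_Ad: "hermitian_adjoint (Ad g A) = Ad g (hermitian_adjoint A)"
  by (simp add: Ad_def hermitian_adjoint_mult matrix_mul_assoc)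

lemma Ad_su3: "g \<in> SU3 \<Longrightarrow> A \<in> su3 \<Longrightarrow> Ad g A \<in> su3"
  by (simp add: su3_def hermitian_adjoint_Ad trace_Ad Ad_minus)

lemma orbit_Ad: "g \<in> SU3 \<Longrightarrow> X \<in> orbit lam \<Longrightarrow> Ad g X \<in> orbit lam"
  unfolding orbit_def using SU3_mult Ad_Ad by blast

lemma orbit_skew:
  assumes "X \<in> orbit lam"
  shows "hermitian_adjoint X = - X"
proof -
  let ?d = "diag_mat (\<chi> j. \<i> * complex_of_real (lam $ j))"
  have "hermitian_adjoint ?d = - ?d" by (simp add: mat_entries)
  then show ?thesis using assms by (auto simp: orbit_def hermitian_adjoint_Ad Ad_minus)
qed

text \<open>The power sums of the eigenvalues are the invariants through which the orbits constrain
  \<open>Y - Z\<close> and \<open>Y + Z\<close> on the zero level.\<close>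

lemma orbit_traces:
  assumes "X \<in> orbit lam"
  shows "trace X = trace (diag_mat (\<chi> j. \<i> * complex_of_real (lam $ j)))"
    "trace (X ** X) = trace (diag_mat (\<chi> j. \<i> * complex_of_real (lam $ j))
        ** diag_mat (\<chi> j. \<i> * complex_of_real (lam $ j)))"
    "trace (X ** X ** X) = trace (diag_mat (\<chi> j. \<i> * complex_of_real (lam $ j))
        ** diag_mat (\<chi> j. \<i> * complex_of_real (lam $ j)) ** diag_mat (\<chi> j. \<i> * complex_of_real (lam $ j)))"
  using assms by (auto simp: orbit_def trace_Ad Ad_mult[symmetric])

lemma diagonal_action_simp: "diagonal_action g (X, Y, Z) = (Ad g X, Ad g Y, Ad g Z)"
  by (simp add: diagonal_action_def)

lemma diagonal_action_mult: "diagonal_action g (diagonal_action h p) = diagonal_action (g ** h) p"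
  by (cases p) (simp add: diagonal_action_def Ad_Ad)

lemma diagonal_action_one [simp]: "diagonal_action (mat 1) p = p"
  by (cases p) (simp add: diagonal_action_def)

lemma diagonal_action_inverse [simp]:
  "g \<in> SU3 \<Longrightarrow> diagonal_action (hermitian_adjoint g) (diagonal_action g p) = p"
  "g \<in> SU3 \<Longrightarrow> diagonal_action g (diagonal_action (hermitian_adjoint g) p) = p"
  by (simp_all add: diagonal_action_mult SU3_inverse)

lemma zero_level_diagonal_action:
  "g \<in> SU3 \<Longrightarrow> p \<in> zero_level lam mu nu \<Longrightarrow> diagonal_action g p \<in> zero_level lam mu nu"
  by (cases p) (auto simp: zero_level_def diagonal_action_def moment_map_def orbit_Ad Ad_add[symmetric])

lemma conj_class_diagonal_action:
  assumes "g \<in> SU3"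
  shows "conj_class (diagonal_action g p) = conj_class p"
proof -
  have sub: "conj_class (diagonal_action h q) \<subseteq> conj_class q" if "h \<in> SU3" for h q
    using that SU3_mult by (auto simp: conj_class_def diagonal_action_mult)
  from sub[OF assms, of p] sub[OF SU3_hermitian_adjoint[OF assms], of "diagonal_action g p"] assms
  show ?thesis by simp
qed

lemma conj_class_self: "p \<in> conj_class p"
  using SU3_one by (auto simp: conj_class_def intro!: exI[of _ "mat 1"])

lemma triple_reduced_productD:
  assumes "c \<in> triple_reduced_product lam mu nu" "p \<in> c"
  shows "p \<in> zero_level lam mu nu" "c = conj_class p"
proof -
  obtain q g where "q \<in> zero_level lam mu nu" "c = conj_class q" "g \<in> SU3" "p = diagonal_action g q"
    using assms by (auto simp: triple_reduced_product_def conj_class_def)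
  then show "p \<in> zero_level lam mu nu" "c = conj_class p"
    using zero_level_diagonal_action conj_class_diagonal_action by auto
qed

section \<open>Unitary diagonalization\<close>

definition hin :: "complex^3 \<Rightarrow> complex^3 \<Rightarrow> complex" where
  "hin v w = (\<Sum>i\<in>UNIV. cnj (v $ i) * w $ i)"

lemma hin_skew:
  assumes "hermitian_adjoint A = - A"
  shows "hin v (A *v w) = - hin (A *v v) w"
proof -
  have a: "cnj (A $ j $ i) = - A $ i $ j" for i j
    using assms by (metis hermitian_adjoint_nth vector_uminus_component)
  show ?thesis
    by (simp add: hin_def mat_entries a algebra_simps)
qed

lemma skew_eigenvalue:
  assumes "hermitian_adjoint A = - A" "A *v v = a *s v" "hin v v = 1"
  shows "cnj a = - a"
proof -
  have "hin v (a *s v) = a * hin v v" "hin (a *s v) v = cnj a * hin v v"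
    by (simp_all add: hin_def sum_3 algebra_simps)
  then have "a = - cnj a" using hin_skew[OF assms(1), of v v] assms(2,3) by simp
  then show ?thesis by (metis minus_minus)
qed

lemma unit_eigenvector:
  fixes A :: cmat3
  assumes "det (A - mat a) = 0"
  obtains v where "A *v v = a *s v" "hin v v = 1"
proof -
  have "\<not> invertible (A - mat a)" using assms invertible_det_nz by blast
  then obtain w where w: "(A - mat a) *v w = 0" "w \<noteq> 0"
    by (metis invertible_left_inverse matrix_left_invertible_ker)
  have "A *v w = a *s w"
    using w(1) by (simp add: mat_entries mat_def algebra_simps)
  define n where "n = (cmod (w $ 1))\<^sup>2 + (cmod (w $ 2))\<^sup>2 + (cmod (w $ 3))\<^sup>2"
  have "n > 0"
  proof (rule ccontr)
    assume "\<not> n > 0"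
    then have "w $ 1 = 0" "w $ 2 = 0" "w $ 3 = 0"
      unfolding n_def by (smt (verit) norm_eq_zero zero_le_power2 zero_eq_power2)+
    then show False using w(2) by (simp add: vec_eq_iff forall_3)
  qed
  have nn: "hin w w = complex_of_real n"
    by (simp add: hin_def sum_3 n_def complex_norm_square mult.commute del: of_real_power)
  define c where "c = complex_of_real (1 / sqrt n)"
  have "hin (c *s w) (c *s w) = c\<^sup>2 * hin w w"
    by (simp add: hin_def sum_3 c_def power2_eq_square algebra_simps)
  also have "\<dots> = 1"
    unfolding nn c_def of_real_power[symmetric] of_real_mult[symmetric]
    using \<open>n > 0\<close> by (simp add: power_divide)
  finally have "hin (c *s w) (c *s w) = 1" .
  moreover have "A *v (c *s w) = a *s (c *s w)"
    using \<open>A *v w = a *s w\<close> by (simp add: vector_scalar_commute)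
  ultimately show ?thesis using that by blast
qed

text \<open>The third column of the inverse of \<open>g\<close> is \<open>cnj (v \<times> w)\<close>, which makes its determinant \<open>1\<close>.\<close>
lemma diagonalize_from_two:
  assumes A: "hermitian_adjoint A = - A"
    and v: "A *v v = a *s v" "hin v v = 1" and w: "A *v w = b *s w" "hin w w = 1" and vw: "hin v w = 0"
  shows "\<exists>g\<in>SU3. Ad g A = diag_mat (vector [a, b, trace A - a - b])"
proof -
  define g where "g = mat_of_rows (cnj (v $ 1)) (cnj (v $ 2)) (cnj (v $ 3))
     (cnj (w $ 1)) (cnj (w $ 2)) (cnj (w $ 3))
     (v $ 2 * w $ 3 - v $ 3 * w $ 2) (v $ 3 * w $ 1 - v $ 1 * w $ 3) (v $ 1 * w $ 2 - v $ 2 * w $ 1)"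
  have v1: "cnj (v $ 1) * v $ 1 + cnj (v $ 2) * v $ 2 + cnj (v $ 3) * v $ 3 = 1"
    and w1: "cnj (w $ 1) * w $ 1 + cnj (w $ 2) * w $ 2 + cnj (w $ 3) * w $ 3 = 1"
    and vw1: "cnj (v $ 1) * w $ 1 + cnj (v $ 2) * w $ 2 + cnj (v $ 3) * w $ 3 = 0"
    using v(2) w(2) vw by (simp_all add: hin_def sum_3)
  have wv1: "cnj (w $ 1) * v $ 1 + cnj (w $ 2) * v $ 2 + cnj (w $ 3) * v $ 3 = 0"
    using arg_cong[OF vw1, of cnj] by (simp add: mult.commute)
  have "det g = (cnj (v $ 1) * v $ 1 + cnj (v $ 2) * v $ 2 + cnj (v $ 3) * v $ 3)
      * (cnj (w $ 1) * w $ 1 + cnj (w $ 2) * w $ 2 + cnj (w $ 3) * w $ 3)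
      - (cnj (v $ 1) * w $ 1 + cnj (v $ 2) * w $ 2 + cnj (v $ 3) * w $ 3)
      * (cnj (w $ 1) * v $ 1 + cnj (w $ 2) * v $ 2 + cnj (w $ 3) * v $ 3)"
    by (simp add: det_3 g_def algebra_simps)
  then have det: "det g = 1" using v1 w1 vw1 by simp
  have "(v $ 2 * w $ 3 - v $ 3 * w $ 2) * cnj (v $ 2 * w $ 3 - v $ 3 * w $ 2)
      + (v $ 3 * w $ 1 - v $ 1 * w $ 3) * cnj (v $ 3 * w $ 1 - v $ 1 * w $ 3)
      + (v $ 1 * w $ 2 - v $ 2 * w $ 1) * cnj (v $ 1 * w $ 2 - v $ 2 * w $ 1) = det g"
    by (simp add: det_3 g_def algebra_simps)
  with det have r33: "(v $ 2 * w $ 3 - v $ 3 * w $ 2) * cnj (v $ 2 * w $ 3 - v $ 3 * w $ 2)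
      + (v $ 3 * w $ 1 - v $ 1 * w $ 3) * cnj (v $ 3 * w $ 1 - v $ 1 * w $ 3)
      + (v $ 1 * w $ 2 - v $ 2 * w $ 1) * cnj (v $ 1 * w $ 2 - v $ 2 * w $ 1) = 1" by simp
  have gg: "g ** hermitian_adjoint g = mat 1"
    using v1 w1 vw1 wv1 r33 by (simp add: mat_entries mat_def g_def) (simp add: algebra_simps)
  then have g: "g \<in> SU3" using det by (simp add: SU3_def)
  have col: "Ad g A *v axis k 1 = c *s axis k 1"
    if "hermitian_adjoint g *v axis k 1 = u" "A *v u = c *s u" for k u c
  proof -
    have "Ad g A *v axis k 1 = g *v (A *v (hermitian_adjoint g *v axis k 1))"
      by (simp add: Ad_def matrix_vector_mul_assoc matrix_mul_assoc)
    also have "\<dots> = c *s (g *v (hermitian_adjoint g *v axis k 1))"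
      using that by (simp add: vector_scalar_commute)
    finally show ?thesis by (simp add: matrix_vector_mul_assoc gg)
  qed
  have c1: "Ad g A *v axis 1 1 = a *s axis 1 1"
    by (rule col[OF _ v(1)]) (simp add: mat_entries axis_def g_def)
  have c2: "Ad g A *v axis 2 1 = b *s axis 2 1"
    by (rule col[OF _ w(1)]) (simp add: mat_entries axis_def g_def)
  have e: "Ad g A $ 1 $ 1 = a" "Ad g A $ 2 $ 1 = 0" "Ad g A $ 3 $ 1 = 0"
    "Ad g A $ 1 $ 2 = 0" "Ad g A $ 2 $ 2 = b" "Ad g A $ 3 $ 2 = 0"
    using c1 c2 by (simp_all add: mat_entries axis_def)
  have "hermitian_adjoint (Ad g A) = - Ad g A"
    by (simp add: hermitian_adjoint_Ad A Ad_minus)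
  then have "cnj (Ad g A $ 3 $ 1) = - Ad g A $ 1 $ 3" "cnj (Ad g A $ 3 $ 2) = - Ad g A $ 2 $ 3"
    by (metis hermitian_adjoint_nth vector_uminus_component)+
  then have e3: "Ad g A $ 1 $ 3 = 0" "Ad g A $ 2 $ 3 = 0" using e by simp_all
  have "trace (Ad g A) = a + b + Ad g A $ 3 $ 3"
    using e by (simp add: trace_def sum_3)
  then have "Ad g A $ 3 $ 3 = trace A - a - b" using trace_Ad[OF g] by simp
  then have "Ad g A = diag_mat (vector [a, b, trace A - a - b])"
    using e e3 by (simp add: mat_entries)
  then show ?thesis using g by blast
qed

lemma skew_eigenvectors_orthogonal:
  assumes A: "hermitian_adjoint A = - A"
    and v: "A *v v = a *s v" "hin v v = 1" and w: "A *v w = b *s w" and ab: "a \<noteq> b"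
  shows "hin v w = 0"
proof -
  have "b * hin v w = hin v (A *v w)" "hin (A *v v) w = cnj a * hin v w"
    unfolding v w by (simp_all add: hin_def sum_3 algebra_simps)
  then have "b * hin v w = a * hin v w"
    using hin_skew[OF A, of v w] skew_eigenvalue[OF A v] by simp
  then show ?thesis using ab by simp
qed

text \<open>The first two eigenvalues are prescribed in order; near a diagonal point this preserves
  their numbering.\<close>

lemma diagonalize_distinct:
  assumes A: "hermitian_adjoint A = - A"
    and "det (A - mat a) = 0" "det (A - mat b) = 0" "a \<noteq> b"
  shows "\<exists>g\<in>SU3. Ad g A = diag_mat (vector [a, b, trace A - a - b])"
proof -
  obtain v where v: "A *v v = a *s v" "hin v v = 1" using unit_eigenvector assms(2) by blast
  obtain w where w: "A *v w = b *s w" "hin w w = 1" using unit_eigenvector assms(3) by blast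
  show ?thesis
    using diagonalize_from_two[OF A v w] skew_eigenvectors_orthogonal[OF A v w(1) assms(4)] by blast
qed

lemma det_minus_mat:
  fixes A :: cmat3
  shows "det (A - mat x) = - (x ^ 3) + trace A * x\<^sup>2 - ((trace A)\<^sup>2 - trace (A ** A)) / 2 * x + det A"
  by (simp add: mat_entries mat_def det_3 field_simps power2_eq_square power3_eq_cube)

text \<open>A second eigenvector orthogonal to \<open>v\<close> is an eigenvector of \<open>A + t v v\<^sup>*\<close>, where \<open>t\<close> is chosen
  so that not all eigenvalues of this matrix coincide.\<close>
lemma unitary_diagonalization:
  assumes A: "hermitian_adjoint A = - A"
  shows "\<exists>g\<in>SU3. \<exists>d. Ad g A = diag_mat d"
proof -
  have root: "\<exists>x. det (M - mat x) = 0" for M :: cmat3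
  proof -
    define c where "c = (\<lambda>i::nat. if i = 0 then det M else if i = 1 then - ((trace M)\<^sup>2 - trace (M ** M)) / 2
        else if i = 2 then trace M else (-1 :: complex))"
    obtain x where "(\<Sum>i\<le>3. c i * x ^ i) = 0"
    proof (rule fundamental_theorem_of_algebra[of c 3])
      have "c 3 \<noteq> 0" by (simp add: c_def)
      then show "c 0 = 0 \<or> (\<exists>i\<in>{1..3}. c i \<noteq> 0)" by force
    qed
    then show ?thesis
      unfolding det_minus_mat by (intro exI[of _ x]) (simp add: c_def eval_nat_numeral algebra_simps diff_divide_distrib)
  qed
  obtain l where "det (A - mat l) = 0" using root by blast
  then obtain v where v: "A *v v = l *s v" "hin v v = 1" using unit_eigenvector by blast
  \<comment> \<open>Then \<open>trace B - 3 * (l + t) = - 2\<close>, so \<open>l + t\<close> is not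
    a triple eigenvalue of \<open>B\<close>.\<close>
  define t where "t = (trace A - 3 * l) / 2 + 1"
  define B :: cmat3 where "B = A + (\<chi> i j. t * v $ i * cnj (v $ j))"
  have Bw: "B *v w = A *v w + (t * hin v w) *s v" for w
    by (simp add: B_def mat_entries hin_def algebra_simps)
  have "trace B = trace A + t * hin v v"
    by (simp add: B_def mat_entries hin_def algebra_simps)
  then have trB: "trace B \<noteq> 3 * (l + t)" using v by (simp add: t_def field_simps)
  have "B *v v = (l + t) *s v" using v by (simp add: Bw vec_eq_iff algebra_simps)
  then have "(B - mat (l + t)) *v v = 0" by (simp add: mat_entries mat_def algebra_simps)
  moreover have "v \<noteq> 0" using v(2) by (auto simp: hin_def)
  ultimately have "det (B - mat (l + t)) = 0"
    by (metis invertible_det_nz invertible_left_inverse matrix_left_invertible_ker)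
  define r where "r = l + t"
  define q where "q = ((trace B)\<^sup>2 - trace (B ** B)) / 2"
  have r: "- (r ^ 3) + trace B * r\<^sup>2 - q * r + det B = 0"
    using \<open>det (B - mat (l + t)) = 0\<close> unfolding det_minus_mat q_def r_def by simp
  \<comment> \<open>Coefficients of the quadratic left, up to sign, after dividing the
    characteristic polynomial of \<open>B\<close> by its root factor for \<open>r\<close>.\<close>
  define c where "c = (\<lambda>i::nat. if i = 0 then q + r * (r - trace B) else if i = 1 then r - trace B else (1 :: complex))"
  obtain x where "(\<Sum>i\<le>2. c i * x ^ i) = 0"
  proof (rule fundamental_theorem_of_algebra[of c 2])
    have "c 2 \<noteq> 0" by (simp add: c_def)
    then show "c 0 = 0 \<or> (\<exists>i\<in>{1..2}. c i \<noteq> 0)" by force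
  qed
  then have x: "x\<^sup>2 + (r - trace B) * x + (q + r * (r - trace B)) = 0"
    by (simp add: c_def eval_nat_numeral algebra_simps)
  \<comment> \<open>The roots of the quadratic add up to \<open>trace B - r\<close>; if the root
    found is \<open>r\<close>, the other one is taken.\<close>
  define y where "y = (if x = r then trace B - 2 * r else x)"
  have "y\<^sup>2 + (r - trace B) * y + (q + r * (r - trace B)) = 0"
    using x by (auto simp: y_def power2_eq_square algebra_simps)
  then have "- (y ^ 3) + trace B * y\<^sup>2 - q * y + det B = 0" using r by algebra
  then have "det (B - mat y) = 0" unfolding det_minus_mat q_def by simp
  then obtain w where w: "B *v w = y *s w" "hin w w = 1" using unit_eigenvector by blast
  have "y \<noteq> r" using trB by (auto simp: y_def r_def algebra_simps)
  have "hin v (B *v w) = hin v (A *v w) + t * hin v w * hin v v"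
    unfolding Bw by (simp add: hin_def sum_3 algebra_simps)
  also have "\<dots> = r * hin v w"
  proof -
    have "hin (l *s v) w = cnj l * hin v w" by (simp add: hin_def sum_3 algebra_simps)
    then show ?thesis
      using hin_skew[OF A, of v w] skew_eigenvalue[OF A v] v by (simp add: r_def algebra_simps)
  qed
  finally have "y * hin v w = r * hin v w"
    unfolding w by (simp add: hin_def sum_3 algebra_simps)
  then have 0: "hin v w = 0" using \<open>y \<noteq> r\<close> by simp
  then have "A *v w = y *s w" using w(1) by (simp add: Bw)
  then show ?thesis using diagonalize_from_two[OF A v _ w(2) 0] by blast
qed

section \<open>The symplectic form on tangent vectors\<close>

lemma zero_levelD:
  assumes "(X, Y, Z) \<in> zero_level lam mu nu"
  shows "X = - (Y + Z)" "hermitian_adjoint X = - X" "hermitian_adjoint Y = - Y" "hermitian_adjoint Z = - Z"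
proof -
  have "X + (Y + Z) = 0" using assms by (simp add: zero_level_def moment_map_def add.assoc)
  then show "X = - (Y + Z)" by (rule eq_neg_iff_add_eq_0[THEN iffD2])
qed (use assms orbit_skew in \<open>auto simp: zero_level_def\<close>)

text \<open>Well-definedness of the form: cyclic shifts let the generators be exchanged one at a
  time, because each value depends on the other generator only through its commutator with
  \<open>X\<close>.\<close>

lemma kks_form_commutator:
  assumes "A \<in> su3" "B \<in> su3"
  shows "kks_form X (commutator A X) (commutator B X) = Re (trace (X ** commutator A B))"
  unfolding kks_form_def
proof (rule the_equality)
  show "\<exists>A'\<in>su3. \<exists>B'\<in>su3. commutator A X = commutator A' X \<and> commutator B X = commutator B' X \<and>
      Re (trace (X ** commutator A B)) = Re (trace (X ** commutator A' B'))"
    using assms by blast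
next
  fix r
  assume "\<exists>A'\<in>su3. \<exists>B'\<in>su3. commutator A X = commutator A' X \<and> commutator B X = commutator B' X \<and>
      r = Re (trace (X ** commutator A' B'))"
  then obtain A' B' where *: "commutator A X = commutator A' X" "commutator B X = commutator B' X"
    "r = Re (trace (X ** commutator A' B'))" by blast
  have "trace (X ** commutator A' B') = trace (A' ** commutator B X)"
    unfolding *(2) by (rule trace_commutator_shift)
  also have "\<dots> = - trace (B ** commutator A X)"
    unfolding *(1) by (rule trace_mult_commutator)
  also have "\<dots> = trace (X ** commutator A B)"
    using trace_commutator_shift[of X A B] trace_mult_commutator[of A B X] by simp
  finally show "r = Re (trace (X ** commutator A B))" using *(3) by simp
qed

text \<open>The trace of a product of two skew-Hermitian matrices is real, so \<open>Re\<close>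
  loses nothing and the real form can be compared with the bilinear \<open>omega\<close>.\<close>

lemma trace_skew_commutator_real:
  assumes "hermitian_adjoint X = - X" "A \<in> su3" "B \<in> su3"
  shows "complex_of_real (Re (trace (X ** commutator A B))) = trace (A ** commutator B X)"
proof -
  have "hermitian_adjoint (commutator A B) = - commutator A B"
    using assms(2,3)
    by (simp add: su3_def commutator_def hermitian_adjoint_diff hermitian_adjoint_mult)
      (simp add: mat_entries)
  then have "cnj (trace (X ** commutator A B)) = trace ((- commutator A B) ** (- X))"
    by (simp add: trace_hermitian_adjoint[symmetric] hermitian_adjoint_mult assms(1))
  also have "\<dots> = trace (X ** commutator A B)"
    by (simp add: mat_entries algebra_simps)
  finally show ?thesis unfolding trace_commutator_shift[symmetric]
    by (simp add: complex_eq_iff)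
qed

lemma product_form_commutators:
  assumes "(X, Y, Z) \<in> zero_level lam mu nu" "{A, B, C, A', B', C'} \<subseteq> su3"
  shows "complex_of_real (product_form (X, Y, Z) (commutator A X, commutator B Y, commutator C Z)
      (commutator A' X, commutator B' Y, commutator C' Z))
    = trace (A ** commutator A' X) + trace (B ** commutator B' Y) + trace (C ** commutator C' Z)"
  using assms zero_levelD(2-4)[OF assms(1)]
  by (simp add: product_form_def kks_form_commutator trace_skew_commutator_real)

lemma level_tangentE:
  assumes "u \<in> level_tangent (X, Y, Z)"
  obtains A B C where "u = (commutator A X, commutator B Y, commutator C Z)" "A \<in> su3" "B \<in> su3" "C \<in> su3"
    "commutator A X + commutator B Y + commutator C Z = 0"
  using assms unfolding level_tangent_def by auto

lemma level_tangent_imp_tangent: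
  assumes X: "X = - (Y + Z)" and sum: "commutator A X + commutator B Y + commutator C Z = 0"
  shows "tangent (Y - Z) (Y + Z) A B C (commutator B Y - commutator C Z) (commutator B Y + commutator C Z)"
proof -
  have "commutator A (Y + Z) = - commutator A X"
    unfolding X by (simp add: mat_entries algebra_simps)
  moreover have "- commutator A X = commutator B Y + commutator C Z"
    using sum by (metis add.assoc minus_unique)
  moreover have "commutator B (Y + Z + (Y - Z)) = commutator B Y + commutator C Z + (commutator B Y - commutator C Z)"
    "commutator C (Y + Z - (Y - Z)) = commutator B Y + commutator C Z - (commutator B Y - commutator C Z)"
    by (simp_all add: mat_entries algebra_simps)
  ultimately show ?thesis unfolding tangent_def by simp
qed

lemma product_form_eq_omega:
  assumes Z: "(X, Y, Z) \<in> zero_level lam mu nu" and su3: "{A, B, C, A', B', C'} \<subseteq> su3"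
    and sum: "commutator A' X + commutator B' Y + commutator C' Z = 0"
  shows "complex_of_real (product_form (X, Y, Z) (commutator A X, commutator B Y, commutator C Z)
      (commutator A' X, commutator B' Y, commutator C' Z))
    = omega A B C (commutator B' Y - commutator C' Z) (commutator B' Y + commutator C' Z)"
proof -
  have "- commutator A' X = commutator B' Y + commutator C' Z"
    using sum by (metis add.assoc minus_unique)
  then have X: "commutator B' Y + commutator C' Z = scale_mat (- 1) (commutator A' X)"
    by (simp add: vec_eq_iff)
  \<comment> \<open>The variations of \<open>2 Y\<close> and \<open>2 Z\<close>; these factors
    cancel the division by two in \<open>omega\<close>.\<close>
  have YZ: "commutator B' Y + commutator C' Z + (commutator B' Y - commutator C' Z) = scale_mat 2 (commutator B' Y)"
    "commutator B' Y + commutator C' Z - (commutator B' Y - commutator C' Z) = scale_mat 2 (commutator C' Z)"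
    by (simp_all add: vec_eq_iff)
  show ?thesis unfolding product_form_commutators[OF Z su3] omega_def YZ
    unfolding X by (simp add: trace_mult_scale)
qed

text \<open>\<open>rigidity\<close> yields a complex generator \<open>G\<close>. With
  \<open>x\<close> and \<open>X\<close> skew, the negative adjoint of \<open>G\<close> generates
  \<open>x\<close> as well, hence so does the average of the two.\<close>

lemma skew_part_commutator:
  assumes "hermitian_adjoint X = - X" "hermitian_adjoint x = - x" "x = commutator G X"
  shows "x = commutator (scale_mat (1/2) (G - hermitian_adjoint G)) X"
proof -
  have "- x = hermitian_adjoint (commutator G X)" using assms by simp
  also have "\<dots> = commutator (hermitian_adjoint G) X"
    by (simp add: commutator_def hermitian_adjoint_diff hermitian_adjoint_mult assms(1))
      (simp add: mat_entries algebra_simps)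
  finally have "commutator (hermitian_adjoint G) X = - x" by simp
  then show ?thesis
    by (simp add: commutator_scale_left commutator_diff_left assms(3)[symmetric]) (simp add: vec_eq_iff)
qed

text \<open>The skew part of \<open>G\<close> may have a trace; subtracting a scalar matrix moves it
  into \<open>su3\<close> without affecting commutators.\<close>

lemma vertical_spaceI:
  assumes skew: "hermitian_adjoint X = - X" "hermitian_adjoint Y = - Y" "hermitian_adjoint Z = - Z"
    "hermitian_adjoint x = - x" "hermitian_adjoint y = - y" "hermitian_adjoint z = - z"
    and G: "x = commutator G X" "y = commutator G Y" "z = commutator G Z"
  shows "(x, y, z) \<in> vertical_space (X, Y, Z)"
proof -
  define N where "N = scale_mat (1/2) (G - hermitian_adjoint G)"
  define A where "A = N - mat (trace N / 3)"
  have N: "hermitian_adjoint N = - N" by (simp add: N_def mat_entries algebra_simps)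
  have "cnj (trace N) = - trace N"
    unfolding trace_hermitian_adjoint[symmetric] N by (simp add: mat_entries)
  then have "A \<in> su3"
  proof -
    have "hermitian_adjoint (mat c) = mat (cnj c)" "trace (mat c :: cmat3) = 3 * c" for c
      by (simp_all add: mat_entries mat_def)
    with \<open>cnj (trace N) = - trace N\<close> show ?thesis
      using N by (simp add: A_def su3_def hermitian_adjoint_diff trace_sub) (simp add: mat_entries mat_def)
  qed
  moreover have A: "commutator A M = commutator N M" for M
    by (simp add: A_def mat_entries mat_def algebra_simps)
  ultimately show ?thesis
    unfolding vertical_space_def
    using skew_part_commutator[OF skew(1,4) G(1)] skew_part_commutator[OF skew(2,5) G(2)]
      skew_part_commutator[OF skew(3,6) G(3)] by (auto simp: N_def[symmetric] A intro!: exI[of _ A])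
qed

section \<open>Equivariance\<close>

lemma bounded_linear_diagonal_action: "bounded_linear (diagonal_action g)"
proof -
  have "Ad g (r *\<^sub>R A) = r *\<^sub>R Ad g A" for r A
    by (simp add: Ad_def matrix_scalar_ac scalar_matrix_assoc)
  then have "linear (diagonal_action g)"
    by (intro linearI) (auto simp: diagonal_action_def Ad_add)
  then show ?thesis by (simp add: linear_conv_bounded_linear)
qed

lemma level_tangent_diagonal_action:
  assumes g: "g \<in> SU3" and u: "u \<in> level_tangent p"
  shows "diagonal_action g u \<in> level_tangent (diagonal_action g p)"
proof -
  obtain X Y Z where p: "p = (X, Y, Z)" using prod_cases3 by blast
  obtain A B C where ue: "u = (commutator A X, commutator B Y, commutator C Z)"
    and ABC: "A \<in> su3" "B \<in> su3" "C \<in> su3"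
    and s: "commutator A X + commutator B Y + commutator C Z = 0"
    using level_tangentE u unfolding p by metis
  have "commutator (Ad g A) (Ad g X) + commutator (Ad g B) (Ad g Y) + commutator (Ad g C) (Ad g Z) = 0"
    using arg_cong[OF s, of "Ad g"] by (simp add: Ad_add Ad_commutator[OF g])
  with Ad_su3[OF g] ABC show ?thesis
    unfolding p ue level_tangent_def diagonal_action_simp prod.case Ad_commutator[OF g]
    by (intro CollectI exI conjI) (rule refl | blast)+
qed

lemma vertical_space_diagonal_action:
  assumes g: "g \<in> SU3" and u: "u \<in> vertical_space p"
  shows "diagonal_action g u \<in> vertical_space (diagonal_action g p)"
proof -
  obtain X Y Z where p: "p = (X, Y, Z)" using prod_cases3 by blast
  from u obtain A where "u = (commutator A X, commutator A Y, commutator A Z)" "A \<in> su3"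
    unfolding p vertical_space_def by auto
  with Ad_su3[OF g] show ?thesis
    unfolding p vertical_space_def diagonal_action_def
    by (simp add: Ad_commutator[OF g]) blast
qed

lemma product_form_diagonal_action:
  assumes g: "g \<in> SU3" and p: "p \<in> zero_level lam mu nu" and u: "u \<in> level_tangent p" and v: "v \<in> level_tangent p"
  shows "product_form (diagonal_action g p) (diagonal_action g u) (diagonal_action g v) = product_form p u v"
proof -
  obtain X Y Z where pe: "p = (X, Y, Z)" using prod_cases3 by blast
  obtain A B C where ue: "u = (commutator A X, commutator B Y, commutator C Z)" and su: "A \<in> su3" "B \<in> su3" "C \<in> su3"
    using level_tangentE u unfolding pe by metis
  obtain A' B' C' where ve: "v = (commutator A' X, commutator B' Y, commutator C' Z)"
    and sv: "A' \<in> su3" "B' \<in> su3" "C' \<in> su3"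
    using level_tangentE v unfolding pe by metis
  have z: "(Ad g X, Ad g Y, Ad g Z) \<in> zero_level lam mu nu"
    using zero_level_diagonal_action[OF g p] by (simp add: pe diagonal_action_def)
  have t: "trace (Ad g M ** Ad g N) = trace (M ** N)" for M N
    by (simp add: Ad_mult[OF g, symmetric] trace_Ad[OF g])
  have "complex_of_real (product_form (diagonal_action g p) (diagonal_action g u) (diagonal_action g v))
      = complex_of_real (product_form p u v)"
    using product_form_commutators[OF z, of "Ad g A" "Ad g B" "Ad g C" "Ad g A'" "Ad g B'" "Ad g C'"]
      product_form_commutators[OF p[unfolded pe], of A B C A' B' C'] su sv
    by (simp add: pe ue ve diagonal_action_def Ad_commutator[OF g] Ad_su3[OF g])
      (simp add: Ad_commutator[OF g, symmetric] t)
  then show ?thesis using of_real_eq_iff by blast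
qed

text \<open>The pointwise clause of \<open>darboux_coordinates_on\<close>, isolated so that it can
  be moved along a conjugacy class.\<close>

definition darboux_at where
  "darboux_at lam mu nu f h p \<longleftrightarrow>
       (\<exists>W F H. open W \<and> p \<in> W \<and> smooth_on W F \<and> smooth_on W H \<and>
          (\<forall>q\<in>W \<inter> zero_level lam mu nu. F q = f (conj_class q) \<and> H q = h (conj_class q)) \<and>
          (\<forall>u\<in>level_tangent p. \<forall>v\<in>level_tangent p.
             complex_of_real (product_form p u v) =
               frechet_derivative F (at p) u * frechet_derivative H (at p) v
             - frechet_derivative F (at p) v * frechet_derivative H (at p) u) \<and>
          (\<forall>u\<in>level_tangent p.
             frechet_derivative F (at p) u = 0 \<and> frechet_derivative H (at p) u = 0
               \<longrightarrow> u \<in> vertical_space p))"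

text \<open>The witnesses at \<open>p\<close> are those at the conjugate point composed with the
  linear map \<open>diagonal_action g\<close>. This reduces everything to points with
  \<open>Y - Z\<close> diagonal.\<close>

lemma darboux_at_diagonal_action:
  fixes f h :: "triple set \<Rightarrow> complex"
  assumes g: "g \<in> SU3" and p: "p \<in> zero_level lam mu nu"
    and "darboux_at lam mu nu f h (diagonal_action g p)"
  shows "darboux_at lam mu nu f h p"
proof -
  let ?g = "diagonal_action g"
  obtain W F H where W: "open W" "?g p \<in> W" and sm: "smooth_on W F" "smooth_on W H"
    and val: "\<And>q. q \<in> W \<Longrightarrow> q \<in> zero_level lam mu nu \<Longrightarrow> F q = f (conj_class q) \<and> H q = h (conj_class q)"
    and form: "\<And>u v. u \<in> level_tangent (?g p) \<Longrightarrow> v \<in> level_tangent (?g p) \<Longrightarrow>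
             complex_of_real (product_form (?g p) u v) =
               frechet_derivative F (at (?g p)) u * frechet_derivative H (at (?g p)) v
             - frechet_derivative F (at (?g p)) v * frechet_derivative H (at (?g p)) u"
    and vert: "\<And>u. u \<in> level_tangent (?g p) \<Longrightarrow> frechet_derivative F (at (?g p)) u = 0 \<Longrightarrow>
             frechet_derivative H (at (?g p)) u = 0 \<Longrightarrow> u \<in> vertical_space (?g p)"
    using assms(3) unfolding darboux_at_def by blast
  have lin: "bounded_linear ?g" by (rule bounded_linear_diagonal_action)
  have fd: "frechet_derivative (\<lambda>q. K (?g q)) (at p) u = frechet_derivative K (at (?g p)) (?g u)"
    if "smooth_on W K" for K :: "triple \<Rightarrow> complex" and u
    using frechet_derivative_at[OF has_derivative_compose[OF bounded_linear_imp_has_derivative[OF lin]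
          smooth_on_has_derivative[OF that W(2)]]] by metis
  have "open (?g -` W)"
    using W(1) lin by (simp add: continuous_open_vimage linear_continuous_at)
  moreover have "smooth_on (?g -` W) (\<lambda>q. F (?g q))" "smooth_on (?g -` W) (\<lambda>q. H (?g q))"
    using smooth_on_comp_linear[OF W(1) lin] sm by auto
  moreover have "F (?g q) = f (conj_class q) \<and> H (?g q) = h (conj_class q)"
    if "q \<in> ?g -` W \<inter> zero_level lam mu nu" for q
    using that val[of "?g q"] zero_level_diagonal_action[OF g] conj_class_diagonal_action[OF g] by auto
  moreover have "u \<in> vertical_space p" if "?g u \<in> vertical_space (?g p)" for u
    using vertical_space_diagonal_action[OF SU3_hermitian_adjoint[OF g] that] g by simp
  ultimately show ?thesis
    unfolding darboux_at_def
    using W(2) form vert level_tangent_diagonal_action[OF g]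
    by (intro exI[of _ "?g -` W"] exI[of _ "\<lambda>q. F (?g q)"] exI[of _ "\<lambda>q. H (?g q)"] conjI ballI)
      (simp_all add: fd[OF sm(1)] fd[OF sm(2)] product_form_diagonal_action[OF g p, symmetric])
qed

section \<open>The solution in terms of an eigenvector of \<open>Y - Z\<close>\<close>

definition det3 :: "complex^3 \<Rightarrow> complex^3 \<Rightarrow> complex^3 \<Rightarrow> complex" where
  "det3 a b c = a $ 1 * (b $ 2 * c $ 3 - b $ 3 * c $ 2) + a $ 2 * (b $ 3 * c $ 1 - b $ 1 * c $ 3)
     + a $ 3 * (b $ 1 * c $ 2 - b $ 2 * c $ 1)"

text \<open>The pairing of the row \<open>e \<times> S e\<close> with \<open>D S e\<close>, nonzero
  exactly when \<open>e\<close>, \<open>S e\<close>, \<open>D S e\<close> form a basis; the common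
  denominator of \<open>z\<close> and \<open>\<eta>\<close>.\<close>

definition zden where "zden D S e = det3 e (S *v e) (D *v (S *v e))"

text \<open>The row \<open>e \<times> S e\<close> annihilates \<open>e\<close> and \<open>S e\<close>; these are the \<open>z\<close> and \<open>\<eta>\<close> for which it is a left
  eigenvector of \<open>z D + S\<close> with eigenvalue \<open>\<eta>\<close>, when \<open>e\<close> is an eigenvector of \<open>D\<close>.\<close>
definition zfun where "zfun D S e = - det3 e (S *v e) (S *v (S *v e)) / zden D S e"
definition etafun where
  "etafun D S e = (zfun D S e * det3 e (S *v e) (D *v (D *v (S *v e)))
     + det3 e (S *v e) (S *v (D *v (S *v e)))) / zden D S e"

lemma det3_mult: "det3 (g *v a) (g *v b) (g *v c) = det g * det3 a b c"
  by (simp add: det3_def det_3 matrix_vector_mult_def sum_3 algebra_simps)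

lemma Ad_mult_vector:
  assumes "g \<in> SU3"
  shows "Ad g A *v (g *v x) = g *v (A *v x)"
proof -
  have "Ad g A *v (g *v x) = (g ** A ** (hermitian_adjoint g ** g)) *v x"
    by (simp add: Ad_def matrix_vector_mul_assoc matrix_mul_assoc)
  then show ?thesis by (simp add: SU3_inverse[OF assms] matrix_vector_mul_assoc)
qed

lemma fun_Ad:
  assumes "g \<in> SU3"
  shows "zden (Ad g D) (Ad g S) (g *v e) = zden D S e"
    "zfun (Ad g D) (Ad g S) (g *v e) = zfun D S e"
    "etafun (Ad g D) (Ad g S) (g *v e) = etafun D S e"
  using assms by (simp_all add: zden_def zfun_def etafun_def Ad_mult_vector det3_mult SU3_def)

text \<open>The determinants involved are homogeneous of degree three in \<open>e\<close>, so
  \<open>z\<close> and \<open>\<eta>\<close> depend on the eigenline only.\<close>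

lemma fun_scale:
  assumes "c \<noteq> 0"
  shows "zden D S (c *s e) = c ^ 3 * zden D S e" "zfun D S (c *s e) = zfun D S e"
    "etafun D S (c *s e) = etafun D S e"
proof -
  have d: "det3 (c *s a) (c *s b) (c *s x) = c ^ 3 * det3 a b x" for a b x
    by (simp add: det3_def algebra_simps power3_eq_cube)
  show "zden D S (c *s e) = c ^ 3 * zden D S e" "zfun D S (c *s e) = zfun D S e"
    using assms by (simp_all add: zden_def zfun_def vector_scalar_commute d)
  then show "etafun D S (c *s e) = etafun D S e"
  proof -
    have "zfun D S e * (c ^ 3 * a) + c ^ 3 * b = c ^ 3 * (zfun D S e * a + b)" for a b
      by (simp add: algebra_simps)
    then show ?thesis
      using assms \<open>zden D S (c *s e) = c ^ 3 * zden D S e\<close> \<open>zfun D S (c *s e) = zfun D S e\<close>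
      by (simp add: etafun_def vector_scalar_commute d)
  qed
qed

lemma zden_diagonal:
  "zden (diag_mat \<alpha>) S (axis 1 1) = S $ 2 $ 1 * S $ 3 $ 1 * (\<alpha> $ 3 - \<alpha> $ 2)"
  by (simp add: zden_def det3_def mat_entries axis_def algebra_simps)

lemma linear_system_diagonal:
  assumes "\<alpha> $ 2 \<noteq> \<alpha> $ 3" "S $ 2 $ 1 \<noteq> 0" "S $ 3 $ 1 \<noteq> 0"
  shows "S $ 2 $ 1 * (\<alpha> $ 3 * z - \<eta> + S $ 3 $ 3) = S $ 3 $ 1 * S $ 2 $ 3 \<and>
      S $ 3 $ 1 * (\<alpha> $ 2 * z - \<eta> + S $ 2 $ 2) = S $ 2 $ 1 * S $ 3 $ 2 \<longleftrightarrow>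
    z = zfun (diag_mat \<alpha>) S (axis 1 1) \<and> \<eta> = etafun (diag_mat \<alpha>) S (axis 1 1)"
    (is "?E z \<eta> \<longleftrightarrow> z = ?z \<and> \<eta> = ?\<eta>")
proof -
  let ?s = "\<lambda>i j. S $ i $ j" and ?M = "zden (diag_mat \<alpha>) S (axis 1 1)"
  have M: "?M = ?s 2 1 * ?s 3 1 * (\<alpha> $ 3 - \<alpha> $ 2)" by (rule zden_diagonal)
  then have nz: "?M \<noteq> 0" using assms by simp
  have z: "?z * (?s 2 1 * ?s 3 1 * (\<alpha> $ 3 - \<alpha> $ 2))
      = (?s 3 1)\<^sup>2 * ?s 2 3 - (?s 2 1)\<^sup>2 * ?s 3 2 + ?s 2 1 * ?s 3 1 * (?s 2 2 - ?s 3 3)"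
  proof -
    have "?z * ?M = - det3 (axis 1 1) (S *v axis 1 1) (S *v (S *v axis 1 1))"
      using nz by (simp add: zfun_def)
    then show ?thesis unfolding M
      by (simp add: det3_def mat_entries axis_def algebra_simps power2_eq_square)
  qed
  have e: "?\<eta> * (?s 2 1 * ?s 3 1 * (\<alpha> $ 3 - \<alpha> $ 2))
      = ?z * (?s 2 1 * ?s 3 1 * ((\<alpha> $ 3)\<^sup>2 - (\<alpha> $ 2)\<^sup>2))
      + ?s 2 1 * (?s 3 2 * \<alpha> $ 2 * ?s 2 1 + ?s 3 3 * \<alpha> $ 3 * ?s 3 1)
      - ?s 3 1 * (?s 2 2 * \<alpha> $ 2 * ?s 2 1 + ?s 2 3 * \<alpha> $ 3 * ?s 3 1)"
  proof -
    have "?\<eta> * ?M = ?z * det3 (axis 1 1) (S *v axis 1 1) (diag_mat \<alpha> *v (diag_mat \<alpha> *v (S *v axis 1 1)))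
       + det3 (axis 1 1) (S *v axis 1 1) (S *v (diag_mat \<alpha> *v (S *v axis 1 1)))"
      using nz by (simp add: etafun_def)
    then have "?\<eta> * ?M = ?z * (?s 2 1 * ?s 3 1 * ((\<alpha> $ 3)\<^sup>2 - (\<alpha> $ 2)\<^sup>2))
      + (?s 2 1 * (?s 3 1 * \<alpha> $ 1 * ?s 1 1 + ?s 3 2 * \<alpha> $ 2 * ?s 2 1 + ?s 3 3 * \<alpha> $ 3 * ?s 3 1)
      - ?s 3 1 * (?s 2 1 * \<alpha> $ 1 * ?s 1 1 + ?s 2 2 * \<alpha> $ 2 * ?s 2 1 + ?s 2 3 * \<alpha> $ 3 * ?s 3 1))"
      by (simp add: det3_def mat_entries axis_def algebra_simps power2_eq_square)
    then show ?thesis unfolding M by (simp add: algebra_simps)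
  qed
  have d: "\<alpha> $ 3 - \<alpha> $ 2 \<noteq> 0" using assms by simp
  have "?s 2 1 * ?s 3 1 * (\<alpha> $ 3 - \<alpha> $ 2) * (?s 2 1 * (\<alpha> $ 3 * ?z - ?\<eta> + ?s 3 3) - ?s 3 1 * ?s 2 3) = 0"
    "?s 2 1 * ?s 3 1 * (\<alpha> $ 3 - \<alpha> $ 2) * (?s 3 1 * (\<alpha> $ 2 * ?z - ?\<eta> + ?s 2 2) - ?s 2 1 * ?s 3 2) = 0"
    using z e by algebra+
  then have sol: "?E ?z ?\<eta>" using assms d by simp
  have "z = ?z \<and> \<eta> = ?\<eta>" if "?E z \<eta>"
  proof -
    have "?s 2 1 * ?s 3 1 * (\<alpha> $ 3 - \<alpha> $ 2) * (z - ?z) = 0"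
      using that sol by algebra
    then have "z = ?z" using assms d by simp
    moreover have "?s 2 1 * (\<eta> - ?\<eta>) = 0" using that sol \<open>z = ?z\<close> by algebra
    ultimately show ?thesis using assms by simp
  qed
  with sol show ?thesis by blast
qed

lemma L_mat_diagonal:
  assumes "diagonal_representative p \<alpha>"
  shows "L_mat p z = mat z ** diag_mat \<alpha> + s_mat p"
  using assms by (cases p) (simp add: diagonal_representative_def L_mat_def s_mat_def)

lemma L_tilde_diagonal:
  assumes "diagonal_representative p \<alpha>"
  shows "L_tilde p z \<eta> $ 2 $ 1 = - s_mat p $ 2 $ 1 * (\<alpha> $ 3 * z - \<eta> + s_mat p $ 3 $ 3)
      + s_mat p $ 3 $ 1 * s_mat p $ 2 $ 3"
    "L_tilde p z \<eta> $ 3 $ 1 = - s_mat p $ 3 $ 1 * (\<alpha> $ 2 * z - \<eta> + s_mat p $ 2 $ 2)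
      + s_mat p $ 2 $ 1 * s_mat p $ 3 $ 2"
    "L_tilde p z \<eta> $ 1 $ 1 = (\<alpha> $ 2 * z - \<eta> + s_mat p $ 2 $ 2) * (\<alpha> $ 3 * z - \<eta> + s_mat p $ 3 $ 3)
      - s_mat p $ 2 $ 3 * s_mat p $ 3 $ 2"
  unfolding L_tilde_def L_mat_diagonal[OF assms] cofactor_matrix_def
  by (simp_all add: det_3 mat_entries mat_def algebra_simps)

lemma cofactor_matrix_mult: "A ** cofactor_matrix A = mat (det A)"
  by (simp add: cofactor_matrix_def mat_entries mat_def det_3 algebra_simps)

lemma common_zero_diagonal:
  assumes "diagonal_representative p \<alpha>"
  shows "common_zero p (z, \<eta>) \<longleftrightarrow>
      s_mat p $ 2 $ 1 * (\<alpha> $ 3 * z - \<eta> + s_mat p $ 3 $ 3) = s_mat p $ 3 $ 1 * s_mat p $ 2 $ 3 \<and>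
      s_mat p $ 3 $ 1 * (\<alpha> $ 2 * z - \<eta> + s_mat p $ 2 $ 2) = s_mat p $ 2 $ 1 * s_mat p $ 3 $ 2"
  unfolding common_zero_def by (simp add: L_tilde_diagonal[OF assms]) (auto simp: algebra_simps)

lemma common_zero_iff:
  assumes "diagonal_representative p \<alpha>" "\<alpha> $ 2 \<noteq> \<alpha> $ 3" "s_mat p $ 2 $ 1 \<noteq> 0" "s_mat p $ 3 $ 1 \<noteq> 0"
  shows "common_zero p q \<longleftrightarrow>
    q = (zfun (diag_mat \<alpha>) (s_mat p) (axis 1 1), etafun (diag_mat \<alpha>) (s_mat p) (axis 1 1))"
  using common_zero_diagonal[OF assms(1)] linear_system_diagonal[OF assms(2-4)]
  by (cases q) simp

text \<open>The product of the two equations, divided by the nonzero entries, is the vanishing of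
  the lower right minor.\<close>

lemma common_zero_L_tilde_11:
  assumes "diagonal_representative p \<alpha>" "s_mat p $ 2 $ 1 \<noteq> 0" "s_mat p $ 3 $ 1 \<noteq> 0" "common_zero p (z, \<eta>)"
  shows "L_tilde p z \<eta> $ 1 $ 1 = 0"
proof -
  have "s_mat p $ 2 $ 1 * s_mat p $ 3 $ 1 * L_tilde p z \<eta> $ 1 $ 1 = 0"
    using assms(4) unfolding common_zero_diagonal[OF assms(1)] L_tilde_diagonal[OF assms(1)] by algebra
  then show ?thesis using assms(2,3) by simp
qed

section \<open>Invariants of the zero level\<close>

text \<open>Polarization. Of the cubic traces odd in \<open>D\<close> only one combination is
  expressed by the orbit invariants; this leaves the free coefficient of the spectral curve.\<close>

lemma traces_sum_diff:
  fixes Y Z :: cmat3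
  defines "D \<equiv> Y - Z" and "S \<equiv> Y + Z"
  shows "trace (D ** D) = 2 * trace (Y ** Y) + 2 * trace (Z ** Z) - trace (S ** S)"
    "trace (D ** S) = trace (Y ** Y) - trace (Z ** Z)"
    "3 * trace (D ** D ** S) = 4 * (trace (Y ** Y ** Y) + trace (Z ** Z ** Z)) - trace (S ** S ** S)"
    "trace (D ** D ** D) + 3 * trace (D ** S ** S) = 4 * (trace (Y ** Y ** Y) - trace (Z ** Z ** Z))"
proof -
  have dist: "A ** (B + C) = A ** B + A ** C" "(B + C) ** A = B ** A + C ** A"
    "A ** (B - C) = A ** B - A ** C" "(B - C) ** A = B ** A - C ** A" for A B C :: cmat3
    by (simp_all add: mat_entries algebra_simps)
  have cyc: "trace (A ** B ** C) = trace (B ** C ** A)" for A B C :: cmat3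
    using trace_mul_sym[of A "B ** C"] by (simp add: matrix_mul_assoc)
  note e = dist trace_add trace_sub
  show "trace (D ** D) = 2 * trace (Y ** Y) + 2 * trace (Z ** Z) - trace (S ** S)"
    "trace (D ** S) = trace (Y ** Y) - trace (Z ** Z)"
    unfolding D_def S_def e using trace_mul_sym[of Y Z] by simp_all
  note c = cyc[of Y Y Z] cyc[of Y Z Y] cyc[of Z Z Y] cyc[of Z Y Z]
  show "3 * trace (D ** D ** S) = 4 * (trace (Y ** Y ** Y) + trace (Z ** Z ** Z)) - trace (S ** S ** S)"
    unfolding D_def S_def e using c by simp
  show "trace (D ** D ** D) + 3 * trace (D ** S ** S) = 4 * (trace (Y ** Y ** Y) - trace (Z ** Z ** Z))"
    unfolding D_def S_def e using c by simp
qed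

lemma zero_level_traces:
  assumes p: "(X, Y, Z) \<in> zero_level lam mu nu" and p': "(X', Y', Z') \<in> zero_level lam mu nu"
  defines "D \<equiv> Y - Z" and "S \<equiv> Y + Z" and "D' \<equiv> Y' - Z'" and "S' \<equiv> Y' + Z'"
  shows "trace S = trace S'" "trace (D ** D) = trace (D' ** D')" "trace (D ** S) = trace (D' ** S')"
    "trace (S ** S) = trace (S' ** S')" "trace (D ** D ** S) = trace (D' ** D' ** S')"
    "trace (S ** S ** S) = trace (S' ** S' ** S')"
    "trace (D ** D ** D) + 3 * trace (D ** S ** S) = trace (D' ** D' ** D') + 3 * trace (D' ** S' ** S')"
proof -
  have o: "X \<in> orbit lam" "Y \<in> orbit mu" "Z \<in> orbit nu" "X' \<in> orbit lam" "Y' \<in> orbit mu" "Z' \<in> orbit nu"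
    using p p' by (auto simp: zero_level_def)
  have X: "X = - S" "X' = - S'" using zero_levelD(1)[OF p] zero_levelD(1)[OF p'] by (simp_all add: S_def S'_def)
  have "trace (- A) = - trace A" "(- A) ** B = - (A ** B)" "A ** (- B) = - (A ** B)" for A B :: cmat3
    by (simp_all add: mat_entries algebra_simps)
  note m = this
  have x: "trace X = trace X'" "trace (X ** X) = trace (X' ** X')" "trace (X ** X ** X) = trace (X' ** X' ** X')"
    and y: "trace (Y ** Y) = trace (Y' ** Y')" "trace (Y ** Y ** Y) = trace (Y' ** Y' ** Y')"
    and z: "trace (Z ** Z) = trace (Z' ** Z')" "trace (Z ** Z ** Z) = trace (Z' ** Z' ** Z')"
    using orbit_traces[OF o(1)] orbit_traces[OF o(2)] orbit_traces[OF o(3)]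
      orbit_traces[OF o(4)] orbit_traces[OF o(5)] orbit_traces[OF o(6)] by simp_all
  show s: "trace S = trace S'" and s2: "trace (S ** S) = trace (S' ** S')"
    and s3: "trace (S ** S ** S) = trace (S' ** S' ** S')"
    using x unfolding X by (simp_all add: m)
  note t = traces_sum_diff[of Y Z, folded D_def S_def] traces_sum_diff[of Y' Z', folded D'_def S'_def]
  show "trace (D ** D) = trace (D' ** D')" "trace (D ** S) = trace (D' ** S')"
    "trace (D ** D ** D) + 3 * trace (D ** S ** S) = trace (D' ** D' ** D') + 3 * trace (D' ** S' ** S')"
    unfolding t using y z s2 by simp_all
  have "3 * trace (D ** D ** S) = 3 * trace (D' ** D' ** S')"
    unfolding t using y z s3 by simp
  then show "trace (D ** D ** S) = trace (D' ** D' ** S')" by simp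
qed

lemma zero_level_trace_zero:
  assumes "(\<Sum>j\<in>UNIV. mu $ j) = 0" "(\<Sum>j\<in>UNIV. nu $ j) = 0" "(X, Y, Z) \<in> zero_level lam mu nu"
  shows "trace (Y - Z) = 0" "trace (Y + Z) = 0"
proof -
  have "trace (diag_mat (\<chi> j. \<i> * complex_of_real (l $ j))) = \<i> * complex_of_real (\<Sum>j\<in>UNIV. l $ j)" for l
    by (simp add: trace_def diag_mat_def sum_distrib_left)
  then have "trace Y = 0" "trace Z = 0"
    using assms orbit_traces(1)[of Y mu] orbit_traces(1)[of Z nu]
    by (auto simp: zero_level_def simp del: of_real_sum)
  then show "trace (Y - Z) = 0" "trace (Y + Z) = 0" by (simp_all add: trace_add trace_sub)
qed

lemma det_eq_traces:
  fixes A :: cmat3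
  shows "det A = ((trace A) ^ 3 - 3 * trace A * trace (A ** A) + 2 * trace (A ** A ** A)) / 6"
  by (simp add: mat_entries det_3 field_simps power3_eq_cube)

lemma ordered_eigenvalues_distinct:
  assumes "bij \<sigma>" "ordered_eigenvalues \<sigma> \<alpha>" "i \<noteq> j"
  shows "\<alpha> $ i \<noteq> \<alpha> $ j"
proof -
  obtain i' j' where ij: "i = \<sigma> i'" "j = \<sigma> j'" using assms(1) by (metis bij_pointE)
  then have "i' \<noteq> j'" using assms(3) by auto
  then show ?thesis
    using assms(2) exhaust_3[of i'] exhaust_3[of j'] unfolding ordered_eigenvalues_def ij by auto
qed

text \<open>The power sums determine the characteristic polynomial, hence the set of eigenvalues;
  the order prescribed by \<open>\<sigma>\<close> then matches smallest with smallest and largest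
  with largest, which leaves the middle one.\<close>

lemma ordered_eigenvalues_unique:
  assumes \<sigma>: "bij \<sigma>" and o: "ordered_eigenvalues \<sigma> \<alpha>" "ordered_eigenvalues \<sigma> \<beta>"
    and tr: "trace (diag_mat \<alpha>) = trace (diag_mat \<beta>)"
      "trace (diag_mat \<alpha> ** diag_mat \<alpha>) = trace (diag_mat \<beta> ** diag_mat \<beta>)"
      "trace (diag_mat \<alpha> ** diag_mat \<alpha> ** diag_mat \<alpha>) = trace (diag_mat \<beta> ** diag_mat \<beta> ** diag_mat \<beta>)"
  shows "\<alpha> = \<beta>"
proof -
  have "det (diag_mat \<alpha> - mat x) = det (diag_mat \<beta> - mat x)" for x
    unfolding det_minus_mat det_eq_traces[of "diag_mat \<alpha>"] det_eq_traces[of "diag_mat \<beta>"] tr ..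
  moreover have "det (diag_mat a - mat x) = (a $ 1 - x) * (a $ 2 - x) * (a $ 3 - x)" for a x
    by (simp add: det_3 diag_mat_def mat_def)
  ultimately have P: "(\<alpha> $ 1 - x) * (\<alpha> $ 2 - x) * (\<alpha> $ 3 - x) = (\<beta> $ 1 - x) * (\<beta> $ 2 - x) * (\<beta> $ 3 - x)" for x
    by metis
  have a: "\<exists>k. \<alpha> $ i = \<beta> $ k" for i
  proof -
    have "(\<alpha> $ 1 - \<alpha> $ i) * (\<alpha> $ 2 - \<alpha> $ i) * (\<alpha> $ 3 - \<alpha> $ i) = 0" using exhaust_3[of i] by auto
    then show ?thesis unfolding P by (metis eq_iff_diff_eq_0 mult_eq_0_iff)
  qed
  have b: "\<exists>k. \<beta> $ i = \<alpha> $ k" for i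
  proof -
    have "(\<beta> $ 1 - \<beta> $ i) * (\<beta> $ 2 - \<beta> $ i) * (\<beta> $ 3 - \<beta> $ i) = 0" using exhaust_3[of i] by auto
    then show ?thesis unfolding P[symmetric] by (metis eq_iff_diff_eq_0 mult_eq_0_iff)
  qed
  have ran: "(\<exists>k. y = c $ k) \<longleftrightarrow> y = c $ \<sigma> 1 \<or> y = c $ \<sigma> 2 \<or> y = c $ \<sigma> 3" for c :: "complex^3" and y
  proof -
    have "\<exists>i. k = \<sigma> i" for k using \<sigma> by (metis bij_pointE)
    moreover have "\<sigma> i = \<sigma> 1 \<or> \<sigma> i = \<sigma> 2 \<or> \<sigma> i = \<sigma> 3" for i using exhaust_3[of i] by auto
    ultimately have "k = \<sigma> 1 \<or> k = \<sigma> 2 \<or> k = \<sigma> 3" for k by metis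
    then show ?thesis by metis
  qed
  have a': "\<alpha> $ \<sigma> i = \<beta> $ \<sigma> 1 \<or> \<alpha> $ \<sigma> i = \<beta> $ \<sigma> 2 \<or> \<alpha> $ \<sigma> i = \<beta> $ \<sigma> 3" for i
    using a ran by blast
  have b': "\<beta> $ \<sigma> i = \<alpha> $ \<sigma> 1 \<or> \<beta> $ \<sigma> i = \<alpha> $ \<sigma> 2 \<or> \<beta> $ \<sigma> i = \<alpha> $ \<sigma> 3" for i
    using b ran by blast
  have "\<alpha> $ \<sigma> 1 = \<beta> $ \<sigma> 1"
    using a'[of 1] b'[of 1] o unfolding ordered_eigenvalues_def by auto
  moreover have "\<alpha> $ \<sigma> 3 = \<beta> $ \<sigma> 3"
    using a'[of 3] b'[of 3] o unfolding ordered_eigenvalues_def by auto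
  moreover have "\<alpha> $ \<sigma> 2 = \<beta> $ \<sigma> 2"
    using a'[of 2] calculation o unfolding ordered_eigenvalues_def by auto
  ultimately have "\<alpha> $ \<sigma> i = \<beta> $ \<sigma> i" for i using exhaust_3[of i] by auto
  then have "\<alpha> $ j = \<beta> $ j" for j using \<sigma> by (metis bij_pointE)
  then show ?thesis by (simp add: vec_eq_iff)
qed

section \<open>Independence of the representative\<close>

lemma eq_if_diff_add_eq:
  fixes x y :: "'a::real_vector"
  assumes "x - y = x' - y'" "x + y = x' + y'"
  shows "x = x'" "y = y'"
proof -
  have "2 *\<^sub>R x = (x + y) + (x - y)" "2 *\<^sub>R x' = (x' + y') + (x' - y')" by (simp_all add: scaleR_2)
  then have "2 *\<^sub>R x = 2 *\<^sub>R x'" using assms by simp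
  then show "x = x'" by simp
  then show "y = y'" using assms(2) by simp
qed

definition d_mat :: "triple \<Rightarrow> cmat3" where "d_mat = (\<lambda>(X, Y, Z). Y - Z)"

lemma d_mat_diagonal_action: "d_mat (diagonal_action g p) = Ad g (d_mat p)"
  and s_mat_diagonal_action: "s_mat (diagonal_action g p) = Ad g (s_mat p)"
  by (cases p; simp add: d_mat_def s_mat_def diagonal_action_def Ad_diff Ad_add)+

lemma diagonal_representative_iff: "diagonal_representative p \<alpha> \<longleftrightarrow> d_mat p = diag_mat \<alpha>"
  by (cases p) (simp add: diagonal_representative_def d_mat_def)

lemma zero_level_eqI:
  assumes "p \<in> zero_level lam mu nu" "q \<in> zero_level lam mu nu" "d_mat p = d_mat q" "s_mat p = s_mat q"
  shows "p = q"
proof -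
  obtain X Y Z X' Y' Z' where p: "p = (X, Y, Z)" and q: "q = (X', Y', Z')" by (metis prod_cases3)
  have d: "Y - Z = Y' - Z'" and s: "Y + Z = Y' + Z'" using assms(3,4) by (simp_all add: p q d_mat_def s_mat_def)
  have "Y = Y'" "Z = Z'" using eq_if_diff_add_eq[OF d s] by auto
  then show ?thesis using assms(1,2) zero_levelD(1) unfolding p q by metis
qed

lemma diagonal_stabilizer_axis:
  assumes g: "g \<in> SU3" and D: "Ad g (diag_mat \<alpha>) = diag_mat \<alpha>" and ne: "\<alpha> $ 1 \<noteq> \<alpha> $ 2" "\<alpha> $ 1 \<noteq> \<alpha> $ 3"
  obtains \<kappa> where "\<kappa> \<noteq> 0" "g *v axis 1 1 = \<kappa> *s axis 1 1"
proof -
  define y where "y = g *v axis 1 1"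
  have e: "diag_mat \<alpha> *v axis 1 1 = \<alpha> $ 1 *s axis 1 1" by (simp add: mat_entries axis_def)
  have "diag_mat \<alpha> *v y = \<alpha> $ 1 *s y"
    using Ad_mult_vector[OF g, of "diag_mat \<alpha>" "axis 1 1"] unfolding D e y_def
    by (simp add: vector_scalar_commute)
  then have "\<alpha> $ 2 * y $ 2 = \<alpha> $ 1 * y $ 2" "\<alpha> $ 3 * y $ 3 = \<alpha> $ 1 * y $ 3"
    by (simp_all add: mat_entries)
  then have 23: "y $ 2 = 0" "y $ 3 = 0" using ne by simp_all
  have "hermitian_adjoint g *v y = axis 1 1"
    unfolding y_def by (simp add: matrix_vector_mul_assoc SU3_inverse[OF g])
  then have "y \<noteq> 0" by (auto simp: axis_eq_0_iff)
  then have "y $ 1 \<noteq> 0" using 23 by (auto simp: vec_eq_iff forall_3)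
  moreover have "y = y $ 1 *s axis 1 1" using 23 by (simp add: vec_eq_iff forall_3 axis_def)
  ultimately show ?thesis using that y_def by blast
qed

text \<open>Two such representatives differ by a group element commuting with a diagonal matrix of
  distinct eigenvalues. It rescales the first eigenvector, which \<open>fun_Ad\<close> and
  \<open>fun_scale\<close> absorb.\<close>

lemma diagonal_representatives_agree:
  assumes \<sigma>: "bij \<sigma>" and c: "c \<in> triple_reduced_product lam mu nu"
    and p: "p \<in> c" "diagonal_representative p \<alpha>" "ordered_eigenvalues \<sigma> \<alpha>"
    and q: "q \<in> c" "diagonal_representative q \<beta>" "ordered_eigenvalues \<sigma> \<beta>"
  shows "\<beta> = \<alpha>"
    "zden (diag_mat \<alpha>) (s_mat q) (axis 1 1) = 0 \<longleftrightarrow> zden (diag_mat \<alpha>) (s_mat p) (axis 1 1) = 0"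
    "zfun (diag_mat \<alpha>) (s_mat q) (axis 1 1) = zfun (diag_mat \<alpha>) (s_mat p) (axis 1 1)"
    "etafun (diag_mat \<alpha>) (s_mat q) (axis 1 1) = etafun (diag_mat \<alpha>) (s_mat p) (axis 1 1)"
proof -
  obtain g where g: "g \<in> SU3" and qe: "q = diagonal_action g p"
    using q(1) triple_reduced_productD(2)[OF c p(1)] by (auto simp: conj_class_def)
  have dp: "d_mat p = diag_mat \<alpha>" and dq: "d_mat q = diag_mat \<beta>"
    using p q by (simp_all add: diagonal_representative_iff)
  have b: "diag_mat \<beta> = Ad g (diag_mat \<alpha>)" using dp dq d_mat_diagonal_action[of g p] qe by simp
  show "\<beta> = \<alpha>"
    by (rule ordered_eigenvalues_unique[OF \<sigma> q(3) p(3)])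
      (simp_all add: b trace_Ad[OF g] Ad_mult[OF g, symmetric])
  then have D: "Ad g (diag_mat \<alpha>) = diag_mat \<alpha>" using b by simp
  note ne = ordered_eigenvalues_distinct[OF \<sigma> p(3)]
  obtain \<kappa> where \<kappa>: "\<kappa> \<noteq> 0" "g *v axis 1 1 = \<kappa> *s axis 1 1"
    by (rule diagonal_stabilizer_axis[OF g D]) (use ne in simp_all)
  have s: "s_mat q = Ad g (s_mat p)" using s_mat_diagonal_action qe by simp
  note f = fun_Ad[OF g, of "diag_mat \<alpha>" "s_mat p" "axis 1 1", unfolded D s[symmetric] \<kappa>(2) fun_scale[OF \<kappa>(1)]]
  show "zden (diag_mat \<alpha>) (s_mat q) (axis 1 1) = 0 \<longleftrightarrow> zden (diag_mat \<alpha>) (s_mat p) (axis 1 1) = 0"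
    using f(1) \<kappa>(1) by (metis mult_eq_0_iff power_eq_0_iff)
  show "zfun (diag_mat \<alpha>) (s_mat q) (axis 1 1) = zfun (diag_mat \<alpha>) (s_mat p) (axis 1 1)"
    "etafun (diag_mat \<alpha>) (s_mat q) (axis 1 1) = etafun (diag_mat \<alpha>) (s_mat p) (axis 1 1)"
    using f(2,3) .
qed

text \<open>Resolves the definite description: the common zero at one representative is the common
  zero at every other one.\<close>

lemma solution_point_eq:
  assumes \<sigma>: "bij \<sigma>" and c: "c \<in> triple_reduced_product lam mu nu"
    and p: "p \<in> c" "diagonal_representative p \<alpha>" "ordered_eigenvalues \<sigma> \<alpha>"
    and s: "s_mat p $ 2 $ 1 \<noteq> 0" "s_mat p $ 3 $ 1 \<noteq> 0"
  shows "solution_point \<sigma> c = (zfun (diag_mat \<alpha>) (s_mat p) (axis 1 1), etafun (diag_mat \<alpha>) (s_mat p) (axis 1 1))"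
    and "\<And>q \<beta> x. q \<in> c \<Longrightarrow> diagonal_representative q \<beta> \<Longrightarrow> ordered_eigenvalues \<sigma> \<beta> \<Longrightarrow>
      common_zero q x \<longleftrightarrow> x = solution_point \<sigma> c"
    and "\<And>q \<beta>. q \<in> c \<Longrightarrow> diagonal_representative q \<beta> \<Longrightarrow> ordered_eigenvalues \<sigma> \<beta> \<Longrightarrow>
      \<beta> = \<alpha> \<and> s_mat q $ 2 $ 1 \<noteq> 0 \<and> s_mat q $ 3 $ 1 \<noteq> 0"
proof -
  let ?x = "(zfun (diag_mat \<alpha>) (s_mat p) (axis 1 1), etafun (diag_mat \<alpha>) (s_mat p) (axis 1 1))"
  have ne: "\<alpha> $ 2 \<noteq> \<alpha> $ 3" using ordered_eigenvalues_distinct[OF \<sigma> p(3)] by simp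
  show nz: "\<beta> = \<alpha> \<and> s_mat q $ 2 $ 1 \<noteq> 0 \<and> s_mat q $ 3 $ 1 \<noteq> 0"
    if "q \<in> c" "diagonal_representative q \<beta>" "ordered_eigenvalues \<sigma> \<beta>" for q \<beta>
    using diagonal_representatives_agree(1,2)[OF \<sigma> c p that] s ne by (auto simp: zden_diagonal)
  have cz: "common_zero q x \<longleftrightarrow> x = ?x"
    if "q \<in> c" "diagonal_representative q \<beta>" "ordered_eigenvalues \<sigma> \<beta>" for q \<beta> x
    using nz[OF that] common_zero_iff[of q \<alpha> x] ne that diagonal_representatives_agree(3,4)[OF \<sigma> c p that]
    by auto
  show sp: "solution_point \<sigma> c = ?x"
    unfolding solution_point_def
  proof (rule the_equality)
    show "\<exists>p\<in>c. \<exists>\<alpha>. diagonal_representative p \<alpha> \<and> ordered_eigenvalues \<sigma> \<alpha> \<and> common_zero p ?x"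
      using p cz by blast
  qed (use cz in blast)
  show "common_zero q x \<longleftrightarrow> x = solution_point \<sigma> c"
    if "q \<in> c" "diagonal_representative q \<beta>" "ordered_eigenvalues \<sigma> \<beta>" for q \<beta> x
    using cz[OF that] unfolding sp .
qed

section \<open>Injectivity\<close>

lemma (in diagonal_frame) det_L: "det L = 0"
proof -
  have "S $ 2 $ 1 * S $ 3 $ 1 * det L = 0"
    using zero2 zero3 by (simp add: det_3 diag_mat_def mat_def) algebra
  then show ?thesis using s_nz by simp
qed

text \<open>The coefficients are the traces controlled by \<open>zero_level_traces\<close>, where
  those of \<open>z ^ 3\<close> and \<open>z\<close> occur only as one combination.\<close>

lemma det_pencil:
  fixes D S :: cmat3
  assumes "trace D = 0" "trace S = 0"
  shows "det (scale_mat z D + S - mat \<eta>) = - (\<eta> ^ 3)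
     + (z\<^sup>2 * trace (D ** D) + 2 * z * trace (D ** S) + trace (S ** S)) / 2 * \<eta>
     + (z ^ 3 * trace (D ** D ** D) + 3 * z\<^sup>2 * trace (D ** D ** S) + 3 * z * trace (D ** S ** S)
        + trace (S ** S ** S)) / 3"
proof -
  have sc: "scale_mat z A ** B = scale_mat z (A ** B)" "B ** scale_mat z A = scale_mat z (B ** A)"
    "(A + B) ** C = A ** C + B ** C" "C ** (A + B) = C ** A + C ** B"
    "scale_mat z (A + B) = scale_mat z A + scale_mat z B"
    "trace (scale_mat z A) = z * trace A" for A B C :: cmat3
    by (simp_all add: mat_entries algebra_simps)
  have cyc: "trace (A ** B ** C) = trace (B ** C ** A)" for A B C :: cmat3
    using trace_mul_sym[of A "B ** C"] by (simp add: matrix_mul_assoc)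
  let ?L = "scale_mat z D + S"
  have 1: "trace ?L = 0" using assms by (simp add: sc trace_add)
  have 2: "trace (?L ** ?L) = z\<^sup>2 * trace (D ** D) + 2 * z * trace (D ** S) + trace (S ** S)"
    unfolding sc trace_add using trace_mul_sym[of D S] by (simp add: algebra_simps power2_eq_square)
  have 3: "trace (?L ** ?L ** ?L) = z ^ 3 * trace (D ** D ** D) + 3 * z\<^sup>2 * trace (D ** D ** S)
      + 3 * z * trace (D ** S ** S) + trace (S ** S ** S)"
    unfolding sc trace_add
    using cyc[of D D S] cyc[of D S D] cyc[of S S D] cyc[of S D S]
    by (simp add: algebra_simps power2_eq_square power3_eq_cube)
  show ?thesis
    unfolding det_minus_mat det_eq_traces[of ?L] 1 2 3 by (simp add: field_simps)
qed

text \<open>Supplies the scalar phase that gives a diagonal unitary matrix determinant one.\<close>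

lemma unit_cube_root:
  assumes "cmod w = 1"
  obtains t where "cmod t = 1" "t ^ 3 * w = 1"
proof -
  have w: "w = cis (Arg w)" using assms by (subst cis_Arg) (auto simp: sgn_div_norm)
  have "cis (- Arg w / 3) ^ 3 = cis (real 3 * (- Arg w / 3))" by (rule Complex.DeMoivre)
  then have "cis (- Arg w / 3) ^ 3 * cis (Arg w) = cis (real 3 * (- Arg w / 3) + Arg w)"
    by (simp only: cis_mult)
  then have "cis (- Arg w / 3) ^ 3 * cis (Arg w) = 1" by simp
  then show ?thesis using that[of "cis (- Arg w / 3)"] w by simp
qed

text \<open>The relations involving \<open>m2\<close> recover \<open>S\<^sub>3\<^sub>2\<close> from the first column, so that only the phases of
  \<open>S\<^sub>2\<^sub>1\<close> and \<open>S\<^sub>3\<^sub>1\<close> have to be adjusted.\<close>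
lemma phases_conjugate:
  assumes S: "hermitian_adjoint S = - S" and S': "hermitian_adjoint S' = - S'"
    and nz: "S $ 2 $ 1 \<noteq> 0" "S $ 3 $ 1 \<noteq> 0"
    and n2: "cmod (S' $ 2 $ 1) = cmod (S $ 2 $ 1)" and n3: "cmod (S' $ 3 $ 1) = cmod (S $ 3 $ 1)"
    and d: "S' $ 1 $ 1 = S $ 1 $ 1" "S' $ 2 $ 2 = S $ 2 $ 2" "S' $ 3 $ 3 = S $ 3 $ 3"
    and r: "S $ 3 $ 1 * m2 = S $ 2 $ 1 * S $ 3 $ 2" "S' $ 3 $ 1 * m2 = S' $ 2 $ 1 * S' $ 3 $ 2"
  shows "\<exists>g\<in>SU3. Ad g S = S' \<and> (\<forall>\<alpha>. Ad g (diag_mat \<alpha>) = diag_mat \<alpha>)"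
proof -
  define u2 where "u2 = S' $ 2 $ 1 / S $ 2 $ 1"
  define u3 where "u3 = S' $ 3 $ 1 / S $ 3 $ 1"
  have u: "S' $ 2 $ 1 = u2 * S $ 2 $ 1" "S' $ 3 $ 1 = u3 * S $ 3 $ 1" using nz by (simp_all add: u2_def u3_def)
  have un: "cmod u2 = 1" "cmod u3 = 1" using n2 n3 nz by (simp_all add: u2_def u3_def norm_divide)
  obtain t where t: "cmod t = 1" "t ^ 3 * (u2 * u3) = 1"
    using unit_cube_root[of "u2 * u3"] un by (auto simp: norm_mult)
  have uni: "x * cnj x = 1" if "cmod x = 1" for x
    using that by (simp add: complex_norm_square[symmetric])
  have t1: "t * cnj t = 1" and u21: "u2 * cnj u2 = 1" and u31: "u3 * cnj u3 = 1"
    using uni t un by auto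
  define g where "g = diag_mat (vector [t, t * u2, t * u3])"
  have ge: "Ad g M $ i $ j = (vector [t, t * u2, t * u3] :: complex^3) $ i * M $ i $ j
      * cnj ((vector [t, t * u2, t * u3] :: complex^3) $ j)" for M i j
    using exhaust_3[of i] exhaust_3[of j] by (auto simp: Ad_def g_def mat_entries)
  have "g ** hermitian_adjoint g = mat 1"
    using t1 u21 u31 by (simp add: g_def mat_entries mat_def) algebra
  moreover have "det g = 1" using t(2) by (simp add: g_def det_3 diag_mat_def power3_eq_cube algebra_simps)
  ultimately have g: "g \<in> SU3" by (simp add: SU3_def)
  have diag: "Ad g (diag_mat \<alpha>) = diag_mat \<alpha>" for \<alpha>
    using t1 u21 u31 by (simp add: vec_eq_iff forall_3 ge) (simp add: diag_mat_def, algebra)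
  have sk: "S $ i $ j = - cnj (S $ j $ i)" "S' $ i $ j = - cnj (S' $ j $ i)" for i j
    using S S' by (metis hermitian_adjoint_nth minus_minus vector_uminus_component)+
  have "S $ 2 $ 1 * (u2 * S' $ 3 $ 2 - u3 * S $ 3 $ 2) = 0" using r unfolding u by algebra
  then have "u2 * S' $ 3 $ 2 = u3 * S $ 3 $ 2" using nz by simp
  then have s32: "S' $ 3 $ 2 = u3 * cnj u2 * S $ 3 $ 2" using u21 by algebra
  have s23: "S' $ 2 $ 3 = u2 * cnj u3 * S $ 2 $ 3"
    using sk(2)[of 2 3] sk(1)[of 2 3] by (simp add: s32)
  have s1: "S' $ 1 $ 2 = cnj u2 * S $ 1 $ 2" "S' $ 1 $ 3 = cnj u3 * S $ 1 $ 3"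
    using sk(2)[of 1 2] sk(1)[of 1 2] sk(2)[of 1 3] sk(1)[of 1 3] by (simp_all add: u)
  have "Ad g S = S'"
    unfolding vec_eq_iff forall_3 ge u s1 s23 s32 d
    using t1 u21 u31 by (simp, algebra)
  with g diag show ?thesis by blast
qed

text \<open>The finite counterpart of \<open>diagonal_rigidity\<close>. Skewness makes the products
  \<open>S $ j $ k * S $ k $ j\<close> squared moduli up to sign, so only phases remain, and
  \<open>phases_conjugate\<close> removes them.\<close>

lemma coordinates_injective:
  assumes \<sigma>: "bij \<sigma>"
    and zs: "(\<Sum>j\<in>UNIV. mu $ j) = 0" "(\<Sum>j\<in>UNIV. nu $ j) = 0"
    and p: "p \<in> zero_level lam mu nu" "diagonal_representative p \<alpha>" "ordered_eigenvalues \<sigma> \<alpha>"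
    and q: "q \<in> zero_level lam mu nu" "diagonal_representative q \<beta>" "ordered_eigenvalues \<sigma> \<beta>"
    and fp: "diagonal_frame \<alpha> (s_mat p) z \<eta>" and fq: "diagonal_frame \<beta> (s_mat q) z \<eta>"
    and z: "z \<noteq> 0" "z\<^sup>2 \<noteq> 1"
  shows "conj_class p = conj_class q"
proof -
  define S where "S = s_mat p"
  define S' where "S' = s_mat q"
  obtain X Y Z X' Y' Z' where pe: "p = (X, Y, Z)" and qe: "q = (X', Y', Z')" by (metis prod_cases3)
  have D: "Y - Z = diag_mat \<alpha>" "Y' - Z' = diag_mat \<beta>" and S: "Y + Z = S" "Y' + Z' = S'"
    using p(2) q(2) by (simp_all add: pe qe diagonal_representative_def s_mat_def S_def S'_def)
  note tr = zero_level_traces[OF p(1)[unfolded pe] q(1)[unfolded qe], unfolded D S]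
  have t0: "trace (diag_mat \<alpha>) = 0" "trace S = 0" "trace (diag_mat \<beta>) = 0" "trace S' = 0"
    using zero_level_trace_zero[OF zs p(1)[unfolded pe]] zero_level_trace_zero[OF zs q(1)[unfolded qe]]
    unfolding D S by auto
  have det: "det (scale_mat z (diag_mat \<alpha>) + S - mat \<eta>) = 0" "det (scale_mat z (diag_mat \<beta>) + S' - mat \<eta>) = 0"
    using diagonal_frame.det_L[OF fp] diagonal_frame.det_L[OF fq] by (simp_all add: S_def S'_def)
  let ?d = "trace (diag_mat \<alpha> ** diag_mat \<alpha> ** diag_mat \<alpha>) - trace (diag_mat \<beta> ** diag_mat \<beta> ** diag_mat \<beta>)"
  \<comment> \<open>Both determinants vanish at the same \<open>(z, \<eta>)\<close>, and as
    polynomials they differ only in the coefficients tied together by \<open>tr(7)\<close>.\<close>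
  have "(z ^ 3 - z) * ?d = 0"
    using det tr(7) unfolding det_pencil[OF t0(1,2)] det_pencil[OF t0(3,4)] tr(2-6) by algebra
  moreover have "z ^ 3 - z = z * (z\<^sup>2 - 1)" by algebra
  ultimately have d3: "trace (diag_mat \<alpha> ** diag_mat \<alpha> ** diag_mat \<alpha>) = trace (diag_mat \<beta> ** diag_mat \<beta> ** diag_mat \<beta>)"
    using z by simp
  have ab: "\<beta> = \<alpha>"
    by (rule ordered_eigenvalues_unique[OF \<sigma> q(3) p(3)]) (use t0 tr(2) d3 in simp_all)
  note ne = diagonal_frame.distinct[OF fp]
  have "S $ 1 $ 1 - S' $ 1 $ 1 = 0 \<and> S $ 2 $ 2 - S' $ 2 $ 2 = 0 \<and> S $ 3 $ 3 - S' $ 3 $ 3 = 0"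
    by (rule vandermonde3[OF ne]) (use tr(1,3,5) in \<open>simp_all add: ab mat_entries algebra_simps power2_eq_square\<close>)
  then have diag: "S' $ 1 $ 1 = S $ 1 $ 1" "S' $ 2 $ 2 = S $ 2 $ 2" "S' $ 3 $ 3 = S $ 3 $ 3" by auto
  note nz = diagonal_frame.s_nz[OF fp, folded S_def] diagonal_frame.s_nz[OF fq, folded S'_def]
  define m2 where "m2 = \<alpha> $ 2 * z - \<eta> + S $ 2 $ 2"
  define m3 where "m3 = \<alpha> $ 3 * z - \<eta> + S $ 3 $ 3"
  have E: "S $ 2 $ 1 * m3 = S $ 3 $ 1 * S $ 2 $ 3" "S $ 3 $ 1 * m2 = S $ 2 $ 1 * S $ 3 $ 2"
    and E': "S' $ 2 $ 1 * m3 = S' $ 3 $ 1 * S' $ 2 $ 3" "S' $ 3 $ 1 * m2 = S' $ 2 $ 1 * S' $ 3 $ 2"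
    using diagonal_frame.zero2[OF fp] diagonal_frame.zero3[OF fp] diagonal_frame.zero2[OF fq] diagonal_frame.zero3[OF fq]
    by (simp_all add: m2_def m3_def ab diag S_def[symmetric] S'_def[symmetric])
  have "S $ 2 $ 1 * S $ 3 $ 1 * (m2 * m3 - S $ 2 $ 3 * S $ 3 $ 2) = 0" using E by algebra
  moreover have "S' $ 2 $ 1 * S' $ 3 $ 1 * (m2 * m3 - S' $ 2 $ 3 * S' $ 3 $ 2) = 0" using E' by algebra
  ultimately have q23: "S' $ 2 $ 3 * S' $ 3 $ 2 = S $ 2 $ 3 * S $ 3 $ 2" using nz by simp
  \<comment> \<open>\<open>q23\<close> settles one product; the traces of \<open>S S\<close> and
    \<open>D S S\<close> give two independent equations for the other two.\<close>
  define a where "a = S' $ 1 $ 2 * S' $ 2 $ 1 - S $ 1 $ 2 * S $ 2 $ 1"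
  define b where "b = S' $ 1 $ 3 * S' $ 3 $ 1 - S $ 1 $ 3 * S $ 3 $ 1"
  have 1: "2 * (a + b) = 0"
    using tr(4) q23 by (simp add: mat_entries a_def b_def diag) algebra
  have "3 * trace (diag_mat \<alpha> ** S ** S) = 3 * trace (diag_mat \<alpha> ** S' ** S')"
    using tr(7) d3 unfolding ab by simp
  then have 2: "(\<alpha> $ 1 + \<alpha> $ 2) * a + (\<alpha> $ 1 + \<alpha> $ 3) * b = 0"
    using q23 by (simp add: mat_entries a_def b_def diag) algebra
  have "(\<alpha> $ 2 - \<alpha> $ 3) * a = 0" using 1 2 by algebra
  then have "a = 0" using ne by simp
  then have "b = 0" using 1 by simp
  have sk: "hermitian_adjoint S = - S" "hermitian_adjoint S' = - S'"
    using zero_levelD(3,4)[OF p(1)[unfolded pe]] zero_levelD(3,4)[OF q(1)[unfolded qe]]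
    by (simp_all add: S[symmetric] hermitian_adjoint_add)
  have ske: "S $ i $ j = - cnj (S $ j $ i)" "S' $ i $ j = - cnj (S' $ j $ i)" for i j
    using sk by (metis hermitian_adjoint_nth minus_minus vector_uminus_component)+
  have norm: "cmod x = cmod y" if "x * cnj x = y * cnj y" for x y
    using that by (metis complex_norm_square of_real_eq_iff norm_ge_zero power2_eq_iff_nonneg of_real_power)
  have "S' $ 2 $ 1 * cnj (S' $ 2 $ 1) = S $ 2 $ 1 * cnj (S $ 2 $ 1)"
    using \<open>a = 0\<close> ske(1)[of 1 2] ske(2)[of 1 2] by (simp add: a_def mult.commute)
  then have n2: "cmod (S' $ 2 $ 1) = cmod (S $ 2 $ 1)" by (rule norm)
  have "S' $ 3 $ 1 * cnj (S' $ 3 $ 1) = S $ 3 $ 1 * cnj (S $ 3 $ 1)"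
    using \<open>b = 0\<close> ske(1)[of 1 3] ske(2)[of 1 3] by (simp add: b_def mult.commute)
  then have n3: "cmod (S' $ 3 $ 1) = cmod (S $ 3 $ 1)" by (rule norm)
  obtain g where g: "g \<in> SU3" "Ad g S = S'" "Ad g (diag_mat \<alpha>) = diag_mat \<alpha>"
    using phases_conjugate[OF sk nz(1,2) n2 n3 diag E(2) E'(2)] by blast
  have "diagonal_action g p = q"
  proof (rule zero_level_eqI[OF zero_level_diagonal_action[OF g(1) p(1)] q(1)])
    show "d_mat (diagonal_action g p) = d_mat q"
      using p(2) q(2) g(3) by (simp add: d_mat_diagonal_action diagonal_representative_iff ab)
    show "s_mat (diagonal_action g p) = s_mat q"
      using g(2) by (simp add: s_mat_diagonal_action S_def S'_def)
  qed
  then show ?thesis using conj_class_diagonal_action[OF g(1)] by metis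
qed

section \<open>Smooth dependence\<close>

text \<open>A traceless \<open>D\<close> with \<open>trace (D ** D) = T\<close> has as eigenvalues
  the roots of \<open>x ^ 3 - T / 2 * x = w\<close>, where
  \<open>w = trace (D ** D ** D) / 3\<close>. With \<open>T\<close> constant, a simple eigenvalue is
  locally a holomorphic function of the single number \<open>w\<close>, by the inverse function
  theorem in one variable.\<close>

lemma local_root:
  fixes \<alpha> T :: complex
  assumes ne: "3 * \<alpha>\<^sup>2 - T / 2 \<noteq> 0"
  obtains V h where "open V" "\<alpha> ^ 3 - T / 2 * \<alpha> \<in> V" "h holomorphic_on V" "h (\<alpha> ^ 3 - T / 2 * \<alpha>) = \<alpha>"
    "\<And>w. w \<in> V \<Longrightarrow> h w ^ 3 - T / 2 * h w = w"
    "(h has_field_derivative 1 / (3 * \<alpha>\<^sup>2 - T / 2)) (at (\<alpha> ^ 3 - T / 2 * \<alpha>))"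
proof -
  define f where "f = (\<lambda>x. x ^ 3 - T / 2 * x)"
  have f: "(f has_field_derivative 3 * x\<^sup>2 - T / 2) (at x)" for x
    unfolding f_def by (auto intro!: derivative_eq_intros)
  then have hol: "f holomorphic_on S" for S
    unfolding holomorphic_on_def field_differentiable_def by (blast intro: has_field_derivative_at_within)
  have "deriv f \<alpha> \<noteq> 0" using ne f DERIV_imp_deriv by metis
  then obtain r where r: "r > 0" "open (f ` ball \<alpha> r)" "inj_on f (ball \<alpha> r)"
    using has_complex_derivative_locally_invertible[OF hol UNIV_I open_UNIV, of \<alpha>] by metis
  obtain h where h: "h holomorphic_on f ` ball \<alpha> r" "\<And>x. x \<in> ball \<alpha> r \<Longrightarrow> deriv f x * deriv h (f x) = 1"
    "\<And>x. x \<in> ball \<alpha> r \<Longrightarrow> h (f x) = x"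
    using holomorphic_has_inverse[OF hol open_ball r(3)] by metis
  have in_ball: "\<alpha> \<in> ball \<alpha> r" using r by simp
  have "deriv f \<alpha> = 3 * \<alpha>\<^sup>2 - T / 2" using f DERIV_imp_deriv by blast
  then have "deriv h (f \<alpha>) = 1 / (3 * \<alpha>\<^sup>2 - T / 2)"
    using h(2)[OF in_ball] ne by (metis mult.commute nonzero_eq_divide_eq)
  then have "(h has_field_derivative 1 / (3 * \<alpha>\<^sup>2 - T / 2)) (at (f \<alpha>))"
    using holomorphic_derivI[OF h(1) r(2), of "f \<alpha>"] in_ball by auto
  moreover have "f (h w) = w" if "w \<in> f ` ball \<alpha> r" for w using that h(3) by auto
  ultimately show ?thesis
    using that[of "f ` ball \<alpha> r" h] r(2) h(1,3) in_ball unfolding f_def by auto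
qed

definition vec_smooth :: "'a::real_normed_vector set \<Rightarrow> ('a \<Rightarrow> complex^3) \<Rightarrow> bool" where
  "vec_smooth W v \<longleftrightarrow> (\<forall>i. smooth_on W (\<lambda>q. v q $ i))"

definition mat_smooth :: "'a::real_normed_vector set \<Rightarrow> ('a \<Rightarrow> cmat3) \<Rightarrow> bool" where
  "mat_smooth W A \<longleftrightarrow> (\<forall>i j. smooth_on W (\<lambda>q. A q $ i $ j))"

lemma mat_smooth_mult_vec:
  assumes "open W" "mat_smooth W A" "vec_smooth W v"
  shows "vec_smooth W (\<lambda>q. A q *v v q)"
  using assms unfolding vec_smooth_def mat_smooth_def
  by (auto simp: matrix_vector_mult_def sum_3 intro!: smooth_on_add smooth_on_mult)

lemma mat_smooth_mult:
  assumes "open W" "mat_smooth W A" "mat_smooth W B"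
  shows "mat_smooth W (\<lambda>q. A q ** B q)"
  using assms unfolding mat_smooth_def
  by (auto simp: matrix_matrix_mult_def sum_3 intro!: smooth_on_add smooth_on_mult)

lemma smooth_on_trace:
  assumes "open W" "mat_smooth W A"
  shows "smooth_on W (\<lambda>q. trace (A q))"
  using assms unfolding mat_smooth_def by (auto simp: trace_def sum_3 intro!: smooth_on_add)

lemma smooth_on_det3:
  assumes "open W" "vec_smooth W a" "vec_smooth W b" "vec_smooth W c"
  shows "smooth_on W (\<lambda>q. det3 (a q) (b q) (c q))"
  using assms unfolding vec_smooth_def det3_def
  by (auto intro!: smooth_on_add smooth_on_mult smooth_on_diff)

lemma smooth_on_zden:
  assumes "open W" "mat_smooth W D" "mat_smooth W S" "vec_smooth W e"
  shows "smooth_on W (\<lambda>q. zden (D q) (S q) (e q))"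
  unfolding zden_def by (intro smooth_on_det3 mat_smooth_mult_vec assms)

lemma smooth_on_zfun:
  assumes "open W" "mat_smooth W D" "mat_smooth W S" "vec_smooth W e"
    and "\<And>q. q \<in> W \<Longrightarrow> zden (D q) (S q) (e q) \<noteq> 0"
  shows "smooth_on W (\<lambda>q. zfun (D q) (S q) (e q))"
proof -
  have "smooth_on W (\<lambda>q. (0 - det3 (e q) (S q *v e q) (S q *v (S q *v e q))) / zden (D q) (S q) (e q))"
    by (intro smooth_on_divide smooth_on_diff smooth_on_const smooth_on_zden smooth_on_det3
        mat_smooth_mult_vec assms)
  then show ?thesis by (simp add: zfun_def)
qed

lemma smooth_on_etafun:
  assumes "open W" "mat_smooth W D" "mat_smooth W S" "vec_smooth W e"
    and "\<And>q. q \<in> W \<Longrightarrow> zden (D q) (S q) (e q) \<noteq> 0"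
  shows "smooth_on W (\<lambda>q. etafun (D q) (S q) (e q))"
  unfolding etafun_def
  by (intro smooth_on_divide smooth_on_add smooth_on_mult smooth_on_zfun smooth_on_zden smooth_on_det3
        mat_smooth_mult_vec assms)

section \<open>The differentials of \<open>z\<close> and \<open>\<eta>\<close>\<close>

definition cross :: "complex^3 \<Rightarrow> complex^3 \<Rightarrow> complex^3" where
  "cross a b = vector [a $ 2 * b $ 3 - a $ 3 * b $ 2, a $ 3 * b $ 1 - a $ 1 * b $ 3, a $ 1 * b $ 2 - a $ 2 * b $ 1]"

lemma cross_nth [simp]:
  "cross a b $ 1 = a $ 2 * b $ 3 - a $ 3 * b $ 2"
  "cross a b $ 2 = a $ 3 * b $ 1 - a $ 1 * b $ 3"
  "cross a b $ 3 = a $ 1 * b $ 2 - a $ 2 * b $ 1"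
  by (simp_all add: cross_def)

lemma bdot_cross: "bdot (cross a b) c = det3 a b c"
  by (simp add: bdot_def sum_3 det3_def algebra_simps)

lemma bdot_simps:
  "bdot (u + v) w = bdot u w + bdot v w" "bdot u (v + w) = bdot u v + bdot u w"
  "bdot u (v - w) = bdot u v - bdot u w" "bdot u (c *s v) = c * bdot u v"
  "bdot (u v* A) w = bdot u (A *v w)" "bdot 0 w = 0"
  by (simp_all add: mat_entries algebra_simps)

lemma bounded_bilinear_mat_vec: "bounded_bilinear ((*v) :: cmat3 \<Rightarrow> complex^3 \<Rightarrow> complex^3)"
  and bounded_bilinear_mat_mat: "bounded_bilinear ((**) :: cmat3 \<Rightarrow> cmat3 \<Rightarrow> cmat3)"
  and bounded_bilinear_smult: "bounded_bilinear ((*s) :: complex \<Rightarrow> complex^3 \<Rightarrow> complex^3)"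
  and bounded_bilinear_cross: "bounded_bilinear cross"
  and bounded_bilinear_bdot: "bounded_bilinear bdot"
  unfolding bilinear_conv_bounded_bilinear[symmetric] bilinear_def linear_iff
  by (simp_all add: mat_entries algebra_simps scaleR_conv_of_real[where 'a = complex])

lemma bounded_linear_trace: "bounded_linear (trace :: cmat3 \<Rightarrow> complex)"
  unfolding linear_conv_bounded_linear[symmetric] linear_iff
  by (simp add: mat_entries algebra_simps)

lemma has_derivative_det3:
  assumes "(a has_derivative a') (at p)" "(b has_derivative b') (at p)" "(c has_derivative c') (at p)"
  shows "((\<lambda>q. det3 (a q) (b q) (c q)) has_derivative
    (\<lambda>u. bdot (cross (a p) (b p)) (c' u) + bdot (cross (a p) (b' u) + cross (a' u) (b p)) (c p))) (at p)"
  using bounded_bilinear.FDERIV[OF bounded_bilinear_bdot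
      bounded_bilinear.FDERIV[OF bounded_bilinear_cross assms(1,2)] assms(3)]
  by (simp only: bdot_cross)

text \<open>\<open>zdef\<close> and \<open>edef\<close> are the left eigenvector equation paired
  with \<open>S e\<close> and \<open>D S e\<close>. Differentiated along \<open>u\<close>, they show
  that the linearized row \<open>R\<close> annihilates both vectors; by \<open>eig\<close> it also
  annihilates \<open>e\<close>, and the three form a basis.\<close>

lemma (in diagonal_frame) jet_of_derivative:
  fixes Df Sf :: "'a::real_normed_vector \<Rightarrow> cmat3"
  assumes Df: "(Df has_derivative D') (at p)" and Sf: "(Sf has_derivative S') (at p)"
    and ef: "(ef has_derivative e') (at p)"
    and F: "(F has_derivative F') (at p)" and E: "(E has_derivative E') (at p)"
    and at_p: "Df p = D" "Sf p = S" "ef p = axis 1 1" "F p = z" "E p = \<eta>"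
    and W: "open W" "p \<in> W"
    and zdef: "\<And>q. q \<in> W \<Longrightarrow> F q * zden (Df q) (Sf q) (ef q) + det3 (ef q) (Sf q *v ef q) (Sf q *v (Sf q *v ef q)) = 0"
    and edef: "\<And>q. q \<in> W \<Longrightarrow> E q * zden (Df q) (Sf q) (ef q)
        - (F q * det3 (ef q) (Sf q *v ef q) (Df q *v (Df q *v (Sf q *v ef q)))
        + det3 (ef q) (Sf q *v ef q) (Sf q *v (Df q *v (Sf q *v ef q)))) = 0"
    and eig: "D' u *v axis 1 1 + D *v e' u = a' *s axis 1 1 + \<alpha> $ 1 *s e' u"
  shows "is_jet (D' u) (S' u) (F' u) (E' u)"
proof -
  note mv = bounded_bilinear.FDERIV[OF bounded_bilinear_mat_vec]
  define vf where "vf = (\<lambda>q. Sf q *v ef q)"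
  define v' where "v' = (\<lambda>u. S *v e' u + S' u *v axis 1 1)"
  define v where "v = S *v axis 1 1"
  have vf: "(vf has_derivative v') (at p)"
    unfolding vf_def v'_def using mv[OF Sf ef] by (simp add: at_p)
  have vp: "vf p = v" by (simp add: vf_def v_def at_p)
  define wf where "wf = (\<lambda>q. Df q *v vf q)"
  define w' where "w' = (\<lambda>u. D *v v' u + D' u *v v)"
  define w where "w = D *v v"
  have wf: "(wf has_derivative w') (at p)"
    unfolding wf_def w'_def using mv[OF Df vf] by (simp add: at_p vp)
  have wp: "wf p = w" by (simp add: wf_def w_def at_p vp)
  have Sv: "((\<lambda>q. Sf q *v vf q) has_derivative (\<lambda>u. S *v v' u + S' u *v v)) (at p)"
    and Dw: "((\<lambda>q. Df q *v wf q) has_derivative (\<lambda>u. D *v w' u + D' u *v w)) (at p)"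
    and Sw: "((\<lambda>q. Sf q *v wf q) has_derivative (\<lambda>u. S *v w' u + S' u *v w)) (at p)"
    using mv[OF Sf vf] mv[OF Df wf] mv[OF Sf wf] by (simp_all add: at_p vp wp)
  define \<psi>' where "\<psi>' = cross (axis 1 1) (v' u) + cross (e' u) v"
  have psi: "cross (axis 1 1) v = \<psi>"
    by (simp add: vec_eq_iff forall_3 v_def matrix_vector_mult_def sum_3 axis_def)
  note d3 = has_derivative_det3[OF ef vf]
  have zero: "f' u = 0" if "(f has_derivative f') (at p)" "\<And>q. q \<in> W \<Longrightarrow> f q = (0::complex)" for f f'
  proof -
    have "((\<lambda>q. 0) has_derivative f') (at p)"
      by (rule has_derivative_transform_within_open[OF that(1) W]) (use that(2) in auto)
    then show ?thesis using has_derivative_unique[OF _ has_derivative_const] by metis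
  qed
  have i: "F' u * bdot \<psi> w + z * (bdot \<psi> (w' u) + bdot \<psi>' w)
      + (bdot \<psi> (S *v v' u + S' u *v v) + bdot \<psi>' (S *v v)) = 0"
    using zero[OF has_derivative_add[OF has_derivative_mult[OF F d3[OF wf]] d3[OF Sv]]] zdef
    by (simp add: zden_def vf_def[symmetric] wf_def[symmetric] vp wp at_p psi \<psi>'_def bdot_cross[symmetric]
        vf_def[THEN fun_cong, symmetric] wf_def[THEN fun_cong, symmetric] algebra_simps)
  have ii: "E' u * bdot \<psi> w + \<eta> * (bdot \<psi> (w' u) + bdot \<psi>' w)
      - (F' u * bdot \<psi> (D *v w) + z * (bdot \<psi> (D *v w' u + D' u *v w) + bdot \<psi>' (D *v w))
      + (bdot \<psi> (S *v w' u + S' u *v w) + bdot \<psi>' (S *v w))) = 0"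
    using zero[OF has_derivative_diff[OF has_derivative_mult[OF E d3[OF wf]]
          has_derivative_add[OF has_derivative_mult[OF F d3[OF Dw]] d3[OF Sw]]]] edef
    by (simp add: zden_def vp wp at_p psi \<psi>'_def bdot_cross[symmetric]
        vf_def[THEN fun_cong, symmetric] wf_def[THEN fun_cong, symmetric] algebra_simps)
  define N where "N = scale_mat (F' u) D + scale_mat z (D' u) + S' u - mat (E' u)"
  define R where "R = \<psi>' v* L + \<psi> v* N"
  have R: "bdot R x = bdot \<psi>' (L *v x) + bdot \<psi> (N *v x)" for x
    by (simp add: R_def bdot_simps)
  have L: "L *v x = z *s (D *v x) + S *v x - \<eta> *s x"
    and N: "N *v x = F' u *s (D *v x) + z *s (D' u *v x) + S' u *v x - E' u *s x" for x
    by (simp_all add: N_def mat_entries mat_def algebra_simps)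
  have psiL: "bdot \<psi> (L *v x) = 0" for x
    using psi_L by (metis bdot_simps(5,6))
  have psiv: "bdot \<psi> v = 0" "bdot \<psi>' v + bdot \<psi> (v' u) = 0"
    unfolding psi[symmetric] \<psi>'_def by (simp_all add: mat_entries axis_def algebra_simps)
  have psie: "bdot \<psi> (axis 1 1) = 0" "bdot \<psi>' (axis 1 1) + bdot \<psi> (e' u) = 0"
    unfolding psi[symmetric] \<psi>'_def by (simp_all add: mat_entries axis_def algebra_simps)
  have psi'v: "bdot \<psi>' v = - bdot \<psi> (v' u)" using psiv(2) by (simp add: eq_neg_iff_add_eq_0)
  have psi'e: "bdot \<psi>' (axis 1 1) = - bdot \<psi> (e' u)" using psie(2) by (simp add: eq_neg_iff_add_eq_0)
  have "bdot R v = 0"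
    using i psiL[of "v' u"] unfolding R L N bdot_simps psi'v psiv w'_def w_def by algebra
  moreover have "bdot R w = 0"
    using ii psiL[of "w' u"] unfolding R L N bdot_simps by algebra
  moreover have "bdot R (axis 1 1) = 0"
  proof -
    have "bdot \<psi>' (D *v axis 1 1) = \<alpha> $ 1 * bdot \<psi>' (axis 1 1)" "bdot \<psi> (D *v axis 1 1) = \<alpha> $ 1 * bdot \<psi> (axis 1 1)"
      unfolding D_axis bdot_simps by simp_all
    moreover have "bdot \<psi> (D' u *v axis 1 1) + bdot \<psi> (D *v e' u) = a' * bdot \<psi> (axis 1 1) + \<alpha> $ 1 * bdot \<psi> (e' u)"
      unfolding bdot_simps(2,4)[symmetric] eig ..
    moreover have "bdot \<psi>' (S *v axis 1 1) = - bdot \<psi> (S *v e' u) - bdot \<psi> (S' u *v axis 1 1)"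
      using psi'v unfolding v_def[symmetric] v'_def bdot_simps by simp
    ultimately show ?thesis
      using psiL[of "e' u"] unfolding R L N bdot_simps psi'e psie by algebra
  qed
  ultimately have r: "R $ 1 = 0" "S $ 2 $ 1 * R $ 2 + S $ 3 $ 1 * R $ 3 = 0"
     "\<alpha> $ 2 * S $ 2 $ 1 * R $ 2 + \<alpha> $ 3 * S $ 3 $ 1 * R $ 3 = 0"
    by (simp_all add: w_def v_def mat_entries axis_def algebra_simps)
  have "(\<alpha> $ 2 - \<alpha> $ 3) * S $ 2 $ 1 * R $ 2 = 0" "(\<alpha> $ 3 - \<alpha> $ 2) * S $ 3 $ 1 * R $ 3 = 0"
    using r(2,3) by algebra+
  then have "R = 0" using r(1) distinct s_nz by (simp add: vec_eq_iff forall_3)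
  then show ?thesis
    unfolding jet_def using eig psie(2) unfolding R_def N_def by blast
qed

section \<open>The eigenvector near a diagonal point\<close>

text \<open>For traceless \<open>D\<close> with \<open>T = trace (D\<^sup>2)\<close> and eigenvalue \<open>a\<close>, the Cayley-Hamilton theorem reads
  \<open>(D - a) (D\<^sup>2 + a D + a\<^sup>2 - T/2) = 0\<close>.\<close>
definition eigvec :: "complex \<Rightarrow> complex^3 \<Rightarrow> cmat3 \<Rightarrow> complex \<Rightarrow> complex^3" where
  "eigvec T c D a = D *v (D *v c) + a *s (D *v c) + (a * a - T / 2) *s c"

lemma eigvec_Ad: "g \<in> SU3 \<Longrightarrow> eigvec T (g *v c) (Ad g D) a = g *v eigvec T c D a"
  unfolding eigvec_def Ad_mult_vector by (simp add: mat_entries algebra_simps)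

text \<open>The cubic of \<open>local_root\<close> has the eigenvalues as roots, and its derivative
  at each is the product of the differences to the other two, nonzero in the distinct case.\<close>

lemma traceless_eigenvalue_products:
  fixes \<alpha> :: "complex^3"
  assumes "\<alpha> $ 1 + \<alpha> $ 2 + \<alpha> $ 3 = 0" "T = trace (diag_mat \<alpha> ** diag_mat \<alpha>)"
  shows "T / 2 = (\<alpha> $ 1)\<^sup>2 + \<alpha> $ 1 * \<alpha> $ 2 + (\<alpha> $ 2)\<^sup>2"
    "3 * (\<alpha> $ 1)\<^sup>2 - T / 2 = (\<alpha> $ 1 - \<alpha> $ 2) * (\<alpha> $ 1 - \<alpha> $ 3)"
    "3 * (\<alpha> $ 2)\<^sup>2 - T / 2 = (\<alpha> $ 2 - \<alpha> $ 1) * (\<alpha> $ 2 - \<alpha> $ 3)"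
    "3 * (\<alpha> $ 3)\<^sup>2 - T / 2 = (\<alpha> $ 3 - \<alpha> $ 1) * (\<alpha> $ 3 - \<alpha> $ 2)"
    "\<And>j. (\<alpha> $ j) ^ 3 - T / 2 * \<alpha> $ j = trace (diag_mat \<alpha> ** diag_mat \<alpha> ** diag_mat \<alpha>) / 3"
proof -
  have a3: "\<alpha> $ 3 = - \<alpha> $ 1 - \<alpha> $ 2" using assms(1) by (simp add: algebra_simps eq_neg_iff_add_eq_0)
  have T: "T / 2 = (\<alpha> $ 1)\<^sup>2 + \<alpha> $ 1 * \<alpha> $ 2 + (\<alpha> $ 2)\<^sup>2"
    unfolding assms(2) by (simp add: mat_entries a3 power2_eq_square algebra_simps)
  have w: "trace (diag_mat \<alpha> ** diag_mat \<alpha> ** diag_mat \<alpha>) = (\<alpha> $ 1) ^ 3 + (\<alpha> $ 2) ^ 3 + (\<alpha> $ 3) ^ 3"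
    by (simp add: mat_entries power3_eq_cube)
  show "T / 2 = (\<alpha> $ 1)\<^sup>2 + \<alpha> $ 1 * \<alpha> $ 2 + (\<alpha> $ 2)\<^sup>2" by (rule T)
  show "3 * (\<alpha> $ 1)\<^sup>2 - T / 2 = (\<alpha> $ 1 - \<alpha> $ 2) * (\<alpha> $ 1 - \<alpha> $ 3)"
    unfolding T a3 by algebra
  show "3 * (\<alpha> $ 2)\<^sup>2 - T / 2 = (\<alpha> $ 2 - \<alpha> $ 1) * (\<alpha> $ 2 - \<alpha> $ 3)"
    unfolding T a3 by algebra
  show "3 * (\<alpha> $ 3)\<^sup>2 - T / 2 = (\<alpha> $ 3 - \<alpha> $ 1) * (\<alpha> $ 3 - \<alpha> $ 2)"
    unfolding T a3 by algebra
  show "(\<alpha> $ j) ^ 3 - T / 2 * \<alpha> $ j = trace (diag_mat \<alpha> ** diag_mat \<alpha> ** diag_mat \<alpha>) / 3" for j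
  proof -
    have "3 * ((\<alpha> $ j) ^ 3 - T / 2 * \<alpha> $ j) = trace (diag_mat \<alpha> ** diag_mat \<alpha> ** diag_mat \<alpha>)"
    proof -
      have "3 * ((\<alpha> $ 1) ^ 3 - T / 2 * \<alpha> $ 1) = (\<alpha> $ 1) ^ 3 + (\<alpha> $ 2) ^ 3 + (\<alpha> $ 3) ^ 3"
        unfolding T a3 by algebra
      moreover have "3 * ((\<alpha> $ 2) ^ 3 - T / 2 * \<alpha> $ 2) = (\<alpha> $ 1) ^ 3 + (\<alpha> $ 2) ^ 3 + (\<alpha> $ 3) ^ 3"
        unfolding T a3 by algebra
      moreover have "3 * ((\<alpha> $ 3) ^ 3 - T / 2 * \<alpha> $ 3) = (\<alpha> $ 1) ^ 3 + (\<alpha> $ 2) ^ 3 + (\<alpha> $ 3) ^ 3"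
        unfolding T a3 by algebra
      ultimately show ?thesis unfolding w using exhaust_3[of j] by metis
    qed
    then show ?thesis by (intro eq_divide_imp) (simp, metis mult.commute)
  qed
qed

lemma eigvec_diagonal:
  assumes "\<alpha> $ 1 + \<alpha> $ 2 + \<alpha> $ 3 = 0" "T = trace (diag_mat \<alpha> ** diag_mat \<alpha>)"
  shows "eigvec T c (diag_mat \<alpha>) (\<alpha> $ 1) = (c $ 1 * ((\<alpha> $ 1 - \<alpha> $ 2) * (\<alpha> $ 1 - \<alpha> $ 3))) *s axis 1 1"
proof -
  have a3: "\<alpha> $ 3 = - \<alpha> $ 1 - \<alpha> $ 2" using assms(1) by (simp add: algebra_simps eq_neg_iff_add_eq_0)
  show ?thesis
    unfolding eigvec_def traceless_eigenvalue_products(1)[OF assms]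
    by (simp add: mat_entries axis_def a3 power2_eq_square algebra_simps)
qed

text \<open>\<open>e'\<close> is the derivative of \<open>eigvec\<close> at fixed \<open>T\<close>.
  The trace conditions, which hold along tangent directions, make the derivative \<open>a'\<close>
  of the root equal to \<open>D' $ 1 $ 1\<close>, so the eigenvector equation holds to first
  order.\<close>

lemma eigvec_perturbation:
  fixes D' :: cmat3
  assumes sum: "\<alpha> $ 1 + \<alpha> $ 2 + \<alpha> $ 3 = 0"
    and tr: "trace D' = 0" "trace (diag_mat \<alpha> ** D') = 0"
    and k: "k * ((\<alpha> $ 1 - \<alpha> $ 2) * (\<alpha> $ 1 - \<alpha> $ 3)) = 1"
    and a': "a' = k * trace (diag_mat \<alpha> ** diag_mat \<alpha> ** D')"
    and e': "e' = diag_mat \<alpha> *v (D' *v c) + D' *v (diag_mat \<alpha> *v c)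
      + (\<alpha> $ 1 *s (D' *v c) + a' *s (diag_mat \<alpha> *v c)) + (2 * \<alpha> $ 1 * a') *s c"
    and c: "c = axis 1 k"
  shows "D' *v axis 1 1 + diag_mat \<alpha> *v e' = a' *s axis 1 1 + \<alpha> $ 1 *s e'"
proof -
  have t: "D' $ 1 $ 1 + D' $ 2 $ 2 + D' $ 3 $ 3 = 0"
    "\<alpha> $ 1 * D' $ 1 $ 1 + \<alpha> $ 2 * D' $ 2 $ 2 + \<alpha> $ 3 * D' $ 3 $ 3 = 0"
    using tr by (simp_all add: mat_entries)
  have "trace (diag_mat \<alpha> ** diag_mat \<alpha> ** D')
      = (\<alpha> $ 1)\<^sup>2 * D' $ 1 $ 1 + (\<alpha> $ 2)\<^sup>2 * D' $ 2 $ 2 + (\<alpha> $ 3)\<^sup>2 * D' $ 3 $ 3"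
    by (simp add: mat_entries power2_eq_square)
  also have "\<dots> = ((\<alpha> $ 1 - \<alpha> $ 2) * (\<alpha> $ 1 - \<alpha> $ 3)) * D' $ 1 $ 1" using t by algebra
  finally have 1: "a' = D' $ 1 $ 1" using a' k by (simp add: mult.assoc[symmetric])
  have "e' $ 2 = k * (2 * \<alpha> $ 1 + \<alpha> $ 2) * D' $ 2 $ 1" "e' $ 3 = k * (2 * \<alpha> $ 1 + \<alpha> $ 3) * D' $ 3 $ 1"
    unfolding e' c by (simp_all add: mat_entries axis_def algebra_simps)
  then have "D' $ 2 $ 1 + \<alpha> $ 2 * e' $ 2 = \<alpha> $ 1 * e' $ 2" "D' $ 3 $ 1 + \<alpha> $ 3 * e' $ 3 = \<alpha> $ 1 * e' $ 3"
    using k sum by algebra+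
  then show ?thesis using 1 by (simp add: mat_entries axis_def)
qed

text \<open>The roots \<open>a $ j\<close> are the eigenvalues of \<open>d_mat q\<close> in the
  right order, so some \<open>g\<close> conjugates it to \<open>diag_mat a\<close>. It carries
  \<open>eigvec\<close> to a multiple of \<open>axis 1 1\<close>, and invariance identifies the
  explicit functions with \<open>z0\<close> and \<open>eta0\<close>.\<close>

lemma conj_class_in_domain:
  fixes a c :: "complex^3"
  assumes \<sigma>: "bij \<sigma>"
    and zs: "(\<Sum>j\<in>UNIV. mu $ j) = 0" "(\<Sum>j\<in>UNIV. nu $ j) = 0"
    and q: "q \<in> zero_level lam mu nu" and a: "ordered_eigenvalues \<sigma> a"
    and T: "T = trace (d_mat q ** d_mat q)"
    and roots: "\<And>j. (a $ j) ^ 3 - T / 2 * a $ j = trace (d_mat q ** d_mat q ** d_mat q) / 3"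
    and nz: "zden (d_mat q) (s_mat q) (eigvec T c (d_mat q) (a $ 1)) \<noteq> 0"
    and z: "z = zfun (d_mat q) (s_mat q) (eigvec T c (d_mat q) (a $ 1))" "z \<noteq> 0" "z\<^sup>2 \<noteq> 1"
    and \<eta>: "\<eta> = etafun (d_mat q) (s_mat q) (eigvec T c (d_mat q) (a $ 1))"
  shows "conj_class q \<in> coordinate_domain lam mu nu \<sigma>" "z0 \<sigma> (conj_class q) = z" "eta0 \<sigma> (conj_class q) = \<eta>"
proof -
  obtain X Y Z where qe: "q = (X, Y, Z)" by (metis prod_cases3)
  have D: "d_mat q = Y - Z" by (simp add: qe d_mat_def)
  note ne = ordered_eigenvalues_distinct[OF \<sigma> a]
  have tr0: "trace (d_mat q) = 0" using zero_level_trace_zero[OF zs q[unfolded qe]] D by simp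
  have skew: "hermitian_adjoint (d_mat q) = - d_mat q"
    using zero_levelD(3,4)[OF q[unfolded qe]] by (simp add: D hermitian_adjoint_diff)
  have det: "det (d_mat q - mat (a $ j)) = 0" for j
    using roots[of j] unfolding det_minus_mat det_eq_traces[of "d_mat q"] tr0 T[symmetric]
    by (simp add: field_simps)
  \<comment> \<open>Three distinct roots of a cubic without quadratic term have sum zero, so the
    third is the eigenvalue left over by the trace.\<close>
  have "(a $ 1 - a $ 2) * ((a $ 1)\<^sup>2 + a $ 1 * a $ 2 + (a $ 2)\<^sup>2 - T / 2) = 0"
    "(a $ 1 - a $ 3) * ((a $ 1)\<^sup>2 + a $ 1 * a $ 3 + (a $ 3)\<^sup>2 - T / 2) = 0"
    using roots[of 1] roots[of 2] roots[of 3] by algebra+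
  then have "(a $ 1)\<^sup>2 + a $ 1 * a $ 2 + (a $ 2)\<^sup>2 - T / 2 = 0" "(a $ 1)\<^sup>2 + a $ 1 * a $ 3 + (a $ 3)\<^sup>2 - T / 2 = 0"
    using ne by simp_all
  then have "(a $ 2 - a $ 3) * (a $ 1 + a $ 2 + a $ 3) = 0" by algebra
  then have sum: "a $ 1 + a $ 2 + a $ 3 = 0" using ne by simp
  then have vec: "vector [a $ 1, a $ 2, trace (d_mat q) - a $ 1 - a $ 2] = a"
  proof -
    have "0 - a $ 1 - a $ 2 = a $ 3" using sum by algebra
    then show ?thesis unfolding tr0 by (simp add: vec_eq_iff forall_3)
  qed
  obtain g where g: "g \<in> SU3" and gD: "Ad g (d_mat q) = diag_mat a"
    using diagonalize_distinct[OF skew det[of 1] det[of 2]] ne unfolding vec by auto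
  define p where "p = diagonal_action g q"
  define S where "S = s_mat p"
  have S: "S = Ad g (s_mat q)" by (simp add: S_def p_def s_mat_diagonal_action)
  have p: "p \<in> conj_class q" using g by (auto simp: p_def conj_class_def)
  have c: "conj_class q \<in> triple_reduced_product lam mu nu"
    using q by (auto simp: triple_reduced_product_def)
  have dp: "diagonal_representative p a"
    using gD by (simp add: diagonal_representative_iff p_def d_mat_diagonal_action)
  have Ta: "T = trace (diag_mat a ** diag_mat a)"
    unfolding gD[symmetric] by (simp add: T Ad_mult[OF g, symmetric] trace_Ad[OF g])
  define \<kappa> where "\<kappa> = (g *v c) $ 1 * ((a $ 1 - a $ 2) * (a $ 1 - a $ 3))"
  have e: "g *v eigvec T c (d_mat q) (a $ 1) = \<kappa> *s axis 1 1"
    unfolding eigvec_Ad[OF g, symmetric] gD \<kappa>_def by (rule eigvec_diagonal[OF sum Ta])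
  note f = fun_Ad[OF g, of "d_mat q" "s_mat q" "eigvec T c (d_mat q) (a $ 1)", unfolded gD S[symmetric] e]
  \<comment> \<open>A vanishing \<open>eigvec\<close> would make \<open>zden\<close> zero, contrary
    to \<open>nz\<close>.\<close>
  have "\<kappa> \<noteq> 0"
  proof
    assume "\<kappa> = 0"
    then have "zden (diag_mat a) S (\<kappa> *s axis 1 1) = 0" by (simp add: zden_def det3_def)
    then show False using f(1) nz by simp
  qed
  note f' = f[unfolded fun_scale[OF \<open>\<kappa> \<noteq> 0\<close>]]
  have "zden (diag_mat a) S (axis 1 1) \<noteq> 0" using f'(1) nz by auto
  then have s: "S $ 2 $ 1 \<noteq> 0" "S $ 3 $ 1 \<noteq> 0" by (auto simp: zden_diagonal)
  have "solution_point \<sigma> (conj_class q) = (z, \<eta>)"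
    using solution_point_eq(1)[OF \<sigma> c p dp a] s f'(2,3) z(1) \<eta> by (simp add: S_def)
  then show *: "z0 \<sigma> (conj_class q) = z" "eta0 \<sigma> (conj_class q) = \<eta>"
    by (simp_all add: z0_def eta0_def)
  show "conj_class q \<in> coordinate_domain lam mu nu \<sigma>"
    unfolding coordinate_domain_def using c p dp a s z(2,3) * by (auto simp: S_def)
qed

lemma bounded_linear_d_mat: "bounded_linear d_mat"
  and bounded_linear_s_mat: "bounded_linear s_mat"
proof -
  have "d_mat = (\<lambda>q. fst (snd q) - snd (snd q))" "s_mat = (\<lambda>q. fst (snd q) + snd (snd q))"
    by (auto simp: d_mat_def s_mat_def fun_eq_iff)
  moreover have "bounded_linear (\<lambda>q :: triple. fst (snd q) - snd (snd q))"
    "bounded_linear (\<lambda>q :: triple. fst (snd q) + snd (snd q))"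
    by (intro bounded_linear_sub bounded_linear_add bounded_linear_compose[OF bounded_linear_fst]
        bounded_linear_compose[OF bounded_linear_snd] bounded_linear_snd)+
  ultimately show "bounded_linear d_mat" "bounded_linear s_mat" by simp_all
qed

lemma mat_smooth_linear:
  assumes "open W" "bounded_linear (A :: 'a::real_normed_vector \<Rightarrow> cmat3)"
  shows "mat_smooth W A"
proof -
  have "bounded_linear (\<lambda>q. A q $ i $ j)" for i j
    by (rule bounded_linear_compose[OF bounded_linear_vec_nth
          bounded_linear_compose[OF bounded_linear_vec_nth assms(2)]])
  then show ?thesis by (simp add: mat_smooth_def smooth_on_linear[OF assms(1)])
qed

lemma smooth_on_eigvec:
  assumes "open W" "mat_smooth W D" "smooth_on W a"
  shows "vec_smooth W (\<lambda>q. eigvec T c (D q) (a q))"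
proof -
  have c: "vec_smooth W (\<lambda>q. c)" by (simp add: vec_smooth_def smooth_on_const[OF assms(1)])
  have D: "vec_smooth W (\<lambda>q. D q *v c)" "vec_smooth W (\<lambda>q. D q *v (D q *v c))"
    by (intro mat_smooth_mult_vec assms c)+
  show ?thesis unfolding vec_smooth_def
  proof
    fix i
    have "smooth_on W (\<lambda>q. (D q *v (D q *v c)) $ i + a q * (D q *v c) $ i + (a q * a q - T / 2) * c $ i)"
      using D unfolding vec_smooth_def
      by (intro smooth_on_add smooth_on_mult smooth_on_diff smooth_on_const assms) auto
    then show "smooth_on W (\<lambda>q. eigvec T c (D q) (a q) $ i)"
      by (simp only: eigvec_def vector_add_component vector_smult_component)
  qed
qed

section \<open>Darboux coordinates\<close>

locale diagonal_point =
  fixes lam mu nu :: "real^3" and \<sigma> :: "3 \<Rightarrow> 3" and p0 :: triple and \<alpha> :: "complex^3"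
  assumes bij: "bij \<sigma>"
    and sums: "(\<Sum>j\<in>UNIV. mu $ j) = 0" "(\<Sum>j\<in>UNIV. nu $ j) = 0"
    and p0: "p0 \<in> zero_level lam mu nu" "diagonal_representative p0 \<alpha>" "ordered_eigenvalues \<sigma> \<alpha>"
    and nonzero: "s_mat p0 $ 2 $ 1 \<noteq> 0" "s_mat p0 $ 3 $ 1 \<noteq> 0"
    and domain: "conj_class p0 \<in> coordinate_domain lam mu nu \<sigma>"
begin

definition T where "T = trace (diag_mat \<alpha> ** diag_mat \<alpha>)"
text \<open>The determinant of \<open>d_mat q\<close> wherever that matrix is traceless.\<close>

definition w where "w q = trace (d_mat q ** d_mat q ** d_mat q) / 3"
text \<open>The derivative at \<open>\<alpha> $ 1\<close> of the cubic that
  \<open>local_root\<close> inverts.\<close>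

definition \<kappa> where "\<kappa> = (\<alpha> $ 1 - \<alpha> $ 2) * (\<alpha> $ 1 - \<alpha> $ 3)"
text \<open>Scaled so that \<open>eigvec\<close> at \<open>p0\<close> is exactly
  \<open>axis 1 1\<close>.\<close>

definition c :: "complex^3" where "c = axis 1 (1 / \<kappa>)"
definition z where "z = zfun (diag_mat \<alpha>) (s_mat p0) (axis 1 1)"
definition \<eta> where "\<eta> = etafun (diag_mat \<alpha>) (s_mat p0) (axis 1 1)"

lemma d_p0: "d_mat p0 = diag_mat \<alpha>"
  using p0(2) by (simp add: diagonal_representative_iff)

lemmas distinct = ordered_eigenvalues_distinct[OF bij p0(3)]

lemma sum0: "\<alpha> $ 1 + \<alpha> $ 2 + \<alpha> $ 3 = 0"
proof -
  obtain X Y Z where pe: "p0 = (X, Y, Z)" by (metis prod_cases3)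
  have "trace (diag_mat \<alpha>) = 0"
    using zero_level_trace_zero(1)[OF sums p0(1)[unfolded pe]] d_p0 by (simp add: pe d_mat_def)
  then show ?thesis by (simp add: mat_entries)
qed

lemmas products = traceless_eigenvalue_products[OF sum0 T_def]

lemma kappa: "\<kappa> \<noteq> 0" "3 * (\<alpha> $ 1)\<^sup>2 - T / 2 = \<kappa>"
  using distinct products(2) by (simp_all add: \<kappa>_def)

lemma trace_square: "q \<in> zero_level lam mu nu \<Longrightarrow> trace (d_mat q ** d_mat q) = T"
proof -
  assume q: "q \<in> zero_level lam mu nu"
  obtain X Y Z X' Y' Z' where pe: "p0 = (X, Y, Z)" and qe: "q = (X', Y', Z')" by (metis prod_cases3)
  show ?thesis
    using zero_level_traces(2)[OF p0(1)[unfolded pe] q[unfolded qe]] d_p0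
    by (simp add: T_def pe qe d_mat_def)
qed

lemma w_p0: "(\<alpha> $ j) ^ 3 - T / 2 * \<alpha> $ j = w p0"
  unfolding w_def d_p0 by (rule products(5))

sublocale frame: diagonal_frame \<alpha> "s_mat p0" z \<eta>
  using linear_system_diagonal[of \<alpha> "s_mat p0" z \<eta>] distinct nonzero
  by unfold_locales (simp_all add: z_def \<eta>_def)

lemma domain_z: "z \<noteq> 0" "z\<^sup>2 \<noteq> 1"
proof -
  have "conj_class p0 \<in> triple_reduced_product lam mu nu"
    using p0 by (auto simp: triple_reduced_product_def)
  then have "z0 \<sigma> (conj_class p0) = z"
    using solution_point_eq(1)[OF bij _ conj_class_self p0(2,3) nonzero] by (simp add: z0_def z_def)
  then show "z \<noteq> 0" "z\<^sup>2 \<noteq> 1" using domain by (auto simp: coordinate_domain_def)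
qed

lemma eigvec_p0: "eigvec T c (d_mat p0) (\<alpha> $ 1) = axis 1 1"
  unfolding d_p0 eigvec_diagonal[OF sum0 T_def] \<kappa>_def[symmetric]
  using kappa by (simp add: c_def vec_eq_iff axis_def)

text \<open>\<open>a1\<close> is the continuation of \<open>\<alpha> $ 1\<close>, read as an
  eigenvalue on the zero level. All three roots are continued, since the order of the eigenvalues
  has to persist as well.\<close>

lemma local_functions:
  obtains W a1 where "open W" "p0 \<in> W" "smooth_on W a1" "a1 p0 = \<alpha> $ 1"
    "(a1 has_derivative (\<lambda>u. 1 / \<kappa> * trace (diag_mat \<alpha> ** diag_mat \<alpha> ** d_mat u))) (at p0)"
    "\<And>q. q \<in> W \<Longrightarrow> zden (d_mat q) (s_mat q) (eigvec T c (d_mat q) (a1 q)) \<noteq> 0"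
    "\<And>q. q \<in> W \<Longrightarrow> zfun (d_mat q) (s_mat q) (eigvec T c (d_mat q) (a1 q)) \<notin> {0, 1, - 1}"
    "\<And>q. q \<in> W \<inter> zero_level lam mu nu \<Longrightarrow> conj_class q \<in> coordinate_domain lam mu nu \<sigma> \<and>
       z0 \<sigma> (conj_class q) = zfun (d_mat q) (s_mat q) (eigvec T c (d_mat q) (a1 q)) \<and>
       eta0 \<sigma> (conj_class q) = etafun (d_mat q) (s_mat q) (eigvec T c (d_mat q) (a1 q))"
proof -
  have "3 * (\<alpha> $ j)\<^sup>2 - T / 2 \<noteq> 0" for j
  proof -
    have "3 * (\<alpha> $ 1)\<^sup>2 - T / 2 \<noteq> 0" unfolding products(2) using distinct by simp
    moreover have "3 * (\<alpha> $ 2)\<^sup>2 - T / 2 \<noteq> 0" unfolding products(3) using distinct by simp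
    moreover have "3 * (\<alpha> $ 3)\<^sup>2 - T / 2 \<noteq> 0" unfolding products(4) using distinct by simp
    ultimately show ?thesis using exhaust_3[of j] by metis
  qed
  then have "\<exists>V h. open V \<and> w p0 \<in> V \<and> h holomorphic_on V \<and> h (w p0) = \<alpha> $ j \<and>
      (\<forall>x\<in>V. h x ^ 3 - T / 2 * h x = x) \<and>
      (h has_field_derivative 1 / (3 * (\<alpha> $ j)\<^sup>2 - T / 2)) (at (w p0))" for j
    using local_root[of "\<alpha> $ j" T] unfolding w_p0 by metis
  then obtain V h where V: "\<And>j. open (V j)" "\<And>j. w p0 \<in> V j" and h: "\<And>j. h j holomorphic_on V j"
      "\<And>j. h j (w p0) = \<alpha> $ j" and hroot: "\<And>j x. x \<in> V j \<Longrightarrow> h j x ^ 3 - T / 2 * h j x = x"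
      "\<And>j. (h j has_field_derivative 1 / (3 * (\<alpha> $ j)\<^sup>2 - T / 2)) (at (w p0))"
    by metis
  have msd: "mat_smooth W d_mat" and mss: "mat_smooth W s_mat" if "open W" for W
    by (rule mat_smooth_linear[OF that bounded_linear_d_mat] mat_smooth_linear[OF that bounded_linear_s_mat])+
  have wsm: "smooth_on UNIV w"
  proof -
    have "smooth_on UNIV (\<lambda>q. 1 / 3 * trace (d_mat q ** d_mat q ** d_mat q))"
      by (intro smooth_on_mult smooth_on_const smooth_on_trace mat_smooth_mult msd open_UNIV)
    then show ?thesis by (simp add: w_def[abs_def])
  qed
  define W1 where "W1 = w -` (\<Inter>j. V j)"
  have "open (\<Inter>j. V j)" using V by (intro open_INT) auto
  then have W1: "open W1" "p0 \<in> W1"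
    using V smooth_on_imp_continuous_on[OF wsm]
    by (auto simp: W1_def intro: open_vimage)
  have asm: "smooth_on W1 (\<lambda>q. h j (w q))" for j
    by (rule smooth_on_holomorphic_comp[OF W1(1) V(1)[of j] _ h(1)])
      (use smooth_on_subset[OF wsm] in \<open>auto simp: W1_def\<close>)
  define a1 where "a1 q = h 1 (w q)" for q
  have a1sm: "smooth_on W1 a1" using asm[of 1] by (simp add: a1_def[abs_def])
  have acont: "continuous_on W1 (\<lambda>q. Im (h j (w q)))" for j
    using smooth_on_imp_continuous_on[OF asm] by (intro continuous_intros)
  define e where "e q = eigvec T c (d_mat q) (a1 q)" for q
  have esm: "vec_smooth W1 e"
    unfolding e_def[abs_def] by (rule smooth_on_eigvec[OF W1(1) msd[OF W1(1)] a1sm])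
  \<comment> \<open>The order of the eigenvalues and the nonvanishing of the denominator are open
    conditions that hold at \<open>p0\<close>.\<close>
  define W2 where "W2 = (W1 \<inter> (\<lambda>q. Im (h (\<sigma> 2) (w q)) - Im (h (\<sigma> 1) (w q))) -` {0<..})
      \<inter> (W1 \<inter> (\<lambda>q. Im (h (\<sigma> 3) (w q)) - Im (h (\<sigma> 2) (w q))) -` {0<..})
      \<inter> (W1 \<inter> (\<lambda>q. zden (d_mat q) (s_mat q) (e q)) -` (- {0}))"
  have W2o: "open W2"
    unfolding W2_def
    by (intro open_Int continuous_open_preimage W1(1) continuous_on_diff acont
        smooth_on_imp_continuous_on smooth_on_zden msd mss esm) auto
  have e0: "e p0 = axis 1 1" using eigvec_p0 by (simp add: e_def a1_def h)
  have "zden (d_mat p0) (s_mat p0) (e p0) \<noteq> 0"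
    unfolding e0 d_p0 zden_diagonal using nonzero distinct by simp
  then have W2p: "p0 \<in> W2"
    using p0(3) W1(2) by (simp add: W2_def h(2) ordered_eigenvalues_def)
  have sub: "W2 \<subseteq> W1" by (auto simp: W2_def)
  have esm2: "vec_smooth W2 e" using esm smooth_on_subset[OF _ sub] by (auto simp: vec_smooth_def)
  have zden: "zden (d_mat q) (s_mat q) (e q) \<noteq> 0" if "q \<in> W2" for q using that by (simp add: W2_def)
  define W where "W = W2 \<inter> (\<lambda>q. zfun (d_mat q) (s_mat q) (e q)) -` (- {0, 1, - 1})"
  have Wo: "open W"
    unfolding W_def
    by (intro continuous_open_preimage W2o smooth_on_imp_continuous_on smooth_on_zfun msd mss esm2 zden)
      (auto intro: open_Compl finite_imp_closed)
  have "zfun (d_mat p0) (s_mat p0) (e p0) = z" by (simp add: e0 d_p0 z_def)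
  then have Wp: "p0 \<in> W"
    using domain_z W2p by (auto simp: W_def)
  have Wsub: "W \<subseteq> W1" using sub by (auto simp: W_def)
  have dw: "(w has_derivative (\<lambda>u. trace (diag_mat \<alpha> ** diag_mat \<alpha> ** d_mat u))) (at p0)"
  proof -
    note d = bounded_linear_imp_has_derivative[OF bounded_linear_d_mat, of "at p0"]
    note mm = bounded_bilinear.FDERIV[OF bounded_bilinear_mat_mat]
    \<comment> \<open>By cyclicity the three terms of the product rule agree, which cancels the
      division by three.\<close>
    have "trace (diag_mat \<alpha> ** diag_mat \<alpha> ** M + (diag_mat \<alpha> ** M + M ** diag_mat \<alpha>) ** diag_mat \<alpha>) / 3
        = trace (diag_mat \<alpha> ** diag_mat \<alpha> ** M)" for M
      by (simp add: mat_entries algebra_simps)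
    then show ?thesis
      using has_derivative_mult_right[OF bounded_linear.has_derivative[OF bounded_linear_trace mm[OF mm[OF d d] d]], of "1 / 3"]
      by (simp add: w_def[abs_def] d_p0)
  qed
  have da: "(a1 has_derivative (\<lambda>u. 1 / \<kappa> * trace (diag_mat \<alpha> ** diag_mat \<alpha> ** d_mat u))) (at p0)"
    using has_derivative_compose[OF dw has_field_derivative_imp_has_derivative[OF hroot(2)[of 1]]]
    by (simp only: a1_def[abs_def] kappa(2))
  show ?thesis
  proof (rule that[OF Wo Wp smooth_on_subset[OF a1sm Wsub] _ da])
    show "a1 p0 = \<alpha> $ 1" by (simp add: a1_def h)
    fix q
    show "zden (d_mat q) (s_mat q) (eigvec T c (d_mat q) (a1 q)) \<noteq> 0"
      and "zfun (d_mat q) (s_mat q) (eigvec T c (d_mat q) (a1 q)) \<notin> {0, 1, - 1}" if "q \<in> W"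
      using that zden unfolding e_def[symmetric] by (auto simp: W_def)
    assume q: "q \<in> W \<inter> zero_level lam mu nu"
    define a where "a = (\<chi> j. h j (w q))"
    have wq: "w q \<in> V j" for j using q Wsub by (auto simp: W1_def)
    have ord: "ordered_eigenvalues \<sigma> a"
      using q by (auto simp: W_def W2_def ordered_eigenvalues_def a_def)
    have roots: "(a $ j) ^ 3 - T / 2 * a $ j = trace (d_mat q ** d_mat q ** d_mat q) / 3" for j
      using hroot(1)[OF wq[of j]] by (simp add: a_def w_def)
    have a1: "eigvec T c (d_mat q) (a $ 1) = e q" by (simp add: e_def a1_def a_def)
    have zne: "zden (d_mat q) (s_mat q) (e q) \<noteq> 0" "zfun (d_mat q) (s_mat q) (e q) \<noteq> 0"
      "(zfun (d_mat q) (s_mat q) (e q))\<^sup>2 \<noteq> 1"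
      using q zden by (auto simp: W_def power2_eq_1_iff)
    show "conj_class q \<in> coordinate_domain lam mu nu \<sigma> \<and>
       z0 \<sigma> (conj_class q) = zfun (d_mat q) (s_mat q) (eigvec T c (d_mat q) (a1 q)) \<and>
       eta0 \<sigma> (conj_class q) = etafun (d_mat q) (s_mat q) (eigvec T c (d_mat q) (a1 q))"
      using conj_class_in_domain[OF bij sums _ ord _ roots, of lam c, unfolded a1] trace_square q zne
      unfolding e_def[symmetric] by auto
  qed
qed

lemma domain_open: "\<exists>W. open W \<and> p0 \<in> W \<and> (\<forall>q\<in>W \<inter> zero_level lam mu nu. conj_class q \<in> coordinate_domain lam mu nu \<sigma>)"
  using local_functions by metis

theorem darboux_at_diagonal_point: "darboux_at lam mu nu (z0 \<sigma>) (zeta0 \<sigma>) p0"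
proof -
  obtain W a1 where W: "open W" "p0 \<in> W" and a1: "smooth_on W a1" "a1 p0 = \<alpha> $ 1"
    "(a1 has_derivative (\<lambda>u. 1 / \<kappa> * trace (diag_mat \<alpha> ** diag_mat \<alpha> ** d_mat u))) (at p0)"
    and zden: "\<And>q. q \<in> W \<Longrightarrow> zden (d_mat q) (s_mat q) (eigvec T c (d_mat q) (a1 q)) \<noteq> 0"
    and zfun: "\<And>q. q \<in> W \<Longrightarrow> zfun (d_mat q) (s_mat q) (eigvec T c (d_mat q) (a1 q)) \<notin> {0, 1, - 1}"
    and coord: "\<And>q. q \<in> W \<inter> zero_level lam mu nu \<Longrightarrow> conj_class q \<in> coordinate_domain lam mu nu \<sigma> \<and>
       z0 \<sigma> (conj_class q) = zfun (d_mat q) (s_mat q) (eigvec T c (d_mat q) (a1 q)) \<and>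
       eta0 \<sigma> (conj_class q) = etafun (d_mat q) (s_mat q) (eigvec T c (d_mat q) (a1 q))"
    by (rule local_functions) blast
  define e where "e q = eigvec T c (d_mat q) (a1 q)" for q
  define F where "F q = zfun (d_mat q) (s_mat q) (e q)" for q
  define E where "E q = etafun (d_mat q) (s_mat q) (e q)" for q
  define H where "H q = E q / (F q * (F q * F q - 1))" for q
  have zden: "zden (d_mat q) (s_mat q) (e q) \<noteq> 0" and Fne: "F q * (F q * F q - 1) \<noteq> 0" if "q \<in> W" for q
    using zden[OF that] zfun[OF that] by (auto simp: e_def F_def square_eq_1_iff)
  have ms: "mat_smooth W d_mat" "mat_smooth W s_mat"
    using mat_smooth_linear[OF W(1)] bounded_linear_d_mat bounded_linear_s_mat by auto
  have esm: "vec_smooth W e"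
    unfolding e_def[abs_def] by (rule smooth_on_eigvec[OF W(1) ms(1) a1(1)])
  have Fsm: "smooth_on W F"
    unfolding F_def[abs_def] by (rule smooth_on_zfun[OF W(1) ms esm zden])
  have Esm: "smooth_on W E"
    unfolding E_def[abs_def] by (rule smooth_on_etafun[OF W(1) ms esm zden])
  have Hsm: "smooth_on W H"
    unfolding H_def[abs_def]
    by (intro smooth_on_divide smooth_on_mult smooth_on_diff smooth_on_const W(1) Esm Fsm Fne)
  define F' where "F' = frechet_derivative F (at p0)"
  define H' where "H' = frechet_derivative H (at p0)"
  have dF: "(F has_derivative F') (at p0)" and dH: "(H has_derivative H') (at p0)"
    unfolding F'_def H'_def using smooth_on_has_derivative W(2) Fsm Hsm by blast+
  have e0: "e p0 = axis 1 1" using eigvec_p0 by (simp add: e_def a1)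
  have F0: "F p0 = z" and E0: "E p0 = \<eta>" by (simp_all add: F_def E_def z_def \<eta>_def e0 d_p0)
  define m where "m = z ^ 3 - z"
  have m: "m \<noteq> 0" using Fne[OF W(2)] by (simp add: F0 m_def power3_eq_cube algebra_simps)
  \<comment> \<open>\<open>E = H (F ^ 3 - F)\<close> on \<open>W\<close>, differentiated at
    \<open>p0\<close>; the multiple of \<open>F'\<close> drops out of the wedge product in
    \<open>form\<close>.\<close>
  define E' where "E' u = m * H' u + H p0 * (3 * z\<^sup>2 - 1) * F' u" for u
  have dE: "(E has_derivative E') (at p0)"
  proof -
    have EH: "H q * (F q * (F q * F q - 1)) = E q" if "q \<in> W" for q
      using Fne[OF that] by (simp add: H_def)
    have "((\<lambda>q. H q * (F q * (F q * F q - 1))) has_derivative E') (at p0)"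
      by (rule derivative_eq_intros dF dH refl)+
        (auto simp: fun_eq_iff E'_def m_def F0 power2_eq_square power3_eq_cube algebra_simps)
    then show ?thesis
      by (rule has_derivative_transform_within_open[OF _ W]) (rule EH)
  qed
  define de where "de u = diag_mat \<alpha> *v (d_mat u *v c) + d_mat u *v (diag_mat \<alpha> *v c)
      + (\<alpha> $ 1 *s (d_mat u *v c) + (1 / \<kappa> * trace (diag_mat \<alpha> ** diag_mat \<alpha> ** d_mat u)) *s (diag_mat \<alpha> *v c))
      + (2 * \<alpha> $ 1 * (1 / \<kappa> * trace (diag_mat \<alpha> ** diag_mat \<alpha> ** d_mat u))) *s c" for u
  note dd = bounded_linear_imp_has_derivative[OF bounded_linear_d_mat, of "at p0"]
  note ds = bounded_linear_imp_has_derivative[OF bounded_linear_s_mat, of "at p0"]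
  have dedef: "(e has_derivative de) (at p0)"
  proof -
    note mv = bounded_bilinear.FDERIV[OF bounded_bilinear_mat_vec]
    note sm = bounded_bilinear.FDERIV[OF bounded_bilinear_smult]
    have 1: "((\<lambda>q. d_mat q *v c) has_derivative (\<lambda>u. d_mat u *v c)) (at p0)"
      using mv[OF dd has_derivative_const[of c]] by simp
    have 2: "((\<lambda>q. a1 q * a1 q - T / 2) has_derivative
        (\<lambda>u. 2 * \<alpha> $ 1 * (1 / \<kappa> * trace (diag_mat \<alpha> ** diag_mat \<alpha> ** d_mat u)))) (at p0)"
      using has_derivative_diff[OF has_derivative_mult[OF a1(3) a1(3)] has_derivative_const[of "T / 2"]]
      by (simp add: a1(2) mult_ac)
    show ?thesis
      using has_derivative_add[OF has_derivative_add[OF mv[OF dd 1] sm[OF a1(3) 1]]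
          sm[OF 2 has_derivative_const[of c]]]
      by (simp add: e_def[abs_def] eigvec_def de_def[abs_def] d_p0 a1(2))
  qed
  obtain X Y Z where pe: "p0 = (X, Y, Z)" by (metis prod_cases3)
  have DS: "Y - Z = diag_mat \<alpha>" "Y + Z = s_mat p0"
    using d_p0 by (simp_all add: pe d_mat_def s_mat_def)
  have XYZ: "X = - (Y + Z)" "hermitian_adjoint X = - X" "hermitian_adjoint Y = - Y" "hermitian_adjoint Z = - Z"
    using zero_levelD p0(1) unfolding pe by metis+
  have jet: "frame.is_jet (d_mat u) (s_mat u) (F' u) (E' u)"
    if t: "tangent (diag_mat \<alpha>) (s_mat p0) A B C (d_mat u) (s_mat u)" for u A B C
  proof (rule frame.jet_of_derivative[OF dd ds dedef dF dE d_p0 refl e0 F0 E0 W])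
    show "F q * zden (d_mat q) (s_mat q) (e q) + det3 (e q) (s_mat q *v e q) (s_mat q *v (s_mat q *v e q)) = 0"
      if "q \<in> W" for q
      using zden[OF that] by (simp add: F_def zfun_def)
    show "E q * zden (d_mat q) (s_mat q) (e q)
        - (F q * det3 (e q) (s_mat q *v e q) (d_mat q *v (d_mat q *v (s_mat q *v e q)))
        + det3 (e q) (s_mat q *v e q) (s_mat q *v (d_mat q *v (s_mat q *v e q)))) = 0"
      if "q \<in> W" for q
      using zden[OF that] by (simp add: E_def F_def etafun_def)
    show "d_mat u *v axis 1 1 + diag_mat \<alpha> *v de u
        = (1 / \<kappa> * trace (diag_mat \<alpha> ** diag_mat \<alpha> ** d_mat u)) *s axis 1 1 + \<alpha> $ 1 *s de u"
      by (rule eigvec_perturbation[OF sum0 tangent_traces(2,4)[OF t] _ refl de_def c_def])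
        (use kappa in \<open>simp add: \<kappa>_def\<close>)
  qed
  have form: "complex_of_real (product_form p0 u v) = F' u * H' v - F' v * H' u"
    if u: "u \<in> level_tangent p0" and v: "v \<in> level_tangent p0" for u v
  proof -
    obtain A B C where ue: "u = (commutator A X, commutator B Y, commutator C Z)" and su: "A \<in> su3" "B \<in> su3" "C \<in> su3"
      and us: "commutator A X + commutator B Y + commutator C Z = 0"
      using level_tangentE u unfolding pe by metis
    obtain A' B' C' where ve: "v = (commutator A' X, commutator B' Y, commutator C' Z)"
      and sv: "A' \<in> su3" "B' \<in> su3" "C' \<in> su3"
      and vs: "commutator A' X + commutator B' Y + commutator C' Z = 0"
      using level_tangentE v unfolding pe by metis
    have t1: "tangent (diag_mat \<alpha>) (s_mat p0) A B C (d_mat u) (s_mat u)"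
      using level_tangent_imp_tangent[OF XYZ(1) us] by (simp add: DS ue d_mat_def) (simp add: s_mat_def)
    have t2: "tangent (diag_mat \<alpha>) (s_mat p0) A' B' C' (d_mat v) (s_mat v)"
      using level_tangent_imp_tangent[OF XYZ(1) vs] by (simp add: DS ve d_mat_def) (simp add: s_mat_def)
    have "complex_of_real (product_form p0 u v) = omega A B C (d_mat v) (s_mat v)"
      using product_form_eq_omega[OF p0(1)[unfolded pe], of A B C A' B' C'] su sv vs
      by (simp add: pe ue ve d_mat_def s_mat_def)
    moreover have "m * omega A B C (d_mat v) (s_mat v) = F' u * E' v - F' v * E' u"
      unfolding m_def by (rule frame.omega_eq[OF domain_z t1 jet[OF t1] t2 jet[OF t2]])
    moreover have "F' u * E' v - F' v * E' u = m * (F' u * H' v - F' v * H' u)"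
      by (simp add: E'_def algebra_simps)
    ultimately show ?thesis using m by simp
  qed
  have vert: "u \<in> vertical_space p0" if u: "u \<in> level_tangent p0" and 0: "F' u = 0" "H' u = 0" for u
  proof -
    obtain A B C where ue: "u = (commutator A X, commutator B Y, commutator C Z)" and su: "A \<in> su3" "B \<in> su3" "C \<in> su3"
      and us: "commutator A X + commutator B Y + commutator C Z = 0"
      using level_tangentE u unfolding pe by metis
    have t1: "tangent (diag_mat \<alpha>) (s_mat p0) A B C (d_mat u) (s_mat u)"
      using level_tangent_imp_tangent[OF XYZ(1) us] by (simp add: DS ue d_mat_def) (simp add: s_mat_def)
    \<comment> \<open>Vanishing differentials of \<open>z0\<close> and \<open>zeta0\<close> force
      that of \<open>eta0\<close> to vanish, so \<open>rigidity\<close> applies.\<close>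
    have "frame.is_jet (d_mat u) (s_mat u) 0 0"
      using jet[OF t1] 0 by (simp add: E'_def)
    then obtain G where G: "d_mat u = commutator G (Y - Z)" "s_mat u = commutator G (Y + Z)"
      using frame.rigidity[OF domain_z t1] DS by auto
    have y: "commutator B Y = commutator G Y" and z: "commutator C Z = commutator G Z"
    proof -
      have "commutator B Y - commutator C Z = commutator G Y - commutator G Z"
        "commutator B Y + commutator C Z = commutator G Y + commutator G Z"
        using G by (simp_all add: ue d_mat_def s_mat_def commutator_diff_right commutator_add_right)
      then show "commutator B Y = commutator G Y" "commutator C Z = commutator G Z"
        by (rule eq_if_diff_add_eq)+
    qed
    have "commutator A X = - (commutator G Y + commutator G Z)"
      using us unfolding y z by (metis add.assoc eq_neg_iff_add_eq_0)
    also have "\<dots> = commutator G X"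
      unfolding XYZ(1) by (simp add: mat_entries algebra_simps)
    finally have x: "commutator A X = commutator G X" .
    have skew: "hermitian_adjoint (commutator K M) = - commutator K M"
      if "K \<in> su3" "hermitian_adjoint M = - M" for K M
      using that by (simp add: su3_def commutator_def hermitian_adjoint_diff hermitian_adjoint_mult)
        (simp add: mat_entries)
    show ?thesis
      unfolding pe ue by (rule vertical_spaceI[OF XYZ(2-4) _ _ _ x y z]) (use skew su XYZ in blast)+
  qed
  have "F q = z0 \<sigma> (conj_class q) \<and> H q = zeta0 \<sigma> (conj_class q)" if "q \<in> W \<inter> zero_level lam mu nu" for q
    using coord[OF that] by (simp add: F_def E_def H_def e_def zeta0_def power2_eq_square)
  then show ?thesis
    unfolding darboux_at_def using W Fsm Hsm form vert unfolding F'_def H'_def by blast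
qed

end

lemma coordinate_domain_representative:
  assumes "bij \<sigma>" "(\<Sum>j\<in>UNIV. mu $ j) = 0" "(\<Sum>j\<in>UNIV. nu $ j) = 0"
    and p: "p \<in> zero_level lam mu nu" "conj_class p \<in> coordinate_domain lam mu nu \<sigma>"
  obtains g \<alpha> where "g \<in> SU3" "diagonal_point lam mu nu \<sigma> (diagonal_action g p) \<alpha>"
proof -
  obtain q \<alpha> where q: "q \<in> conj_class p" "diagonal_representative q \<alpha>" "ordered_eigenvalues \<sigma> \<alpha>"
    "s_mat q $ 2 $ 1 \<noteq> 0" "s_mat q $ 3 $ 1 \<noteq> 0"
    using p(2) by (auto simp: coordinate_domain_def)
  then obtain g where g: "g \<in> SU3" "q = diagonal_action g p" by (auto simp: conj_class_def)
  have "diagonal_point lam mu nu \<sigma> (diagonal_action g p) \<alpha>"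
    using q zero_level_diagonal_action[OF g(1) p(1)] conj_class_diagonal_action[OF g(1)] p(2) assms(1-3)
    unfolding g(2) by unfold_locales auto
  with g(1) show ?thesis by (rule that)
qed

lemma darboux_coordinates:
  assumes \<sigma>: "bij \<sigma>" and zs: "(\<Sum>j\<in>UNIV. mu $ j) = 0" "(\<Sum>j\<in>UNIV. nu $ j) = 0"
  shows "darboux_coordinates_on lam mu nu (coordinate_domain lam mu nu \<sigma>) (z0 \<sigma>) (zeta0 \<sigma>)"
proof -
  let ?Z = "zero_level lam mu nu" and ?U = "coordinate_domain lam mu nu \<sigma>"
  have "darboux_at lam mu nu (z0 \<sigma>) (zeta0 \<sigma>) p" if p: "p \<in> ?Z" "conj_class p \<in> ?U" for p
  proof (rule coordinate_domain_representative[OF \<sigma> zs p])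
    fix g \<alpha> assume g: "g \<in> SU3" and d: "diagonal_point lam mu nu \<sigma> (diagonal_action g p) \<alpha>"
    show ?thesis
      by (rule darboux_at_diagonal_action[OF g p(1) diagonal_point.darboux_at_diagonal_point[OF d]])
  qed
  moreover have "openin (top_of_set ?Z) {p \<in> ?Z. conj_class p \<in> ?U}"
  proof -
    define T where "T = \<Union>{W. open W \<and> (\<forall>q\<in>W \<inter> ?Z. conj_class q \<in> ?U)}"
    have "p \<in> T" if p: "p \<in> ?Z" "conj_class p \<in> ?U" for p
    proof (rule coordinate_domain_representative[OF \<sigma> zs p])
      fix g \<alpha> assume g: "g \<in> SU3" and d: "diagonal_point lam mu nu \<sigma> (diagonal_action g p) \<alpha>"
      obtain W where W: "open W" "diagonal_action g p \<in> W" "\<forall>q\<in>W \<inter> ?Z. conj_class q \<in> ?U"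
        using diagonal_point.domain_open[OF d] by blast
      have "open (diagonal_action g -` W)"
        using W(1) bounded_linear_diagonal_action by (simp add: continuous_open_vimage linear_continuous_at)
      moreover have "\<forall>q\<in>diagonal_action g -` W \<inter> ?Z. conj_class q \<in> ?U"
      proof
        fix q assume "q \<in> diagonal_action g -` W \<inter> ?Z"
        then have "diagonal_action g q \<in> W \<inter> ?Z" using zero_level_diagonal_action[OF g] by auto
        then show "conj_class q \<in> ?U" using W(3) conj_class_diagonal_action[OF g] by metis
      qed
      ultimately show ?thesis using W(2) unfolding T_def by blast
    qed
    then have "{p \<in> ?Z. conj_class p \<in> ?U} = ?Z \<inter> T" by (auto simp: T_def)
    moreover have "open T" unfolding T_def by (rule open_Union) blast
    ultimately show ?thesis unfolding openin_open by blast
  qed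
  moreover have "inj_on (\<lambda>c. (z0 \<sigma> c, zeta0 \<sigma> c)) ?U"
  proof (rule inj_onI)
    fix c c' assume c: "c \<in> ?U" and c': "c' \<in> ?U" and eq: "(z0 \<sigma> c, zeta0 \<sigma> c) = (z0 \<sigma> c', zeta0 \<sigma> c')"
    define z where "z = z0 \<sigma> c"
    have z: "z \<noteq> 0" "z\<^sup>2 \<noteq> 1" "z0 \<sigma> c' = z" using c eq by (auto simp: z_def coordinate_domain_def)
    have e: "eta0 \<sigma> c' = eta0 \<sigma> c"
      using eq z unfolding zeta0_def by (simp add: z_def)
    have frame: "\<exists>p\<in>zero_level lam mu nu. \<exists>\<alpha>. d = conj_class p \<and> diagonal_representative p \<alpha> \<and>
        ordered_eigenvalues \<sigma> \<alpha> \<and> diagonal_frame \<alpha> (s_mat p) (z0 \<sigma> d) (eta0 \<sigma> d)" if d: "d \<in> ?U" for d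
    proof -
      obtain p \<alpha> where p: "p \<in> d" "diagonal_representative p \<alpha>" "ordered_eigenvalues \<sigma> \<alpha>"
        and s: "s_mat p $ 2 $ 1 \<noteq> 0" "s_mat p $ 3 $ 1 \<noteq> 0" and dt: "d \<in> triple_reduced_product lam mu nu"
        using d by (auto simp: coordinate_domain_def)
      note ne = ordered_eigenvalues_distinct[OF \<sigma> p(3)]
      have "z0 \<sigma> d = zfun (diag_mat \<alpha>) (s_mat p) (axis 1 1)" "eta0 \<sigma> d = etafun (diag_mat \<alpha>) (s_mat p) (axis 1 1)"
        using solution_point_eq(1)[OF \<sigma> dt p s] by (simp_all add: z0_def eta0_def)
      then have "diagonal_frame \<alpha> (s_mat p) (z0 \<sigma> d) (eta0 \<sigma> d)"
        using linear_system_diagonal[of \<alpha> "s_mat p" "z0 \<sigma> d" "eta0 \<sigma> d"] ne s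
        by unfold_locales simp_all
      then show ?thesis using p triple_reduced_productD[OF dt p(1)] by blast
    qed
    obtain p \<alpha> where p: "p \<in> zero_level lam mu nu" "diagonal_representative p \<alpha>" "ordered_eigenvalues \<sigma> \<alpha>"
      "c = conj_class p" "diagonal_frame \<alpha> (s_mat p) z (eta0 \<sigma> c)"
      using frame[OF c] unfolding z_def by blast
    obtain q \<beta> where q: "q \<in> zero_level lam mu nu" "diagonal_representative q \<beta>" "ordered_eigenvalues \<sigma> \<beta>"
      "c' = conj_class q" "diagonal_frame \<beta> (s_mat q) z (eta0 \<sigma> c)"
      using frame[OF c'] unfolding z(3) e by blast
    show "c = c'"
      unfolding p(4) q(4) by (rule coordinates_injective[OF \<sigma> zs p(1-3) q(1-3) p(5) q(5) z(1,2)])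
  qed
  moreover have "?U \<subseteq> triple_reduced_product lam mu nu" by (auto simp: coordinate_domain_def)
  ultimately show ?thesis unfolding darboux_coordinates_on_def darboux_at_def by blast
qed

theorem mainTheorem3:
  fixes lam mu nu :: "real^3"
  assumes "(\<Sum>j\<in>UNIV. lam $ j) = 0" and "(\<Sum>j\<in>UNIV. mu $ j) = 0" and "(\<Sum>j\<in>UNIV. nu $ j) = 0"
  shows
    "(\<forall>c \<in> triple_reduced_product lam mu nu. \<exists>p\<in>c. \<exists>\<alpha>. diagonal_representative p \<alpha>) \<and>
     (\<forall>c \<in> triple_reduced_product lam mu nu. \<forall>p\<in>c. \<forall>\<alpha> s.
        diagonal_representative p \<alpha> \<and> s = s_mat p \<longrightarrow>
        (\<forall>z. L_mat p z = mat z ** diag_mat \<alpha> + s) \<and>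
        (\<forall>z \<eta>. (L_mat p z - mat \<eta>) ** L_tilde p z \<eta> = mat (det (L_mat p z - mat \<eta>)) \<and>
           L_tilde p z \<eta> $ 2 $ 1 =
             - s $ 2 $ 1 * (\<alpha> $ 3 * z - \<eta> + s $ 3 $ 3) + s $ 3 $ 1 * s $ 2 $ 3 \<and>
           L_tilde p z \<eta> $ 3 $ 1 =
             - s $ 3 $ 1 * (\<alpha> $ 2 * z - \<eta> + s $ 2 $ 2) + s $ 2 $ 1 * s $ 3 $ 2) \<and>
        (\<alpha> $ 2 \<noteq> \<alpha> $ 3 \<and> s $ 2 $ 1 \<noteq> 0 \<and> s $ 3 $ 1 \<noteq> 0 \<longrightarrow>
           (\<exists>!q. common_zero p q) \<and>
           (\<forall>z \<eta>. common_zero p (z, \<eta>) \<longrightarrow> L_tilde p z \<eta> $ 1 $ 1 = 0))) \<and>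
     (\<forall>\<sigma>. bij \<sigma> \<longrightarrow>
        (\<forall>c \<in> coordinate_domain lam mu nu \<sigma>. \<forall>p\<in>c. \<forall>\<alpha>.
           diagonal_representative p \<alpha> \<and> ordered_eigenvalues \<sigma> \<alpha> \<longrightarrow>
           (\<forall>z \<eta>. common_zero p (z, \<eta>) \<longleftrightarrow> z = z0 \<sigma> c \<and> \<eta> = eta0 \<sigma> c)) \<and>
        darboux_coordinates_on lam mu nu (coordinate_domain lam mu nu \<sigma>) (z0 \<sigma>) (zeta0 \<sigma>))"
proof (intro conjI ballI allI impI)
  fix c assume c: "c \<in> triple_reduced_product lam mu nu"
  then obtain p where p: "p \<in> c" using conj_class_self unfolding triple_reduced_product_def by blast
  obtain X Y Z where pe: "p = (X, Y, Z)" by (metis prod_cases3)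
  have "hermitian_adjoint (Y - Z) = - (Y - Z)"
    using zero_levelD(3,4) triple_reduced_productD(1)[OF c p] by (simp add: pe hermitian_adjoint_diff)
  then obtain g \<alpha> where g: "g \<in> SU3" "Ad g (Y - Z) = diag_mat \<alpha>"
    using unitary_diagonalization by blast
  have "diagonal_representative (diagonal_action g p) \<alpha>"
    using g(2) by (simp add: pe diagonal_representative_def diagonal_action_def Ad_diff)
  moreover have "diagonal_action g p \<in> c"
    using triple_reduced_productD(2)[OF c p] g(1) by (auto simp: conj_class_def)
  ultimately show "\<exists>p\<in>c. \<exists>\<alpha>. diagonal_representative p \<alpha>" by blast
next
  fix c p \<alpha> s
  assume "diagonal_representative p \<alpha> \<and> s = s_mat p"
  then have d: "diagonal_representative p \<alpha>" and s: "s = s_mat p" by auto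
  show "L_mat p z = mat z ** diag_mat \<alpha> + s" for z
    unfolding s by (rule L_mat_diagonal[OF d])
  show "(L_mat p z - mat \<eta>) ** L_tilde p z \<eta> = mat (det (L_mat p z - mat \<eta>))" for z \<eta>
    unfolding L_tilde_def by (rule cofactor_matrix_mult)
  show "L_tilde p z \<eta> $ 2 $ 1 = - s $ 2 $ 1 * (\<alpha> $ 3 * z - \<eta> + s $ 3 $ 3) + s $ 3 $ 1 * s $ 2 $ 3"
    "L_tilde p z \<eta> $ 3 $ 1 = - s $ 3 $ 1 * (\<alpha> $ 2 * z - \<eta> + s $ 2 $ 2) + s $ 2 $ 1 * s $ 3 $ 2" for z \<eta>
    unfolding s by (rule L_tilde_diagonal[OF d])+
  assume "\<alpha> $ 2 \<noteq> \<alpha> $ 3 \<and> s $ 2 $ 1 \<noteq> 0 \<and> s $ 3 $ 1 \<noteq> 0"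
  then have ne: "\<alpha> $ 2 \<noteq> \<alpha> $ 3" "s_mat p $ 2 $ 1 \<noteq> 0" "s_mat p $ 3 $ 1 \<noteq> 0" by (auto simp: s)
  show "\<exists>!q. common_zero p q"
    using common_zero_iff[OF d ne] by auto
  show "L_tilde p z \<eta> $ 1 $ 1 = 0" if "common_zero p (z, \<eta>)" for z \<eta>
    by (rule common_zero_L_tilde_11[OF d ne(2,3) that])
next
  fix \<sigma> :: "3 \<Rightarrow> 3" and c p \<alpha> z \<eta>
  assume \<sigma>: "bij \<sigma>" and c: "c \<in> coordinate_domain lam mu nu \<sigma>" and p: "p \<in> c"
    and "diagonal_representative p \<alpha> \<and> ordered_eigenvalues \<sigma> \<alpha>"
  then have d: "diagonal_representative p \<alpha>" "ordered_eigenvalues \<sigma> \<alpha>" by auto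
  obtain p1 \<alpha>1 where p1: "p1 \<in> c" "diagonal_representative p1 \<alpha>1" "ordered_eigenvalues \<sigma> \<alpha>1"
    "s_mat p1 $ 2 $ 1 \<noteq> 0" "s_mat p1 $ 3 $ 1 \<noteq> 0" and ct: "c \<in> triple_reduced_product lam mu nu"
    using c by (auto simp: coordinate_domain_def)
  show "common_zero p (z, \<eta>) \<longleftrightarrow> z = z0 \<sigma> c \<and> \<eta> = eta0 \<sigma> c"
    unfolding solution_point_eq(2)[OF \<sigma> ct p1 p d] z0_def eta0_def by (simp add: prod_eq_iff)
next
  fix \<sigma> :: "3 \<Rightarrow> 3"
  assume "bij \<sigma>"
  then show "darboux_coordinates_on lam mu nu (coordinate_domain lam mu nu \<sigma>) (z0 \<sigma>) (zeta0 \<sigma>)"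
    using assms(2,3) by (rule darboux_coordinates)
qed

end
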